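(* Let $\mathcal{Z}\subset\mathrm{Sym}(p)$ be a linear subspace satisfying (Z0) and (Z1) with respect to an ordered partition $(n_1,\dots,n_r)$ of $p$, and let $A\in\mathrm{Sym}^+(p)$ and $s\in\mathbb{R}$. The integral $\int_{\mathcal{Z}\cap\mathrm{Sym}^+(p)}(\det x)^s e^{-\operatorname{tr}(Ax)}\,\mathrm{d}x$ converges if and only if $s>\max\{-\frac{2+m_{i,\alpha}}{2\mu_{i,\alpha}}: i\in[r],\alpha\in[d_i]\}$, and in that case it equals $$e^{-p_{\mathcal{Z}}s-q_{\mathcal{Z}}}\prod_{i\in[r]}\prod_{\alpha\in[d_i]}\Big\{\Gamma\Big(\mu_{i,\alpha}s+1+\frac{m_{i,\alpha}}{2}\Big)\Big(\frac{\det\phi_{i,\alpha}(A)}{\det\psi_{i,\alpha}(A)}\Big)^{-\mu_{i,\alpha}s-1-m_{i,\alpha}/2}(\det\psi_{i,\alpha}(A))^{-1/2}\Big\},$$ where $p_{\mathcal{Z}}=\sum_{i\in[r]}\sum_{\alpha\in[d_i]}\mu_{i,\alpha}\log\mu_{i,\alpha}$, $q_{\mathcal{Z}}=\frac12\sum_{i\in[r]}\sum_{\alpha\in[d_i]}\{(\log\mu_{i,\alpha}-\log(2\pi))m_{i,\alpha}+\log\mu_{i,\alpha}\}$, and $\det\psi_{i,\alpha}(A)$ is interpreted as $1$ when $m_{i,\alpha}=0$.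
   Context: Block notation: for an ordered partition $(n_1,\dots,n_r)$ of $p$, write $x\in\mathrm{Sym}(p)$ in blocks $X_{kh}\in\mathbb{R}^{n_k\times n_h}$. $\mathrm{BlockTri}(x)$ keeps the blocks $X_{kh}$ with $k\ge h$ and zeroes the others. For a linear subspace $\mathcal{Z}\subset\mathrm{Sym}(p)$: $M_i(\mathcal{Z})=\{x\in\mathcal{Z}: X_{kh}=0$ unless $(k,h)=(i,i)\}$, $L_i(\mathcal{Z})=\{x\in\mathcal{Z}: X_{kh}=0$ unless $k>h=i$ or $h>k=i\}$. (Z0): $I_p\in\mathcal{Z}$ and $\mathcal{Z}=(\bigoplus_{i\in[r]}M_i(\mathcal{Z}))\oplus(\bigoplus_{i\in[r-1]}L_i(\mathcal{Z}))$; (Z1): $\mathrm{BlockTri}(x)\mathrm{BlockTri}(x)^\top\in\mathcal{Z}$ for all $x\in\mathcal{Z}$. Structure constants: $e^{(i)}$ is the $p\times p$ matrix with $(i,i)$ block $I_{n_i}$ and other blocks $0$; $M_i(\mathcal{Z})$ is a Euclidean Jordan algebra under $x\circ y=(xy+yx)/2$ with identity $e^{(i)}$, and $\{c^{(i)}_\alpha\}_{\alpha\in[d_i]}$ is a Jordan frame (maximal family of nonzero mutually orthogonal idempotents in $M_i(\mathcal{Z})$ summing to $e^{(i)}$). $\mu_{i,\alpha}=\operatorname{rank}c^{(i)}_\alpha$, $\tilde e^{(i)}_\alpha=c^{(i)}_\alpha/\sqrt{\mu_{i,\alpha}}$, $c^{(i)}_{>\alpha}=\sum_{\beta>\alpha}c^{(i)}_\beta$,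 $\mathfrak{h}_{i,\alpha}=c^{(i)}_{>\alpha}M_i(\mathcal{Z})c^{(i)}_\alpha\oplus L_i(\mathcal{Z})c^{(i)}_\alpha\subset\mathbb{R}^{p\times p}$ with orthonormal basis $\{\tilde f^{(i)}_\gamma\}_{\gamma\in J_{i,\alpha}}$ for $\langle X,Y\rangle=\operatorname{tr}(XY^\top)$, and $m_{i,\alpha}=\dim\mathfrak{h}_{i,\alpha}$. For $A\in\mathrm{Sym}(p)$: $\lambda_{i,\alpha}(A)=\operatorname{tr}(A\tilde e^{(i)}_\alpha\tilde e^{(i)}_\alpha)$; if $m_{i,\alpha}>0$, $v_{i,\alpha}(A)\in\mathbb{R}^{1\times m_{i,\alpha}}$ has entries $\operatorname{tr}(A\tilde e^{(i)}_\alpha(\tilde f^{(i)}_\gamma)^\top)$, $\psi_{i,\alpha}(A)\in\mathrm{Sym}(m_{i,\alpha})$ has entries $\operatorname{tr}(A\tilde f^{(i)}_\gamma(\tilde f^{(i)}_{\gamma'})^\top)$, and $\phi_{i,\alpha}(A)=\begin{bmatrix}\lambda_{i,\alpha}(A)&v_{i,\alpha}(A)\\ v_{i,\alpha}(A)^\top&\psi_{i,\alpha}(A)\end{bmatrix}$; if $m_{i,\alpha}=0$, $\phi_{i,\alpha}(A)=\lambda_{i,\alpha}(A)$. Lebesgue measure $\mathrm{d}x$ on $\mathcal{Z}$: if $(J_k)_k$ is an orthonormal basis of $\mathcal{Z}$ for the trace inner product and $x=\sum_k\alpha_kJ_k$, then $\mathrm{d}x=\prod_k\mathrm{d}\alpha_k$.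 *)

theory Defs
  imports "HOL-Analysis.Analysis" "HOL-Probability.Probability"
begin

text \<open>p x p real matrices are \<open>real^'n^'n\<close> with \<open>p = CARD('n)\<close>.  An ordered partition
  \<open>(n_1,...,n_r)\<close> of \<open>p\<close> is encoded by a block-assignment map \<open>blk :: 'n \<Rightarrow> nat\<close>
  (index \<open>a\<close> lies in block \<open>blk a\<close>, blocks numbered \<open>0..<r\<close>), which is monotone for the
  linear order of the index type (so blocks are consecutive intervals) and onto \<open>{..<r}\<close>
  (so all parts are nonempty).\<close>

definition ordered_partition :: "('n::{finite,linorder} \<Rightarrow> nat) \<Rightarrow> nat \<Rightarrow> bool" where
  "ordered_partition blk r \<longleftrightarrow> mono blk \<and> range blk = {..<r}"

definition Sym :: "(real^'n^'n) set" where
  "Sym = {x. transpose x = x}"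

definition pos_def_mat :: "real^'n^'n \<Rightarrow> bool" where
  "pos_def_mat x \<longleftrightarrow> transpose x = x \<and> (\<forall>v. v \<noteq> 0 \<longrightarrow> v \<bullet> (x *v v) > 0)"

definition SymPos :: "(real^'n^'n) set" where
  "SymPos = {x. pos_def_mat x}"

definition BlockTri :: "('n \<Rightarrow> nat) \<Rightarrow> real^'n^'n \<Rightarrow> real^'n^'n" where
  "BlockTri blk x = (\<chi> a b. if blk a \<ge> blk b then x$a$b else 0)"

definition Mblk :: "('n \<Rightarrow> nat) \<Rightarrow> (real^'n^'n) set \<Rightarrow> nat \<Rightarrow> (real^'n^'n) set" where
  "Mblk blk Z i = {x \<in> Z. \<forall>a b. x$a$b \<noteq> 0 \<longrightarrow> (blk a = i \<and> blk b = i)}"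

definition Lblk :: "('n \<Rightarrow> nat) \<Rightarrow> (real^'n^'n) set \<Rightarrow> nat \<Rightarrow> (real^'n^'n) set" where
  "Lblk blk Z i = {x \<in> Z. \<forall>a b. x$a$b \<noteq> 0 \<longrightarrow>
      ((blk a > blk b \<and> blk b = i) \<or> (blk b > blk a \<and> blk a = i))}"

text \<open>(Z0). The sum of the subspaces M_i(Z), L_i(Z) is automatically direct (disjoint supports).\<close>
definition condZ0 :: "('n::finite \<Rightarrow> nat) \<Rightarrow> nat \<Rightarrow> (real^'n^'n) set \<Rightarrow> bool" where
  "condZ0 blk r Z \<longleftrightarrow> mat 1 \<in> Z \<and>
     Z = {(\<Sum>i<r. M i) + (\<Sum>i<r-1. L i) | M L.
            (\<forall>i<r. M i \<in> Mblk blk Z i) \<and> (\<forall>i<r-1. L i \<in> Lblk blk Z i)}"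

definition condZ1 :: "('n::finite \<Rightarrow> nat) \<Rightarrow> (real^'n^'n) set \<Rightarrow> bool" where
  "condZ1 blk Z \<longleftrightarrow> (\<forall>x\<in>Z. BlockTri blk x ** transpose (BlockTri blk x) \<in> Z)"

definition eblk :: "('n::finite \<Rightarrow> nat) \<Rightarrow> nat \<Rightarrow> real^'n^'n" where
  "eblk blk i = (\<chi> a b. if a = b \<and> blk a = i then 1 else 0)"

definition jprod :: "real^'n^'n \<Rightarrow> real^'n^'n \<Rightarrow> real^'n^'n" where
  "jprod x y = (1/2) *\<^sub>R (x ** y + y ** x)"

definition orth_idem_family :: "(real^'n^'n) set \<Rightarrow> (nat \<Rightarrow> real^'n^'n) \<Rightarrow> nat \<Rightarrow> bool" where
  "orth_idem_family J c k \<longleftrightarrow>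
     (\<forall>\<alpha><k. c \<alpha> \<in> J \<and> c \<alpha> \<noteq> 0 \<and> jprod (c \<alpha>) (c \<alpha>) = c \<alpha>) \<and>
     (\<forall>\<alpha><k. \<forall>\<beta><k. \<alpha> \<noteq> \<beta> \<longrightarrow> jprod (c \<alpha>) (c \<beta>) = 0)"

definition jordan_frame :: "(real^'n^'n) set \<Rightarrow> real^'n^'n \<Rightarrow> (nat \<Rightarrow> real^'n^'n) \<Rightarrow> nat \<Rightarrow> bool" where
  "jordan_frame J e c d \<longleftrightarrow> orth_idem_family J c d \<and> (\<Sum>\<alpha><d. c \<alpha>) = e \<and>
     (\<forall>c' k. orth_idem_family J c' k \<longrightarrow> k \<le> d)"

definition hspace :: "('n::finite \<Rightarrow> nat) \<Rightarrow> (real^'n^'n) set \<Rightarrow> nat \<Rightarrow> (nat \<Rightarrow> real^'n^'n) \<Rightarrow> nat \<Rightarrow> nat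
    \<Rightarrow> (real^'n^'n) set" where
  "hspace blk Z i c d \<alpha> =
     {(\<Sum>\<beta>\<in>{\<alpha><..<d}. c \<beta>) ** y ** c \<alpha> + l ** c \<alpha> | y l. y \<in> Mblk blk Z i \<and> l \<in> Lblk blk Z i}"

definition orthonormal_basis :: "(real^'n^'n) set \<Rightarrow> (nat \<Rightarrow> real^'n^'n) \<Rightarrow> nat \<Rightarrow> bool" where
  "orthonormal_basis V f k \<longleftrightarrow> (\<forall>\<gamma><k. f \<gamma> \<in> V \<and> f \<gamma> \<bullet> f \<gamma> = 1) \<and>
     (\<forall>\<gamma><k. \<forall>\<gamma>'<k. \<gamma> \<noteq> \<gamma>' \<longrightarrow> f \<gamma> \<bullet> f \<gamma>' = 0) \<and> span (f ` {..<k}) = V"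

definition det_n :: "nat \<Rightarrow> (nat \<Rightarrow> nat \<Rightarrow> real) \<Rightarrow> real" where
  "det_n n M = (\<Sum>\<sigma> | \<sigma> permutes {..<n}. of_int (sign \<sigma>) * (\<Prod>k<n. M k (\<sigma> k)))"

text \<open>phi(A) as a (1+m) x (1+m) matrix for unit vector etilde and basis f (index 0 = etilde);
  psi(A) as the m x m lower-right block.  For m = 0, det psi = 1 (empty determinant).\<close>
definition phi_entries :: "real^'n^'n \<Rightarrow> real^'n^'n \<Rightarrow> (nat \<Rightarrow> real^'n^'n) \<Rightarrow> nat \<Rightarrow> nat \<Rightarrow> real" where
  "phi_entries A et f a b =
     (let g = (\<lambda>k. if k = 0 then et else f (k - 1)) in trace (A ** g a ** transpose (g b)))"

definition psi_entries :: "real^'n^'n \<Rightarrow> (nat \<Rightarrow> real^'n^'n) \<Rightarrow> nat \<Rightarrow> nat \<Rightarrow> real" where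
  "psi_entries A f a b = trace (A ** f a ** transpose (f b))"

text \<open>Coordinates of Z w.r.t. an orthonormal basis J_0..J_{N-1}: Lebesgue measure on Z.\<close>
definition coord_measure :: "nat \<Rightarrow> (nat \<Rightarrow> real) measure" where
  "coord_measure N = (\<Pi>\<^sub>M k\<in>{..<N}. lborel)"

definition from_coords :: "(nat \<Rightarrow> real^'n^'n) \<Rightarrow> nat \<Rightarrow> (nat \<Rightarrow> real) \<Rightarrow> real^'n^'n" where
  "from_coords J N t = (\<Sum>k<N. t k *\<^sub>R J k)"

definition wishart_integrand :: "real^'n^'n \<Rightarrow> real \<Rightarrow> (nat \<Rightarrow> real^'n^'n) \<Rightarrow> nat \<Rightarrow> (nat \<Rightarrow> real) \<Rightarrow> real" where
  "wishart_integrand A s J N t =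
     (let x = from_coords J N t in
        indicator SymPos x * (det x powr s * exp (- trace (A ** x))))"


text \<open>Structure constants, for a choice of Jordan frames \<open>c i\<close> (length \<open>d i\<close>) of \<open>M_i(Z)\<close>
  and orthonormal bases \<open>f i \<alpha>\<close> of \<open>h_{i,\<alpha>}\<close>.\<close>
definition mu_sc :: "(nat \<Rightarrow> nat \<Rightarrow> real^'n^'n) \<Rightarrow> nat \<Rightarrow> nat \<Rightarrow> nat" where
  "mu_sc c i \<alpha> = rank (c i \<alpha>)"

definition m_sc :: "('n::finite \<Rightarrow> nat) \<Rightarrow> (real^'n^'n) set \<Rightarrow> (nat \<Rightarrow> nat \<Rightarrow> real^'n^'n) \<Rightarrow> (nat \<Rightarrow> nat)
    \<Rightarrow> nat \<Rightarrow> nat \<Rightarrow> nat" where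
  "m_sc blk Z c d i \<alpha> = dim (hspace blk Z i (c i) (d i) \<alpha>)"

definition etilde :: "(nat \<Rightarrow> nat \<Rightarrow> real^'n^'n) \<Rightarrow> nat \<Rightarrow> nat \<Rightarrow> real^'n^'n" where
  "etilde c i \<alpha> = (1 / sqrt (real (mu_sc c i \<alpha>))) *\<^sub>R c i \<alpha>"

text \<open>det phi_{i,alpha}(A) (equals lambda_{i,alpha}(A) when m = 0) and det psi_{i,alpha}(A)
  (equals 1 when m = 0).\<close>
definition det_phi :: "('n::finite \<Rightarrow> nat) \<Rightarrow> (real^'n^'n) set \<Rightarrow> (nat \<Rightarrow> nat \<Rightarrow> real^'n^'n) \<Rightarrow> (nat \<Rightarrow> nat)
    \<Rightarrow> (nat \<Rightarrow> nat \<Rightarrow> nat \<Rightarrow> real^'n^'n) \<Rightarrow> real^'n^'n \<Rightarrow> nat \<Rightarrow> nat \<Rightarrow> real" where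
  "det_phi blk Z c d f A i \<alpha> =
     det_n (m_sc blk Z c d i \<alpha> + 1) (phi_entries A (etilde c i \<alpha>) (f i \<alpha>))"

definition det_psi :: "('n::finite \<Rightarrow> nat) \<Rightarrow> (real^'n^'n) set \<Rightarrow> (nat \<Rightarrow> nat \<Rightarrow> real^'n^'n) \<Rightarrow> (nat \<Rightarrow> nat)
    \<Rightarrow> (nat \<Rightarrow> nat \<Rightarrow> nat \<Rightarrow> real^'n^'n) \<Rightarrow> real^'n^'n \<Rightarrow> nat \<Rightarrow> nat \<Rightarrow> real" where
  "det_psi blk Z c d f A i \<alpha> =
     (if m_sc blk Z c d i \<alpha> = 0 then 1 else det_n (m_sc blk Z c d i \<alpha>) (psi_entries A (f i \<alpha>)))"

end

theory Submission
  imports Defs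
begin

text \<open>Order the idempotents \<open>c i \<alpha>\<close> lexicographically and let \<open>Q\<close> be the sum of those after
  \<open>c = c i \<alpha>\<close>. An element of \<open>Z\<close> living on \<open>c + Q\<close> is \<open>x = l c + b + b\<^sup>T + y\<close> with
  \<open>b\<close> in the space \<open>hspace\<close> and \<open>y\<close> living on \<open>Q\<close>; here (Z0), (Z1) and the primitivity of \<open>c\<close> are used.
  Since moreover \<open>b b\<^sup>T\<close> lies in \<open>Z\<close>, one may translate \<open>y\<close> by \<open>b b\<^sup>T / l\<close>, after which the Schur
  complement formula separates the variables: \<open>det x = l\<^bsup>rank c\<^esup> det y\<close> and
  \<open>tr (A x) = tr (A (l c + b) (l c + b)\<^sup>T) / l + tr (A y)\<close>. The integral over \<open>b\<close> is Gaussian, with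
  Gram matrix \<open>\<phi>(A)\<close> for the full quadratic form, the integral over \<open>l\<close> is then a Gamma integral, and
  the integral over \<open>y\<close> is of the same kind with \<open>c + Q\<close> replaced by \<open>Q\<close>. As all factors are positive,
  the whole integral converges iff each Gamma integral does. Lebesgue measure on a subspace is handled as
  an iterated integral along an orthonormal basis, which is shown not to depend on the basis.\<close>

section \<open>Iterated integrals over subspaces\<close>

text \<open>Everything is computed in \<open>ennreal\<close>, where Tonelli and the product of the
  factors make sense before convergence is known, so that the criterion and the value come out of
  one identity. In the integral over \<open>l\<close>, the exponent of \<open>l\<close> is
  \<open>mu * s\<close> from the determinant plus \<open>1 / 2\<close> for each of the
  \<open>m\<close> Gaussian directions of \<open>b\<close>, whose width grows like
  \<open>sqrt l\<close>; integrability at 0 of that power is the stated bound on \<open>s\<close>.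
  The powers of \<open>mu\<close> and of 2 come from orthonormal coordinates: the unit vector along
  \<open>c\<close> is \<open>c / sqrt mu\<close>, and \<open>b + transpose b\<close> is longer than
  \<open>b\<close> by the factor \<open>sqrt 2\<close>. The algebraic obstacle is that
  \<open>Z\<close> is not closed under matrix products. (Z1) only yields Jordan products inside a
  diagonal block, multiplication of an off-diagonal block by a diagonal one, and products of an
  off-diagonal block with its own transpose. The closure properties needed for one idempotent are
  assembled from these three and handed to the analytic step as assumptions of a locale. Primitivity
  enters through maximality of the Jordan frame, which forces the compression of \<open>Z\<close> to
  \<open>c\<close> to be one-dimensional.\<close>

primrec iter_integral :: "'a::euclidean_space list \<Rightarrow> ('a \<Rightarrow> ennreal) \<Rightarrow> ennreal" where
  "iter_integral [] g = g 0"
| "iter_integral (v # vs) g = (\<integral>\<^sup>+ t. iter_integral vs (\<lambda>x. g (t *\<^sub>R v + x)) \<partial>lborel)"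

lemma iter_integral_append:
  "iter_integral (vs @ ws) g = iter_integral vs (\<lambda>x. iter_integral ws (\<lambda>y. g (x + y)))"
  by (induction vs arbitrary: g) (simp_all add: add.assoc)

text \<open>Integrands below are rewritten by formulas that hold only on a subspace of matrices, so
  congruence has to be relative to the span.\<close>

lemma iter_integral_cong_span:
  assumes "\<And>x. x \<in> span (set vs) \<Longrightarrow> g x = h x"
  shows "iter_integral vs g = iter_integral vs h"
  using assms
proof (induction vs arbitrary: g h)
  case (Cons v vs)
  have "iter_integral vs (\<lambda>x. g (t *\<^sub>R v + x)) = iter_integral vs (\<lambda>x. h (t *\<^sub>R v + x))" for t
  proof (rule Cons.IH)
    fix x assume "x \<in> span (set vs)"
    then have "x \<in> span (set (v # vs))"
      using span_mono[OF set_subset_Cons] by blast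
    then show "g (t *\<^sub>R v + x) = h (t *\<^sub>R v + x)"
      using span_base[of v "set (v # vs)"] by (intro Cons.prems span_add span_mul) auto
  qed
  then show ?case by simp
qed simp

text \<open>The induction moves \<open>t *\<^sub>R v\<close> into the argument of the integrand; the
  extra shift \<open>z\<close>, with joint measurability in both parameters, makes the hypothesis
  strong enough for that.\<close>

lemma borel_measurable_iter_integral_shift:
  fixes g :: "'b \<Rightarrow> 'a::euclidean_space \<Rightarrow> ennreal"
  assumes "(\<lambda>(y, x). g y x) \<in> borel_measurable (M \<Otimes>\<^sub>M borel)"
  shows "(\<lambda>(y, z). iter_integral vs (\<lambda>x. g y (z + x))) \<in> borel_measurable (M \<Otimes>\<^sub>M borel)"
proof (induction vs)
  case Nil
  then show ?case using assms by simp
next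
  case (Cons v vs)
  have [measurable]: "(\<lambda>p. (\<lambda>(y, z). iter_integral vs (\<lambda>x. g y (z + x))) (fst (fst p), snd (fst p) + snd p *\<^sub>R v))
      \<in> borel_measurable ((M \<Otimes>\<^sub>M borel) \<Otimes>\<^sub>M lborel)"
    by (rule measurable_compose[OF _ Cons.IH]) measurable
  have "(\<lambda>p. \<integral>\<^sup>+ t. (\<lambda>(y, z). iter_integral vs (\<lambda>x. g y (z + x))) (fst p, snd p + t *\<^sub>R v) \<partial>lborel)
      \<in> borel_measurable (M \<Otimes>\<^sub>M borel)"
    by (rule sigma_finite_measure.borel_measurable_nn_integral)
       (use \<open>_ \<in> borel_measurable ((M \<Otimes>\<^sub>M borel) \<Otimes>\<^sub>M lborel)\<close> in \<open>simp_all add: case_prod_beta' sigma_finite_lborel\<close>)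
  then show ?case
    by (simp add: case_prod_beta' add.assoc)
qed

lemma borel_measurable_iter_integral:
  fixes g :: "'b \<Rightarrow> 'a::euclidean_space \<Rightarrow> ennreal"
  assumes "(\<lambda>(y, x). g y x) \<in> borel_measurable (M \<Otimes>\<^sub>M borel)"
  shows "(\<lambda>y. iter_integral vs (g y)) \<in> borel_measurable M"
proof -
  have "(\<lambda>y. (\<lambda>(y, z). iter_integral vs (\<lambda>x. g y (z + x))) (y, 0)) \<in> borel_measurable M"
    by (rule measurable_compose[OF _ borel_measurable_iter_integral_shift[OF assms]]) measurable
  then show ?thesis by simp
qed

lemma borel_measurable_iter_integral_translate [measurable]:
  fixes g :: "'a::euclidean_space \<Rightarrow> ennreal"
  assumes [measurable]: "g \<in> borel_measurable borel" and [measurable]: "h \<in> measurable M borel"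
  shows "(\<lambda>y. iter_integral vs (\<lambda>x. g (h y + x))) \<in> borel_measurable M"
  by (rule borel_measurable_iter_integral) measurable

lemma iter_integral_cmult:
  assumes [measurable]: "g \<in> borel_measurable borel"
  shows "iter_integral vs (\<lambda>x. c * g x) = c * iter_integral vs g"
  using assms
proof (induction vs arbitrary: g)
  case (Cons v vs)
  note [measurable] = Cons.prems
  have "iter_integral (v # vs) (\<lambda>x. c * g x) = (\<integral>\<^sup>+ t. c * iter_integral vs (\<lambda>x. g (t *\<^sub>R v + x)) \<partial>lborel)"
    by (simp add: Cons.IH)
  also have "\<dots> = c * iter_integral (v # vs) g"
    by (simp add: nn_integral_cmult)
  finally show ?case .
qed simp

lemma iter_integral_multc:
  assumes "g \<in> borel_measurable borel"
  shows "iter_integral vs (\<lambda>x. g x * c) = iter_integral vs g * c"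
  using iter_integral_cmult[OF assms, of vs c] by (simp add: mult.commute)

lemma iter_integral_lborel_swap:
  fixes k :: "real \<Rightarrow> 'a::euclidean_space \<Rightarrow> ennreal"
  assumes "(\<lambda>(t, y). k t y) \<in> borel_measurable (borel \<Otimes>\<^sub>M borel)"
  shows "(\<integral>\<^sup>+ t. iter_integral ws (k t) \<partial>lborel) = iter_integral ws (\<lambda>y. \<integral>\<^sup>+ t. k t y \<partial>lborel)"
  using assms
proof (induction ws arbitrary: k)
  case (Cons w ws)
  note [measurable] = Cons.prems
  have m: "(\<lambda>(t, u). iter_integral ws (\<lambda>x. k t (u *\<^sub>R w + x))) \<in> borel_measurable (borel \<Otimes>\<^sub>M borel)"
    using borel_measurable_iter_integral[of "\<lambda>(t, u) x. k t (u *\<^sub>R w + x)" "borel \<Otimes>\<^sub>M borel" ws]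
    by (simp add: case_prod_beta')
  have "(\<integral>\<^sup>+ t. iter_integral (w # ws) (k t) \<partial>lborel)
      = (\<integral>\<^sup>+ u. (\<integral>\<^sup>+ t. iter_integral ws (\<lambda>x. k t (u *\<^sub>R w + x)) \<partial>lborel) \<partial>lborel)"
  proof -
    have "(\<lambda>(u, t). iter_integral ws (\<lambda>x. k t (u *\<^sub>R w + x))) \<in> borel_measurable (lborel \<Otimes>\<^sub>M lborel)"
      using measurable_compose[OF measurable_pair_swap' m] by (simp add: case_prod_beta' cong: measurable_cong_sets)
    from lborel_pair.Fubini'[OF this] show ?thesis by simp
  qed
  also have "\<dots> = iter_integral (w # ws) (\<lambda>y. \<integral>\<^sup>+ t. k t y \<partial>lborel)"
    by (simp, intro nn_integral_cong Cons.IH) measurable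
  finally show ?case .
qed simp

lemma iter_integral_swap:
  fixes h :: "'a::euclidean_space \<Rightarrow> 'a \<Rightarrow> ennreal"
  assumes "(\<lambda>(x, y). h x y) \<in> borel_measurable (borel \<Otimes>\<^sub>M borel)"
  shows "iter_integral vs (\<lambda>x. iter_integral ws (h x)) = iter_integral ws (\<lambda>y. iter_integral vs (\<lambda>x. h x y))"
  using assms
proof (induction vs arbitrary: h)
  case (Cons v vs)
  note [measurable] = Cons.prems
  have "(\<lambda>p. iter_integral vs (\<lambda>x. h (fst p *\<^sub>R v + x) (snd p))) \<in> borel_measurable (borel \<Otimes>\<^sub>M borel)"
    by (rule borel_measurable_iter_integral) measurable
  then have m: "(\<lambda>(t, y). iter_integral vs (\<lambda>x. h (t *\<^sub>R v + x) y)) \<in> borel_measurable (borel \<Otimes>\<^sub>M borel)"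
    by (simp add: case_prod_beta')
  have "iter_integral (v # vs) (\<lambda>x. iter_integral ws (h x))
      = (\<integral>\<^sup>+ t. iter_integral ws (\<lambda>y. iter_integral vs (\<lambda>x. h (t *\<^sub>R v + x) y)) \<partial>lborel)"
    by (simp, intro nn_integral_cong Cons.IH) measurable
  also have "\<dots> = iter_integral ws (\<lambda>y. iter_integral (v # vs) (\<lambda>x. h x y))"
    using iter_integral_lborel_swap[OF m] by simp
  finally show ?case .
qed simp

text \<open>The component of \<open>w\<close> along \<open>v\<close> is absorbed by translation
  invariance of \<open>lborel\<close>, the remainder by induction.\<close>

lemma iter_integral_translate:
  assumes "g \<in> borel_measurable borel" "w \<in> span (set vs)"
  shows "iter_integral vs (\<lambda>x. g (x + w)) = iter_integral vs g"
  using assms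
proof (induction vs arbitrary: g w)
  case (Cons v vs)
  note [measurable] = Cons.prems(1)
  obtain k where k: "w - k *\<^sub>R v \<in> span (set vs)"
    using Cons.prems(2) by (auto simp: span_insert)
  \<comment> \<open>The shape \<open>k + 1 * t\<close> is the one produced by the affine
    substitution with slope 1 below.\<close>
  have *: "iter_integral vs (\<lambda>x. g (t *\<^sub>R v + x + w)) = iter_integral vs (\<lambda>x. g ((k + 1 * t) *\<^sub>R v + x))" for t
    using Cons.IH[of "\<lambda>x. g ((k + 1 * t) *\<^sub>R v + x)", OF _ k] by (simp add: algebra_simps)
  show ?case
    by (simp only: iter_integral.simps *)
       (subst (2) nn_integral_real_affine[where c=1 and t=k], simp_all)
qed simp

lemma iter_integral_scale:
  assumes "g \<in> borel_measurable borel" "a \<noteq> 0"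
  shows "iter_integral vs g = ennreal (\<bar>a\<bar> ^ length vs) * iter_integral vs (\<lambda>x. g (a *\<^sub>R x))"
  using assms
proof (induction vs arbitrary: g)
  case (Cons v vs)
  note [measurable] = Cons.prems(1)
  have "iter_integral (v # vs) g = \<bar>a\<bar> * (\<integral>\<^sup>+ t. iter_integral vs (\<lambda>x. g ((0 + a * t) *\<^sub>R v + x)) \<partial>lborel)"
    by (simp only: iter_integral.simps, rule nn_integral_real_affine) (use \<open>a \<noteq> 0\<close> in simp_all)
  also have "\<dots> = \<bar>a\<bar> * (\<integral>\<^sup>+ t. ennreal (\<bar>a\<bar> ^ length vs) * iter_integral vs (\<lambda>x. g ((0 + a * t) *\<^sub>R v + a *\<^sub>R x)) \<partial>lborel)"
    by (subst Cons.IH) (use \<open>a \<noteq> 0\<close> in simp_all)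
  also have "\<dots> = \<bar>a\<bar> * (ennreal (\<bar>a\<bar> ^ length vs) * (\<integral>\<^sup>+ t. iter_integral vs (\<lambda>x. g (a *\<^sub>R (t *\<^sub>R v + x))) \<partial>lborel))"
  proof -
    have "(\<lambda>t. iter_integral vs (\<lambda>x. g ((0 + a * t) *\<^sub>R v + a *\<^sub>R x))) \<in> borel_measurable lborel"
      by (rule borel_measurable_iter_integral) measurable
    then show ?thesis
      by (subst nn_integral_cmult) (simp_all add: scaleR_add_right)
  qed
  also have "\<dots> = ennreal (\<bar>a\<bar> ^ length (v # vs)) * iter_integral (v # vs) (\<lambda>x. g (a *\<^sub>R x))"
    by (simp add: ennreal_mult mult.assoc)
  finally show ?case .
qed simp

text \<open>No Jacobian appears because the variables of integration are the coefficients, which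
  \<open>L\<close> leaves alone.\<close>

lemma iter_integral_linear_image:
  assumes "linear L"
  shows "iter_integral (map L vs) g = iter_integral vs (\<lambda>x. g (L x))"
  by (induction vs arbitrary: g) (simp_all add: assms linear_0 linear_add linear_scale)

section \<open>Orthonormal lists: independence of the integral from the basis\<close>

definition orthonormal_list :: "'a::euclidean_space list \<Rightarrow> bool" where
  "orthonormal_list vs \<longleftrightarrow> distinct vs \<and> pairwise orthogonal (set vs) \<and> (\<forall>v\<in>set vs. norm v = 1)"

lemma nn_integral_exp_neg_square: "(\<integral>\<^sup>+ t. ennreal (exp (- t\<^sup>2)) \<partial>(lborel :: real measure)) = ennreal (sqrt pi)"
proof -
  \<comment> \<open>Standard deviation \<open>1 / sqrt 2\<close> makes the exponent of the normal
    density equal to \<open>- t\<^sup>2\<close>.\<close>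
  have "(\<integral>\<^sup>+ t. ennreal (normal_density 0 (1 / sqrt 2) t) \<partial>lborel) = 1"
    by (subst nn_integral_eq_integral) auto
  moreover have "normal_density 0 (1 / sqrt 2) t = 1 / sqrt pi * exp (- t\<^sup>2)" for t
    by (simp add: normal_density_def power_divide)
  ultimately have "ennreal (1 / sqrt pi) * (\<integral>\<^sup>+ t. ennreal (exp (- t\<^sup>2)) \<partial>(lborel :: real measure)) = 1"
    by (subst nn_integral_cmult[symmetric]) (simp_all add: ennreal_mult[symmetric])
  then have "ennreal (sqrt pi) * (ennreal (1 / sqrt pi) * (\<integral>\<^sup>+ t. ennreal (exp (- t\<^sup>2)) \<partial>(lborel :: real measure))) = ennreal (sqrt pi)"
    by simp
  then show ?thesis
    by (simp add: mult.assoc[symmetric] ennreal_mult[symmetric])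
qed

text \<open>The shift \<open>z\<close> collects the coordinates already fixed; it stays orthogonal
  to the remaining vectors, so Pythagoras separates the variables.\<close>

lemma iter_integral_norm_gaussian:
  assumes "orthonormal_list vs" "\<And>v. v \<in> set vs \<Longrightarrow> z \<bullet> v = 0"
  shows "iter_integral vs (\<lambda>x. ennreal (exp (- (norm (z + x))\<^sup>2))) = ennreal (sqrt pi ^ length vs * exp (- (norm z)\<^sup>2))"
  using assms
proof (induction vs arbitrary: z)
  case (Cons v vs)
  have on: "orthonormal_list vs" "norm v = 1" "\<And>u. u \<in> set vs \<Longrightarrow> v \<bullet> u = 0" "z \<bullet> v = 0"
    using Cons.prems by (auto simp: orthonormal_list_def pairwise_insert orthogonal_def)
  have nz: "(norm (z + t *\<^sub>R v))\<^sup>2 = (norm z)\<^sup>2 + t\<^sup>2" for t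
  proof -
    have "(norm (z + t *\<^sub>R v))\<^sup>2 = z \<bullet> z + 2 * t * (z \<bullet> v) + t * t * (v \<bullet> v)"
      unfolding power2_norm_eq_inner by (simp add: inner_simps inner_commute)
    also have "\<dots> = (norm z)\<^sup>2 + t\<^sup>2"
      using on(2,4) by (simp add: norm_eq_1 power2_norm_eq_inner) (simp add: power2_eq_square)
    finally show ?thesis .
  qed
  have "iter_integral vs (\<lambda>x. ennreal (exp (- (norm (z + (t *\<^sub>R v + x)))\<^sup>2)))
      = ennreal (sqrt pi ^ length vs * exp (- (norm z)\<^sup>2)) * ennreal (exp (- t\<^sup>2))" for t
  proof -
    have "exp (- ((norm z)\<^sup>2 + t\<^sup>2)) = exp (- (norm z)\<^sup>2) * exp (- t\<^sup>2)"
      by (simp add: exp_add[symmetric])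
    with Cons.IH[of "z + t *\<^sub>R v"] on Cons.prems(2) show ?thesis
      by (simp add: inner_left_distrib nz add.assoc ennreal_mult[symmetric] mult.assoc)
  qed
  then have "iter_integral (v # vs) (\<lambda>x. ennreal (exp (- (norm (z + x))\<^sup>2)))
      = ennreal (sqrt pi ^ length vs * exp (- (norm z)\<^sup>2)) * ennreal (sqrt pi)"
    by (simp add: nn_integral_cmult nn_integral_exp_neg_square)
  then show ?case
    by (simp add: ennreal_mult[symmetric] mult_ac)
qed simp

text \<open>The argument for uniqueness of Haar measure: the double integral of
  \<open>g x * G (y + x)\<close>, with \<open>x\<close> along \<open>vs\<close> and \<open>y\<close>
  along \<open>ws\<close>, is evaluated in both orders. By translation invariance each order leaves
  the integral of \<open>g\<close> along one list times the Gaussian mass \<open>K\<close>, which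
  depends only on the dimension.\<close>

lemma iter_integral_orthonormal_cong:
  fixes g :: "'a::euclidean_space \<Rightarrow> ennreal"
  assumes vs: "orthonormal_list vs" and ws: "orthonormal_list ws" and span: "span (set vs) = span (set ws)"
    and [measurable]: "g \<in> borel_measurable borel"
  shows "iter_integral vs g = iter_integral ws g"
proof -
  have len: "length us = dim (span (set us))" if "orthonormal_list us" for us :: "'a list"
  proof -
    have "0 \<notin> set us"
      using that by (auto simp: orthonormal_list_def)
    then show ?thesis
      using that unfolding orthonormal_list_def
      by (metis dim_span_eq_card_independent pairwise_orthogonal_independent distinct_card)
  qed
  define G where "G = (\<lambda>x::'a. ennreal (exp (- (norm x)\<^sup>2)))"
  have [measurable]: "G \<in> borel_measurable borel" by (simp add: G_def)
  define K where "K = ennreal (sqrt pi ^ dim (span (set ws)))"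
  have G: "iter_integral vs G = K" "iter_integral ws G = K"
    using iter_integral_norm_gaussian[OF vs, of 0] iter_integral_norm_gaussian[OF ws, of 0]
      len[OF vs] len[OF ws] span by (simp_all add: G_def K_def)
  have "iter_integral vs g * K = iter_integral vs (\<lambda>x. g x * iter_integral ws (\<lambda>y. G (y + x)))"
    by (subst iter_integral_multc[symmetric]) (auto intro!: iter_integral_cong_span simp: iter_integral_translate span G)
  also have "\<dots> = iter_integral vs (\<lambda>x. iter_integral ws (\<lambda>y. g x * G (y + x)))"
    by (simp add: iter_integral_cmult)
  also have "\<dots> = iter_integral ws (\<lambda>y. iter_integral vs (\<lambda>x. g x * G (y + x)))"
    by (rule iter_integral_swap) measurable
  \<comment> \<open>Translation of the inner variable by \<open>y\<close>, which lies in the common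
    span.\<close>
  also have "\<dots> = iter_integral ws (\<lambda>y. iter_integral vs (\<lambda>x. g (x - y) * G x))"
  proof (rule iter_integral_cong_span)
    fix y assume "y \<in> span (set ws)"
    then have "y \<in> span (set vs)" by (simp add: span)
    from iter_integral_translate[of "\<lambda>x. g (x - y) * G x", OF _ this]
    show "iter_integral vs (\<lambda>x. g x * G (y + x)) = iter_integral vs (\<lambda>x. g (x - y) * G x)"
      by (simp add: add.commute)
  qed
  also have "\<dots> = iter_integral vs (\<lambda>x. iter_integral ws (\<lambda>y. g (x - y) * G x))"
    by (rule iter_integral_swap[symmetric]) measurable
  \<comment> \<open>Reflecting \<open>y\<close> and then translating by \<open>x\<close> turns
    \<open>g (x - y)\<close> into \<open>g y\<close>, so that the inner integral no longer depends
    on \<open>x\<close>.\<close>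
  also have "\<dots> = iter_integral vs (\<lambda>x. iter_integral ws g * G x)"
  proof (rule iter_integral_cong_span)
    fix x assume "x \<in> span (set vs)"
    then have x: "x \<in> span (set ws)" by (simp add: span)
    have "iter_integral ws (\<lambda>y. g (x - y)) = iter_integral ws (\<lambda>y. g (y + x))"
      by (subst iter_integral_scale[of _ "-1"]) (auto simp: add.commute)
    also have "\<dots> = iter_integral ws g"
      using x by (intro iter_integral_translate) auto
    finally show "iter_integral ws (\<lambda>y. g (x - y) * G x) = iter_integral ws g * G x"
      by (simp add: iter_integral_multc)
  qed
  also have "\<dots> = iter_integral ws g * K"
    by (simp add: iter_integral_cmult G)
  finally have "iter_integral vs g * K = iter_integral ws g * K" .
  \<comment> \<open>Cancelling \<open>K\<close> in \<open>ennreal\<close> requires it to be finite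
    and nonzero, which is why the auxiliary weight is a Gaussian.\<close>
  moreover have "K \<noteq> 0" "K \<noteq> top" by (simp_all add: K_def)
  ultimately show ?thesis
    by (simp add: mult.commute[of _ K] ennreal_mult_cancel_left)
qed

text \<open>The induction splits off the last coordinate and integrates it innermost, in agreement
  with the order of the list.\<close>

lemma nn_integral_coord_measure:
  fixes g :: "'a::euclidean_space \<Rightarrow> ennreal"
  assumes "g \<in> borel_measurable borel"
  shows "(\<integral>\<^sup>+ t. g (\<Sum>k<N. t k *\<^sub>R J k) \<partial>coord_measure N) = iter_integral (map J [0..<N]) g"
  using assms
proof (induction N arbitrary: g)
  case 0
  then show ?case by (simp add: coord_measure_def PiM_empty nn_integral_count_space_finite)
next
  case (Suc N)
  note [measurable] = Suc.prems
  interpret product_sigma_finite "\<lambda>_::nat. lborel :: real measure" ..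
  have "(\<integral>\<^sup>+ t. g (\<Sum>k<Suc N. t k *\<^sub>R J k) \<partial>coord_measure (Suc N))
      = (\<integral>\<^sup>+ t. (\<integral>\<^sup>+ u. g ((\<Sum>k<N. t k *\<^sub>R J k) + u *\<^sub>R J N) \<partial>lborel) \<partial>coord_measure N)"
    unfolding coord_measure_def lessThan_Suc
    by (subst product_nn_integral_insert) (simp_all add: add.commute)
  also have "\<dots> = iter_integral (map J [0..<N]) (\<lambda>x. \<integral>\<^sup>+ u. g (x + u *\<^sub>R J N) \<partial>lborel)"
    by (rule Suc.IH) measurable
  also have "\<dots> = iter_integral (map J [0..<Suc N]) g"
    by (simp add: iter_integral_append)
  finally show ?case .
qed

section \<open>Gram determinants and Gaussian integrals\<close>

lemma det_n_cong:
  assumes "\<And>i j. i < n \<Longrightarrow> j < n \<Longrightarrow> M i j = M' i j"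
  shows "det_n n M = det_n n M'"
  unfolding det_n_def
  by (intro sum.cong refl arg_cong2[where f="(*)"] prod.cong) (use assms permutes_in_image in fastforce)+

text \<open>Composing a permutation with the transposition of \<open>i\<close> and \<open>j\<close>
  flips its sign and keeps its product of entries, so the determinant equals its own
  negative.\<close>

lemma det_n_identical_rows:
  assumes ij: "i < n" "j < n" "i \<noteq> j" and eq: "\<And>k. k < n \<Longrightarrow> M i k = M j k"
  shows "det_n n M = 0"
proof -
  define \<tau> where "\<tau> = Transposition.transpose i j"
  have \<tau>: "\<tau> permutes {..<n}"
    unfolding \<tau>_def using ij by (intro permutes_swap_id) auto
  let ?f = "\<lambda>\<sigma>. of_int (sign \<sigma>) * (\<Prod>k<n. M k (\<sigma> k))"
  have "?f (\<sigma> \<circ> \<tau>) = - ?f \<sigma>" if \<sigma>: "\<sigma> permutes {..<n}" for \<sigma>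
  proof -
    have "sign (\<sigma> \<circ> \<tau>) = - sign \<sigma>"
      using \<sigma> \<tau> ij(3) by (simp add: sign_compose permutation_permutes[THEN iffD2] sign_swap_id \<tau>_def)
        (metis finite_lessThan mult.right_neutral mult_minus_right permutation_permutes permutation_swap_id sign_compose sign_swap_id)
    moreover have "(\<Prod>k<n. M k ((\<sigma> \<circ> \<tau>) k)) = (\<Prod>k<n. M (\<tau> k) (\<sigma> (\<tau> k)))"
    proof (rule prod.cong)
      fix k assume "k \<in> {..<n}"
      then have "\<sigma> (\<tau> k) < n"
        using \<sigma> \<tau> by (metis lessThan_iff permutes_in_image)
      then show "M k ((\<sigma> \<circ> \<tau>) k) = M (\<tau> k) (\<sigma> (\<tau> k))"
        using eq by (auto simp: \<tau>_def Transposition.transpose_def)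
    qed simp
    moreover have "(\<Prod>k<n. M (\<tau> k) (\<sigma> (\<tau> k))) = (\<Prod>k<n. M k (\<sigma> k))"
      using prod.permute[OF \<tau>, of "\<lambda>k. M k (\<sigma> k)"] by (simp add: o_def)
    ultimately show ?thesis by simp
  qed
  then have "det_n n M = - det_n n M"
    unfolding det_n_def
    by (subst sum_permutations_compose_right[OF \<tau>]) (simp add: sum_negf)
  then show ?thesis by simp
qed

lemma det_n_row_add:
  assumes "i < n"
  shows "det_n n (\<lambda>k l. if k = i then a l + c * b l else M k l)
    = det_n n (\<lambda>k l. if k = i then a l else M k l) + c * det_n n (\<lambda>k l. if k = i then b l else M k l)"
proof -
  have *: "(\<Prod>k<n. if k = i then h (\<sigma> k) else M k (\<sigma> k)) = h (\<sigma> i) * (\<Prod>k\<in>{..<n} - {i}. M k (\<sigma> k))"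
    for h and \<sigma> :: "nat \<Rightarrow> nat"
    using assms by (subst prod.remove[of _ i]) (auto intro!: arg_cong2[where f="(*)"] prod.cong)
  show ?thesis
    unfolding det_n_def *[of a] *[of b] *[of "\<lambda>l. a l + c * b l"] sum_distrib_left sum.distrib[symmetric]
    by (intro sum.cong refl) (simp add: algebra_simps)
qed

lemma det_n_last_column_zero:
  assumes "\<And>k. k < n \<Longrightarrow> M k n = 0"
  shows "det_n (Suc n) M = M n n * det_n n M"
proof -
  let ?f = "\<lambda>\<sigma>. of_int (sign \<sigma>) * (\<Prod>k<Suc n. M k (\<sigma> k))"
  have "det_n (Suc n) M = (\<Sum>b\<in>insert n {..<n}. \<Sum>q | q permutes {..<n}. ?f (Transposition.transpose n b \<circ> q))"
    unfolding det_n_def lessThan_Suc by (rule sum_over_permutations_insert) auto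
  also have "\<dots> = (\<Sum>q | q permutes {..<n}. ?f (Transposition.transpose n n \<circ> q))
      + (\<Sum>b<n. \<Sum>q | q permutes {..<n}. ?f (Transposition.transpose n b \<circ> q))"
    by (rule sum.insert) auto
  also have "(\<Sum>b<n. \<Sum>q | q permutes {..<n}. ?f (Transposition.transpose n b \<circ> q)) = 0"
  proof (intro sum.neutral ballI)
    fix b q assume b: "b \<in> {..<n}" and q: "q \<in> {q. q permutes {..<n}}"
    \<comment> \<open>\<open>q\<close> takes the value \<open>b\<close> at some
      \<open>k < n\<close>, and the transposition turns this value into \<open>n\<close>; the
      product then contains the entry \<open>M k n\<close> of the vanishing column.\<close>
    then obtain k where k: "k < n" "q k = b"
      by (metis mem_Collect_eq permutes_image imageE lessThan_iff)
    then have "(\<Prod>k<Suc n. M k ((Transposition.transpose n b \<circ> q) k)) = 0"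
      using assms by (intro prod_zero) (auto intro!: bexI[of _ k])
    then show "?f (Transposition.transpose n b \<circ> q) = 0" by simp
  qed
  also have "(\<Sum>q | q permutes {..<n}. ?f (Transposition.transpose n n \<circ> q)) = M n n * det_n n M"
    unfolding det_n_def sum_distrib_left
    by (intro sum.cong refl) (simp add: permutes_not_in mult_ac)
  finally show ?thesis by simp
qed

text \<open>Gaussian elimination with the last row as pivot row. In \<open>E S\<close> the last
  column is already cleared in the rows of \<open>S\<close>; clearing one more row adds a multiple
  of a determinant with two equal rows.\<close>

lemma det_n_Schur:
  assumes "M n n \<noteq> 0"
  shows "det_n (Suc n) M = M n n * det_n n (\<lambda>i j. M i j - M i n * M n j / M n n)"
proof -
  define E where "E S = (\<lambda>k l. if k \<in> S then M k l - M k n / M n n * M n l else M k l)" for S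
  have "det_n (Suc n) (E S) = det_n (Suc n) M" if "finite S" "S \<subseteq> {..<n}" for S
    using that
  proof (induction S)
    case empty
    then show ?case by (simp add: E_def)
  next
    case (insert i S)
    then have i: "i < n" "i \<notin> S" "n \<notin> S" by auto
    have "E (insert i S) = (\<lambda>k l. if k = i then M i l + (- (M i n / M n n)) * M n l else E S k l)"
      by (auto simp: E_def fun_eq_iff)
    then have "det_n (Suc n) (E (insert i S)) = det_n (Suc n) (\<lambda>k l. if k = i then M i l else E S k l)
        + (- (M i n / M n n)) * det_n (Suc n) (\<lambda>k l. if k = i then M n l else E S k l)"
      using i by (simp only: det_n_row_add[of i "Suc n"])
    also have "(\<lambda>k l. if k = i then M i l else E S k l) = E S"
      using i by (auto simp: E_def fun_eq_iff)
    also have "det_n (Suc n) (\<lambda>k l. if k = i then M n l else E S k l) = 0"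
      using i by (intro det_n_identical_rows[of i _ n]) (auto simp: E_def)
    finally show ?case using insert by simp
  qed
  then have "det_n (Suc n) M = det_n (Suc n) (E {..<n})"
    by simp
  also have "\<dots> = E {..<n} n n * det_n n (E {..<n})"
    using assms by (intro det_n_last_column_zero) (simp add: E_def)
  also have "det_n n (E {..<n}) = det_n n (\<lambda>i j. M i j - M i n * M n j / M n n)"
    by (rule det_n_cong) (simp add: E_def)
  finally show ?thesis by (simp add: E_def)
qed

text \<open>Stated through coefficient vectors, so that for bilinear \<open>B\<close> it also
  contains the linear independence of \<open>g 0\<close>, ..., \<open>g (n - 1)\<close>.\<close>

definition pos_on :: "('a::real_vector \<Rightarrow> 'a \<Rightarrow> real) \<Rightarrow> (nat \<Rightarrow> 'a) \<Rightarrow> nat \<Rightarrow> bool" where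
  "pos_on B g n \<longleftrightarrow> (\<forall>x. (\<exists>i<n. x i \<noteq> 0) \<longrightarrow> 0 < B (\<Sum>i<n. x i *\<^sub>R g i) (\<Sum>i<n. x i *\<^sub>R g i))"

text \<open>For symmetric bilinear \<open>B\<close> with \<open>B v v \<noteq> 0\<close> this is
  \<open>B\<close> evaluated at the \<open>B\<close>-orthogonal projections of \<open>x\<close> and
  \<open>y\<close> off \<open>v\<close>; on Gram matrices it is the Schur complement of the pivot
  \<open>B v v\<close>.\<close>

definition proj_form :: "('a \<Rightarrow> 'a \<Rightarrow> real) \<Rightarrow> 'a \<Rightarrow> 'a \<Rightarrow> 'a \<Rightarrow> real" where
  "proj_form B v x y = B x y - B x v * B v y / B v v"

lemma bilinear_proj_form:
  assumes "bilinear B"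
  shows "bilinear (proj_form B v)"
  using assms unfolding proj_form_def bilinear_def linear_iff
  by (simp add: algebra_simps add_divide_distrib)

lemma proj_form_square:
  assumes "bilinear B" "\<And>x y. B x y = B y x" "B v v \<noteq> 0"
  shows "B (y + a *\<^sub>R v) (y + a *\<^sub>R v) = proj_form B v y y + B v v * (a + B y v / B v v)\<^sup>2"
  using assms(3)
  by (simp add: bilinear_ladd[OF assms(1)] bilinear_radd[OF assms(1)] bilinear_lmul[OF assms(1)]
      bilinear_rmul[OF assms(1)] proj_form_def assms(2)[of v y] power2_eq_square field_simps)

lemma pos_on_last:
  assumes "pos_on B g (Suc n)"
  shows "0 < B (g n) (g n)"
proof -
  have "(\<Sum>i<Suc n. (if i = n then 1 else 0) *\<^sub>R g i) = g n"
    by (simp add: if_distrib[of "\<lambda>c. c *\<^sub>R _"] cong: if_cong)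
  then show ?thesis
    using assms[unfolded pos_on_def, rule_format, of "\<lambda>i. if i = n then 1 else 0"] by auto
qed

lemma pos_on_proj_form:
  assumes B: "bilinear B" "\<And>x y. B x y = B y x" and pos: "pos_on B g (Suc n)"
  shows "pos_on (proj_form B (g n)) g n"
  unfolding pos_on_def
proof (intro allI impI)
  fix x :: "nat \<Rightarrow> real" assume x: "\<exists>i<n. x i \<noteq> 0"
  define y where "y = (\<Sum>i<n. x i *\<^sub>R g i)"
  have v: "B (g n) (g n) \<noteq> 0" using pos_on_last[OF pos] by simp
  \<comment> \<open>The coefficient of \<open>g n\<close> at which the square in
    \<open>proj_form_square\<close> vanishes.\<close>
  define a where "a = - B y (g n) / B (g n) (g n)"
  have "(\<Sum>i<Suc n. (x(n := a)) i *\<^sub>R g i) = y + a *\<^sub>R g n"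
    by (simp add: y_def)
  moreover have "\<exists>i<Suc n. (x(n := a)) i \<noteq> 0"
    using x by (metis fun_upd_other less_SucI nat_neq_iff)
  ultimately have "0 < B (y + a *\<^sub>R g n) (y + a *\<^sub>R g n)"
    using pos unfolding pos_on_def by metis
  then show "0 < proj_form B (g n) y y"
    unfolding proj_form_square[OF B v] by (simp add: a_def)
qed

lemma det_n_gram_Suc:
  assumes "pos_on B g (Suc n)"
  shows "det_n (Suc n) (\<lambda>i j. B (g i) (g j))
    = B (g n) (g n) * det_n n (\<lambda>i j. proj_form B (g n) (g i) (g j))"
  using pos_on_last[OF assms] by (subst det_n_Schur) (auto simp: proj_form_def)

text \<open>The determinant is the product of the elimination pivots, and each pivot is a value of a
  positive form.\<close>

lemma det_n_gram_pos:
  assumes "bilinear B" "\<And>x y. B x y = B y x" "pos_on B g n"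
  shows "0 < det_n n (\<lambda>i j. B (g i) (g j))"
  using assms
proof (induction n arbitrary: B)
  case 0
  then show ?case by (simp add: det_n_def)
next
  case (Suc n)
  have "0 < det_n n (\<lambda>i j. proj_form B (g n) (g i) (g j))"
    by (rule Suc.IH) (use Suc.prems in \<open>auto simp: bilinear_proj_form pos_on_proj_form, simp add: proj_form_def mult.commute Suc.prems(2)\<close>)
  then show ?case
    using Suc.prems by (simp add: det_n_gram_Suc pos_on_last)
qed

text \<open>Dropping the first vector is the passage from the matrix of phi to that of psi.\<close>

lemma pos_on_tail:
  assumes "pos_on B g (Suc n)"
  shows "pos_on B (g \<circ> Suc) n"
  unfolding pos_on_def
proof (intro allI impI)
  fix x :: "nat \<Rightarrow> real" assume "\<exists>i<n. x i \<noteq> 0"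
  then have "\<exists>i<Suc n. case_nat 0 x i \<noteq> 0"
    by (metis Suc_less_eq nat.case(2))
  then have "0 < B (\<Sum>i<Suc n. case_nat 0 x i *\<^sub>R g i) (\<Sum>i<Suc n. case_nat 0 x i *\<^sub>R g i)"
    using assms unfolding pos_on_def by metis
  then show "0 < B (\<Sum>i<n. x i *\<^sub>R (g \<circ> Suc) i) (\<Sum>i<n. x i *\<^sub>R (g \<circ> Suc) i)"
    by (simp only: sum.lessThan_Suc_shift) simp
qed

section \<open>Gaussian integrals\<close>

lemma nn_integral_shifted_gaussian:
  assumes "0 < q"
  shows "(\<integral>\<^sup>+ t. ennreal (exp (- (q * (t + b)\<^sup>2))) \<partial>lborel) = ennreal (sqrt (pi / q))"
proof -
  have "(\<integral>\<^sup>+ t. ennreal (exp (- (q * (t + b)\<^sup>2))) \<partial>lborel)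
     = ennreal (1 / sqrt q) * (\<integral>\<^sup>+ t. ennreal (exp (- t\<^sup>2)) \<partial>(lborel :: real measure))"
    using assms by (subst nn_integral_real_affine[where c = "1 / sqrt q" and t = "- b"]) (auto simp: power_divide)
  then show ?thesis
    using assms by (simp add: nn_integral_exp_neg_square ennreal_mult[symmetric] real_sqrt_divide)
qed

lemma borel_measurable_bilinear_diag:
  fixes B :: "'a::euclidean_space \<Rightarrow> 'a \<Rightarrow> real"
  assumes "bilinear B"
  shows "(\<lambda>x. B x x) \<in> borel_measurable borel"
proof -
  have "continuous_on UNIV (\<lambda>x. B x x)"
    by (rule bilinear_continuous_on_compose[OF continuous_on_id continuous_on_id assms])
  then show ?thesis by (rule borel_measurable_continuous_onI)
qed

text \<open>Integrating out the last variable replaces \<open>B\<close> by its Schur complement \<open>proj_form B v\<close>,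
  which divides both Gram determinants by the same pivot.\<close>
lemma iter_integral_gaussian:
  fixes g :: "nat \<Rightarrow> 'a::euclidean_space"
  assumes "bilinear B" "\<And>x y. B x y = B y x" "pos_on B g (Suc m)"
  shows "iter_integral (map (g \<circ> Suc) [0..<m]) (\<lambda>b. ennreal (exp (- B (\<tau> *\<^sub>R g 0 + b) (\<tau> *\<^sub>R g 0 + b))))
    = ennreal (sqrt pi ^ m * det_n m (\<lambda>i j. B (g (Suc i)) (g (Suc j))) powr (- 1 / 2)
        * exp (- (\<tau>\<^sup>2 * (det_n (Suc m) (\<lambda>i j. B (g i) (g j)) / det_n m (\<lambda>i j. B (g (Suc i)) (g (Suc j)))))))"
  using assms
proof (induction m arbitrary: B)
  case 0
  have "det_n (Suc 0) (\<lambda>i j. B (g i) (g j)) = B (g 0) (g 0)"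
    using det_n_gram_Suc[OF 0(3)] by (simp add: det_n_def)
  then show ?case
    by (simp add: bilinear_lmul[OF 0(1)] bilinear_rmul[OF 0(1)] power2_eq_square) (simp add: det_n_def)
next
  case (Suc m)
  define v where "v = g (Suc m)"
  let ?B = "proj_form B v"
  have q: "0 < B v v" using pos_on_last[OF Suc.prems(3)] by (simp add: v_def)
  have B': "bilinear ?B" "\<And>x y. ?B x y = ?B y x" "pos_on ?B g (Suc m)"
    using Suc.prems by (auto simp: bilinear_proj_form pos_on_proj_form v_def, simp add: proj_form_def mult.commute Suc.prems(2))
  define K where "K = sqrt (pi / B v v)"
  define D where "D = det_n (Suc m) (\<lambda>i j. ?B (g i) (g j))"
  define P where "P = det_n m (\<lambda>i j. ?B (g (Suc i)) (g (Suc j)))"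
  have P: "0 < P" unfolding P_def
    using det_n_gram_pos[OF B'(1,2) pos_on_tail[OF B'(3)]] by simp
  have detD: "det_n (Suc (Suc m)) (\<lambda>i j. B (g i) (g j)) = B v v * D"
    using det_n_gram_Suc[OF Suc.prems(3)] by (simp add: D_def v_def)
  have detP: "det_n (Suc m) (\<lambda>i j. B (g (Suc i)) (g (Suc j))) = B v v * P"
    using det_n_gram_Suc[OF pos_on_tail[OF Suc.prems(3)]] by (simp add: P_def v_def)
  have inner: "(\<integral>\<^sup>+ t. ennreal (exp (- B (\<tau> *\<^sub>R g 0 + (x + t *\<^sub>R v)) (\<tau> *\<^sub>R g 0 + (x + t *\<^sub>R v)))) \<partial>lborel)
      = ennreal K * ennreal (exp (- ?B (\<tau> *\<^sub>R g 0 + x) (\<tau> *\<^sub>R g 0 + x)))" for x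
  proof -
    define y where "y = \<tau> *\<^sub>R g 0 + x"
    have "ennreal (exp (- B (\<tau> *\<^sub>R g 0 + (x + t *\<^sub>R v)) (\<tau> *\<^sub>R g 0 + (x + t *\<^sub>R v))))
        = ennreal (exp (- ?B y y)) * ennreal (exp (- (B v v * (t + B y v / B v v)\<^sup>2)))" for t
      using proj_form_square[OF Suc.prems(1,2), of v y t] q
      by (simp add: y_def add.assoc ennreal_mult[symmetric] exp_add[symmetric])
    then show ?thesis
      using q by (simp add: nn_integral_cmult nn_integral_shifted_gaussian K_def y_def mult.commute)
  qed
  have "iter_integral (map (g \<circ> Suc) [0..<Suc m]) (\<lambda>b. ennreal (exp (- B (\<tau> *\<^sub>R g 0 + b) (\<tau> *\<^sub>R g 0 + b))))
      = iter_integral (map (g \<circ> Suc) [0..<m]) (\<lambda>x. ennreal K * ennreal (exp (- ?B (\<tau> *\<^sub>R g 0 + x) (\<tau> *\<^sub>R g 0 + x))))"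
    by (simp add: iter_integral_append inner[unfolded v_def] v_def)
  also have "\<dots> = ennreal K * iter_integral (map (g \<circ> Suc) [0..<m]) (\<lambda>x. ennreal (exp (- ?B (\<tau> *\<^sub>R g 0 + x) (\<tau> *\<^sub>R g 0 + x))))"
    using borel_measurable_bilinear_diag[OF B'(1)]
    by (intro iter_integral_cmult) (measurable, rule measurable_compose[where N=borel], measurable)
  also have "\<dots> = ennreal K * ennreal (sqrt pi ^ m * P powr (- 1 / 2) * exp (- (\<tau>\<^sup>2 * (D / P))))"
    unfolding Suc.IH[OF B'] P_def D_def ..
  also have "\<dots> = ennreal (sqrt pi ^ Suc m * (B v v * P) powr (- 1 / 2) * exp (- (\<tau>\<^sup>2 * ((B v v * D) / (B v v * P)))))"
    using q P by (simp add: ennreal_mult[symmetric] K_def powr_mult powr_minus powr_half_sqrt real_sqrt_divide field_simps)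
  finally show ?case by (simp only: detD detP)
qed

section \<open>Symmetric idempotents and Schur complements\<close>

lemma bounded_bilinear_matrix_mult: "bounded_bilinear ((**) :: real^'n^'m \<Rightarrow> real^'p^'n \<Rightarrow> real^'p^'m)"
proof -
  have "bilinear ((**) :: real^'n^'m \<Rightarrow> real^'p^'n \<Rightarrow> real^'p^'m)"
    unfolding bilinear_def linear_iff
    by (auto simp: matrix_matrix_mult_def vec_eq_iff sum.distrib distrib_left distrib_right sum_distrib_left mult_ac)
  then show ?thesis by (simp add: bilinear_conv_bounded_bilinear)
qed

interpretation mmult: bounded_bilinear "(**) :: real^'n^'m \<Rightarrow> real^'p^'n \<Rightarrow> real^'p^'m"
  by (rule bounded_bilinear_matrix_mult)

lemma bounded_linear_transpose: "bounded_linear (transpose :: real^'n^'m \<Rightarrow> real^'m^'n)"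
  by (intro linear_conv_bounded_linear[THEN iffD1]) (auto simp: linear_iff transpose_def vec_eq_iff)

lemmas transpose_linear_simps =
  linear_add[OF bounded_linear.linear[OF bounded_linear_transpose]]
  linear_diff[OF bounded_linear.linear[OF bounded_linear_transpose]]
  linear_scale[OF bounded_linear.linear[OF bounded_linear_transpose]]
  linear_neg[OF bounded_linear.linear[OF bounded_linear_transpose]]

lemma transpose_zero: "transpose 0 = (0 :: real^'n^'m)"
  by (rule linear_0[OF bounded_linear.linear[OF bounded_linear_transpose]])

lemma linear_trace: "linear (trace :: real^'n^'n \<Rightarrow> real)"
  by (auto simp: linear_iff trace_def sum.distrib sum_distrib_left)

lemma matrix_mul_assoc': "(A ** B) ** C = A ** (B ** C)"
  for A :: "real^'n^'m"
  by (simp add: matrix_mul_assoc)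

lemmas mat_distribs = mmult.add_left mmult.add_right mmult.diff_left mmult.diff_right
  mmult.scaleR_left mmult.scaleR_right mmult.minus_left mmult.minus_right
  transpose_linear_simps matrix_transpose_mul matrix_mul_assoc'

lemmas mat_zeros = mmult.zero_left mmult.zero_right transpose_zero

text \<open>As a simp rule it would turn \<open>transpose A *v x\<close> into \<open>x v* A\<close>,
  whereas the quadratic forms below are kept in terms of \<open>*v\<close>.\<close>

declare transpose_matrix_vector [simp del]

lemma inner_matrix_trace: "x \<bullet> y = trace (x ** transpose y)"
  for x y :: "real^'n^'m"
  by (simp add: inner_vec_def trace_def matrix_matrix_mult_def transpose_def)

lemma trace_transpose: "trace (transpose A) = trace A"
  by (simp add: trace_def transpose_def)

lemma inner_transpose: "transpose x \<bullet> transpose y = x \<bullet> y"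
  for x y :: "real^'n^'m"
  by (simp add: inner_matrix_trace trace_mul_sym[of "transpose x"] flip: trace_transpose[of "x ** transpose y"] add: matrix_transpose_mul)

lemma dot_mult_transpose: "x \<bullet> (A *v y) = (transpose A *v x) \<bullet> y"
  for A :: "real^'n^'m"
  by (simp add: dot_lmul_matrix transpose_matrix_vector)

lemma quadratic_form_congruence: "v \<bullet> ((T ** y ** transpose T) *v v) = (transpose T *v v) \<bullet> (y *v (transpose T *v v))"
  for y :: "real^'n^'n"
  by (simp only: matrix_vector_mul_assoc[symmetric] dot_mult_transpose[of v T])

lemma pos_def_mat_congruence:
  fixes S T y :: "real^'n^'n"
  assumes T: "S ** T = mat 1" and y: "pos_def_mat y"
  shows "pos_def_mat (T ** y ** transpose T)"
  unfolding pos_def_mat_def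
proof (intro conjI allI impI)
  show "transpose (T ** y ** transpose T) = T ** y ** transpose T"
    using y by (simp add: pos_def_mat_def mat_distribs)
  fix v :: "real^'n" assume "v \<noteq> 0"
  have "transpose T ** transpose S = mat 1"
    using T by (metis matrix_transpose_mul transpose_mat)
  then have "transpose S ** transpose T = mat 1"
    using matrix_left_right_inverse by blast
  then have "transpose S *v (transpose T *v v) = v"
    by (metis matrix_vector_mul_assoc matrix_vector_mul_lid)
  then have "transpose T *v v \<noteq> 0"
    using \<open>v \<noteq> 0\<close> by auto
  then show "0 < v \<bullet> ((T ** y ** transpose T) *v v)"
    using y unfolding quadratic_form_congruence pos_def_mat_def by blast
qed

section \<open>Orthogonal projections and the Schur complement of one of them\<close>

definition sym_idem :: "real^'n^'n \<Rightarrow> bool" where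
  "sym_idem c \<longleftrightarrow> transpose c = c \<and> c ** c = c"

lemma sym_idem_quadratic: "sym_idem c \<Longrightarrow> v \<bullet> (c *v v) = (c *v v) \<bullet> (c *v v)"
  using dot_mult_transpose[of v c "c *v v"] by (simp add: sym_idem_def matrix_vector_mul_assoc)

text \<open>Writing a vector as \<open>c *v v\<close> plus \<open>v - c *v v\<close> splits the
  quadratic form into \<open>l\<close> times a squared norm and a part depending on \<open>R\<close>
  alone, so only the sign of \<open>l\<close> matters.\<close>

lemma pos_def_mat_direct_sum:
  assumes c: "sym_idem c" "c \<noteq> 0" and R: "c ** R = 0" "R ** c = 0"
  shows "pos_def_mat (l *\<^sub>R c + R) \<longleftrightarrow> 0 < l \<and> pos_def_mat (c + R)"
proof -
  have cT: "transpose c = c" "c ** c = c" using c(1) by (auto simp: sym_idem_def)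
  have sym: "transpose (k *\<^sub>R c + R) = k *\<^sub>R c + R \<longleftrightarrow> transpose R = R" for k
    by (simp add: mat_distribs cT)
  have q: "v \<bullet> ((k *\<^sub>R c + R) *v v) = k * ((c *v v) \<bullet> (c *v v)) + (v - c *v v) \<bullet> (R *v (v - c *v v))" for k v
  proof -
    have 1: "R *v (c *v v) = 0" by (simp add: matrix_vector_mul_assoc R)
    have 2: "(c *v v) \<bullet> (R *v w) = 0" for w
      using dot_mult_transpose[of v c "R *v w"] by (simp add: matrix_vector_mul_assoc R cT)
    show ?thesis
      by (simp add: matrix_vector_mult_add_rdistrib inner_add_right inner_diff_left
          matrix_vector_mult_diff_distrib 1 2 sym_idem_quadratic[OF c(1)]
          flip: scaleR_matrix_vector_assoc)
  qed
  have kernel: "0 < u \<bullet> (R *v u)" if "pos_def_mat (k *\<^sub>R c + R)" "u \<noteq> 0" "c *v u = 0" for k u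
  proof -
    have "0 < u \<bullet> ((k *\<^sub>R c + R) *v u)"
      using that unfolding pos_def_mat_def by blast
    then show ?thesis using q[of u k] that(3) by simp
  qed
  have pos: "pos_def_mat (k *\<^sub>R c + R)"
    if k: "0 < k" "transpose R = R" "\<And>u. u \<noteq> 0 \<Longrightarrow> c *v u = 0 \<Longrightarrow> 0 < u \<bullet> (R *v u)" for k
    unfolding pos_def_mat_def
  proof (intro conjI allI impI)
    show "transpose (k *\<^sub>R c + R) = k *\<^sub>R c + R" using k sym by blast
    fix v :: "real^'a" assume "v \<noteq> 0"
    define u where "u = v - c *v v"
    have "c *v u = 0"
      by (simp add: u_def matrix_vector_mult_diff_distrib matrix_vector_mul_assoc cT)
    then have u: "0 < u \<bullet> (R *v u)" if "u \<noteq> 0" using k(3) that by blast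
    have val: "v \<bullet> ((k *\<^sub>R c + R) *v v) = k * ((c *v v) \<bullet> (c *v v)) + u \<bullet> (R *v u)"
      using q[of v k] by (simp add: u_def)
    show "0 < v \<bullet> ((k *\<^sub>R c + R) *v v)"
    proof (cases "u = 0")
      case True
      then have "c *v v \<noteq> 0" using \<open>v \<noteq> 0\<close> by (auto simp: u_def)
      then have "0 < k * ((c *v v) \<bullet> (c *v v))" using k(1) by simp
      then show ?thesis unfolding val True by simp
    next
      case False
      have "0 \<le> k * ((c *v v) \<bullet> (c *v v))" using k(1) by simp
      then show ?thesis unfolding val using u[OF False] by linarith
    qed
  qed
  show ?thesis
  proof (intro iffI conjI)
    assume l: "pos_def_mat (l *\<^sub>R c + R)"
    obtain w where "c *v w \<noteq> 0"
      using c(2) matrix_eq by (metis matrix_vector_mult_0)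
    define v where "v = c *v w"
    have v: "v \<noteq> 0" "c *v v = v"
      using \<open>c *v w \<noteq> 0\<close> by (auto simp: v_def matrix_vector_mul_assoc cT)
    then have "0 < v \<bullet> ((l *\<^sub>R c + R) *v v)"
      using l unfolding pos_def_mat_def by blast
    then have "0 < l * (v \<bullet> v)" unfolding q v(2) by simp
    then show "0 < l" using v(1) by (metis inner_gt_zero_iff zero_less_mult_pos2)
    show "pos_def_mat (c + R)"
      using pos[of 1] kernel[OF l] l sym[of l] by (simp add: pos_def_mat_def)
  next
    assume l: "0 < l \<and> pos_def_mat (c + R)"
    then show "pos_def_mat (l *\<^sub>R c + R)"
      using pos[of l] kernel[of 1] sym[of 1] by (simp add: pos_def_mat_def)
  qed
qed

text \<open>Range and kernel of an orthogonal projection are orthogonal complements; orthonormal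
  bases of the two together form the columns of \<open>U\<close>.\<close>

lemma sym_idem_diagonalize:
  fixes c :: "real^'n^'n"
  assumes c: "sym_idem c"
  obtains U :: "real^'n^'n" and S where "orthogonal_matrix U"
    "transpose U ** c ** U = (\<chi> i j. if i = j \<and> i \<in> S then 1 else 0)" "card S = rank c"
proof -
  have cT: "transpose c = c" "c ** c = c" using c by (auto simp: sym_idem_def)
  have cc: "c *v (c *v v) = c *v v" for v by (simp add: matrix_vector_mul_assoc cT)
  define V where "V = range ((*v) c)"
  define N where "N = {v. c *v v = 0}"
  have sV: "subspace V" unfolding V_def
    by (intro linear_subspace_image) auto
  have sN: "subspace N" unfolding N_def
    by (intro linear_subspace_kernel) auto
  obtain B1 where B1: "B1 \<subseteq> V" "pairwise orthogonal B1" "\<And>x. x \<in> B1 \<Longrightarrow> norm x = 1" "card B1 = dim V" "span B1 = V"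
    using orthonormal_basis_subspace[OF sV] by metis
  obtain B2 where B2: "B2 \<subseteq> N" "pairwise orthogonal B2" "\<And>x. x \<in> B2 \<Longrightarrow> norm x = 1" "card B2 = dim N" "span B2 = N"
    using orthonormal_basis_subspace[OF sN] by metis
  have VN: "x \<bullet> y = 0" if "x \<in> V" "y \<in> N" for x y
    using that dot_mult_transpose[of _ c y] by (auto simp: V_def N_def cT)
  define B where "B = B1 \<union> B2"
  have orth: "pairwise orthogonal B"
    using B1 B2 VN unfolding B_def pairwise_def orthogonal_def
    by (metis UnE inner_commute subsetD)
  have nrm: "norm x = 1" if "x \<in> B" for x using that B1 B2 by (auto simp: B_def)
  have "independent B"
    using nrm by (intro pairwise_orthogonal_independent orth) fastforce
  have "x \<in> span B" for x
  proof -
    have "c *v x \<in> span B1" "x - c *v x \<in> span B2"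
      by (auto simp: B1 B2 V_def N_def matrix_vector_mult_diff_distrib cc)
    then have "c *v x + (x - c *v x) \<in> span B"
      unfolding B_def by (meson span_add span_mono subsetD sup_ge1 sup_ge2)
    then show ?thesis by simp
  qed
  then have "card B = CARD('n)"
    using dim_span_eq_card_independent[OF \<open>independent B\<close>] by (simp add: UNIV_eq_I[symmetric, of "span B"] dim_UNIV)
  then obtain h :: "'n \<Rightarrow> real^'n" where h: "bij_betw h UNIV B"
    using finite_same_card_bij[of "UNIV :: 'n set" B] independent_imp_finite[OF \<open>independent B\<close>] by auto
  define U where "U = (\<chi> i j. h j $ i)"
  define S where "S = {j. h j \<in> B1}"
  have hB: "h j \<in> B" for j using h by (auto simp: bij_betw_def)
  have hh: "h i \<bullet> h j = (if i = j then 1 else 0)" for i j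
  proof (cases "i = j")
    case True
    then show ?thesis using nrm[OF hB[of j]] by (simp add: norm_eq_1)
  next
    case False
    then have "h i \<noteq> h j" using h by (auto simp: bij_betw_def inj_def)
    then show ?thesis using orth hB False by (simp add: pairwise_def orthogonal_def)
  qed
  have "orthogonal_matrix U"
    unfolding orthogonal_matrix
    by (simp add: vec_eq_iff matrix_matrix_mult_def U_def transpose_def mat_def hh[unfolded inner_vec_def, simplified])
  moreover have "(transpose U ** c ** U) $ i $ j = (if i = j \<and> i \<in> S then 1 else 0)" for i j
  proof -
    have "(transpose U ** c ** U) $ i $ j = h i \<bullet> (c *v h j)"
      unfolding matrix_mul_assoc'
      by (simp add: matrix_matrix_mult_def matrix_vector_mult_def inner_vec_def U_def transpose_def)
    also have "\<dots> = (if i = j \<and> i \<in> S then 1 else 0)"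
    proof (cases "h j \<in> B1")
      case True
      then have "c *v h j = h j" using B1(1) cc by (auto simp: V_def)
      then show ?thesis using True by (auto simp: hh S_def)
    next
      case False
      then have "h j \<in> N" using hB[of j] B2(1) by (auto simp: B_def)
      then show ?thesis using False by (auto simp: S_def N_def)
    qed
    finally show ?thesis .
  qed
  moreover have "card S = rank c"
  proof -
    have "B1 \<subseteq> range h" using h by (simp add: bij_betw_def B_def)
    then have "h ` S = B1" by (auto simp: S_def)
    moreover have "inj_on h S" using h by (meson bij_betw_def inj_on_subset subset_UNIV)
    ultimately show ?thesis
      using B1(4) rank_dim_range[of c] by (metis V_def card_image)
  qed
  ultimately show ?thesis by (intro that[of U S]) (auto simp: vec_eq_iff)
qed

lemma trace_sym_idem:
  assumes "sym_idem c"
  shows "trace c = rank c"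
proof -
  obtain U S where U: "orthogonal_matrix U"
    "transpose U ** c ** U = (\<chi> i j. if i = j \<and> i \<in> S then 1 else 0)" "card S = rank c"
    by (rule sym_idem_diagonalize[OF assms])
  have "trace (transpose U ** c ** U) = trace (c ** (U ** transpose U))"
    by (simp add: trace_mul_sym[of "transpose U"] mat_distribs)
  also have "\<dots> = trace c"
    using U(1) by (simp add: orthogonal_matrix_def)
  finally show ?thesis
    using U(2,3) by (simp add: trace_def sum.If_cases)
qed

lemma rank_sym_idem_pos:
  assumes "sym_idem c" "c \<noteq> 0"
  shows "0 < rank c"
proof -
  have "c \<bullet> c = rank c"
    using assms(1) by (simp add: inner_matrix_trace sym_idem_def flip: trace_sym_idem[OF assms(1)])
  then show ?thesis using assms(2) by (metis inner_gt_zero_iff of_nat_0_less_iff)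
qed

lemma det_sym_idem_scale:
  assumes "sym_idem c"
  shows "det (l *\<^sub>R c + (mat 1 - c)) = l ^ rank c"
proof -
  obtain U S where U: "orthogonal_matrix U"
    "transpose U ** c ** U = (\<chi> i j. if i = j \<and> i \<in> S then 1 else 0)" "card S = rank c"
    by (rule sym_idem_diagonalize[OF assms])
  let ?D = "\<chi> i j. if i = j then (if i \<in> S then l else 1) else (0::real)"
  have "transpose U ** (l *\<^sub>R c + (mat 1 - c)) ** U
      = l *\<^sub>R (transpose U ** c ** U) + (mat 1 - transpose U ** c ** U)"
    using U(1) by (simp add: mat_distribs orthogonal_matrix_def)
  also have "\<dots> = ?D"
    unfolding U(2) by (auto simp: vec_eq_iff mat_def)
  finally have "det (transpose U ** (l *\<^sub>R c + (mat 1 - c)) ** U) = det ?D" by simp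
  also have "det ?D = (\<Prod>i\<in>UNIV. if i \<in> S then l else 1)"
    by (subst det_diagonal) auto
  also have "\<dots> = l ^ card S"
    by (simp add: prod.If_cases)
  also have "det (transpose U ** (l *\<^sub>R c + (mat 1 - c)) ** U)
      = det (transpose U ** U) * det (l *\<^sub>R c + (mat 1 - c))"
    by (simp add: det_mul)
  finally show ?thesis
    using U(1,3) by (simp add: orthogonal_matrix_def)
qed

text \<open>Conjugation by the reflection \<open>1 - 2c\<close> inverts \<open>1 + n\<close>, so its determinant squares to \<open>1\<close>;
  being the square of the determinant of \<open>1 + n/2\<close>, it equals \<open>1\<close>.\<close>
lemma det_one_plus_nilpotent:
  assumes c: "c ** c = c" and n: "n ** c = n" "c ** n = 0"
  shows "det (mat 1 + n) = (1 :: real)"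
proof -
  have sq: "(det (mat 1 + m))\<^sup>2 = 1" if m: "m ** c = m" "c ** m = 0" for m
  proof -
    have mm: "m ** m = 0" using m by (metis matrix_mul_assoc mmult.zero_right)
    define R where "R = mat 1 - 2 *\<^sub>R c"
    have RR: "R ** R = mat 1"
      by (simp add: R_def mat_distribs c) (simp add: vec_eq_iff)
    have "R ** (mat 1 + m) ** R ** (mat 1 + m) = mat 1"
      by (simp add: R_def mat_distribs mat_zeros c m mm) (simp add: vec_eq_iff)
    then have "det (R ** (mat 1 + m) ** R ** (mat 1 + m)) = 1" by simp
    then have "(det R * det R) * (det (mat 1 + m))\<^sup>2 = 1"
      by (simp add: det_mul power2_eq_square mult_ac)
    moreover have "det R * det R = 1" using RR by (metis det_mul det_I)
    ultimately show ?thesis by simp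
  qed
  have "(mat 1 + (1/2) *\<^sub>R n) ** (mat 1 + (1/2) *\<^sub>R n) = mat 1 + n"
  proof -
    have "n ** n = 0" using n by (metis matrix_mul_assoc mmult.zero_right)
    then show ?thesis by (simp add: mat_distribs flip: scaleR_add_left)
  qed
  then have "det (mat 1 + n) = (det (mat 1 + (1/2) *\<^sub>R n))\<^sup>2"
    by (metis det_mul power2_eq_square)
  also have "\<dots> = 1"
    by (rule sq) (simp_all add: mat_distribs mat_zeros n)
  finally show ?thesis .
qed

text \<open>\<open>X\<close> is the congruence of \<open>l *\<^sub>R c + R\<close> by the unipotent
  matrix \<open>mat 1 + n\<close> with \<open>n = b / l\<close>, whose inverse is
  \<open>mat 1 - n\<close> because \<open>n ** n = 0\<close>. Congruence preserves positivity, and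
  the unipotent factor has determinant 1.\<close>

lemma Schur_complement:
  fixes c :: "real^'n^'n"
  assumes c: "sym_idem c" "c \<noteq> 0" and b: "b ** c = b" "c ** b = 0"
    and R: "c ** R = 0" "R ** c = 0" and l: "0 < l"
  defines "X \<equiv> l *\<^sub>R c + b + transpose b + (1 / l) *\<^sub>R (b ** transpose b) + R"
  shows "pos_def_mat X \<longleftrightarrow> pos_def_mat (c + R)" "det X = l ^ rank c * det (c + R)"
proof -
  have cT: "transpose c = c" "c ** c = c" using c by (auto simp: sym_idem_def)
  define n where "n = (1 / l) *\<^sub>R b"
  have n: "n ** c = n" "c ** n = 0" by (simp_all add: n_def mat_distribs mat_zeros b)
  have nn: "n ** n = 0" using n by (metis matrix_mul_assoc mmult.zero_right)
  have bR: "b ** R = 0" using b R by (metis matrix_mul_assoc mmult.zero_right)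
  have bT: "c ** transpose b = transpose b" "transpose b ** c = 0"
    using b cT by (metis matrix_transpose_mul, metis matrix_transpose_mul transpose_zero)
  have RbT: "R ** transpose b = 0" using bT R by (metis matrix_mul_assoc mmult.zero_left)
  have X: "X = (mat 1 + n) ** (l *\<^sub>R c + R) ** transpose (mat 1 + n)"
    using l by (simp add: X_def n_def mat_distribs mat_zeros b bR bT RbT scaleR_add_right)
  have inv: "(mat 1 - n) ** (mat 1 + n) = mat 1" "(mat 1 + n) ** (mat 1 - n) = mat 1"
    by (simp_all add: mat_distribs nn)
  have "(mat 1 - n) ** X ** transpose (mat 1 - n) = l *\<^sub>R c + R"
  proof -
    have "(mat 1 - n) ** X ** transpose (mat 1 - n)
      = ((mat 1 - n) ** (mat 1 + n)) ** (l *\<^sub>R c + R) ** transpose ((mat 1 - n) ** (mat 1 + n))"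
      unfolding X matrix_transpose_mul matrix_mul_assoc ..
    then show ?thesis by (simp add: inv)
  qed
  then have "pos_def_mat X \<longleftrightarrow> pos_def_mat (l *\<^sub>R c + R)"
    using pos_def_mat_congruence[OF inv(1), of "l *\<^sub>R c + R"] pos_def_mat_congruence[OF inv(2), of X] X by auto
  then show "pos_def_mat X \<longleftrightarrow> pos_def_mat (c + R)"
    using pos_def_mat_direct_sum[OF c R] l by simp
  have "det X = det (l *\<^sub>R c + R)"
    unfolding X det_mul det_transpose using det_one_plus_nilpotent[OF cT(2) n] by simp
  \<comment> \<open>Scaling by \<open>l\<close> on the range of \<open>c\<close> alone factors out,
    since \<open>c\<close> annihilates \<open>R\<close>.\<close>
  also have "l *\<^sub>R c + R = (l *\<^sub>R c + (mat 1 - c)) ** (c + R)"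
    by (simp add: mat_distribs cT R)
  also have "det \<dots> = l ^ rank c * det (c + R)"
    by (simp add: det_mul det_sym_idem_scale[OF c(1)])
  finally show "det X = l ^ rank c * det (c + R)" .
qed

text \<open>This is what makes the integrand vanish for nonpositive \<open>l\<close>, so that the
  integral over \<open>l\<close> runs over the positive half line.\<close>

lemma pos_def_mat_corner_pos:
  assumes c: "sym_idem c" "c \<noteq> 0" and X: "pos_def_mat X" "c ** X ** c = l *\<^sub>R c"
  shows "0 < l"
proof -
  have cT: "transpose c = c" "c ** c = c" using c by (auto simp: sym_idem_def)
  obtain w where w: "c *v w \<noteq> 0"
    using c(2) matrix_eq by (metis matrix_vector_mult_0)
  then have "0 < (c *v w) \<bullet> (X *v (c *v w))"
    using X(1) by (simp add: pos_def_mat_def)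
  also have "(c *v w) \<bullet> (X *v (c *v w)) = w \<bullet> ((c ** X ** c) *v w)"
    using quadratic_form_congruence[of w c X] by (simp only: cT)
  also have "\<dots> = l * ((c *v w) \<bullet> (c *v w))"
    unfolding X(2) by (simp add: sym_idem_quadratic[OF c(1)] flip: scaleR_matrix_vector_assoc)
  finally show ?thesis
    using w by (metis inner_gt_zero_iff zero_less_mult_pos2)
qed

section \<open>Measurability of the integrand\<close>

lemma continuous_on_matrix_entry: "continuous_on A (\<lambda>x::real^'n^'m. x $ i $ j)"
  by (intro continuous_intros)

lemma continuous_on_det: "continuous_on A (det :: real^'n^'n \<Rightarrow> real)"
  unfolding det_def
  by (intro continuous_on_sum continuous_on_mult continuous_on_const continuous_on_prod continuous_on_matrix_entry)

lemma borel_measurable_det [measurable]: "(det :: real^'n^'n \<Rightarrow> real) \<in> borel_measurable borel"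
  by (rule borel_measurable_continuous_onI[OF continuous_on_det])

lemma borel_measurable_trace_mult [measurable]: "(\<lambda>x. trace (A ** x)) \<in> borel_measurable borel"
  for A :: "real^'n^'n"
proof -
  have "linear (\<lambda>x. trace (A ** x))"
    using linear_compose[OF mmult.bounded_linear_right[THEN bounded_linear.linear] linear_trace] by (simp add: o_def)
  then show ?thesis
    by (intro borel_measurable_continuous_onI linear_continuous_on) (simp add: linear_conv_bounded_linear)
qed

text \<open>By compactness of the unit sphere, \<open>SymPos\<close> is a countable union of closed sets.\<close>
lemma sets_borel_SymPos [measurable]: "(SymPos :: (real^'n^'n) set) \<in> sets borel"
proof -
  define C where "C k = {x :: real^'n^'n. transpose x = x} \<inter> (\<Inter>v\<in>sphere 0 1. {x. 1 / real (Suc k) \<le> v \<bullet> (x *v v)})" for k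
  have "closed (C k)" for k
    unfolding C_def
  proof (intro closed_Int closed_INT ballI)
    show "closed {x :: real^'n^'n. transpose x = x}"
      by (intro closed_Collect_eq linear_continuous_on bounded_linear_transpose continuous_on_id)
    fix v :: "real^'n"
    have "linear (\<lambda>x::real^'n^'n. v \<bullet> (x *v v))"
      by (auto simp: linear_iff matrix_vector_mult_add_rdistrib inner_add_right simp flip: scaleR_matrix_vector_assoc)
    then show "closed {x. 1 / real (Suc k) \<le> v \<bullet> (x *v v)}"
      by (intro closed_Collect_le continuous_on_const linear_continuous_on) (simp add: linear_conv_bounded_linear)
  qed
  then have "(\<Union>k. C k) \<in> sets borel" by auto
  also have "(\<Union>k. C k) = (SymPos :: (real^'n^'n) set)"
  proof (intro set_eqI iffI)
    fix x :: "real^'n^'n" assume "x \<in> (\<Union>k. C k)"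
    then obtain k where "x \<in> C k" by blast
    then have k: "transpose x = x" "\<And>v. norm v = 1 \<Longrightarrow> 1 / real (Suc k) \<le> v \<bullet> (x *v v)"
      by (auto simp: C_def)
    have "0 < v \<bullet> (x *v v)" if "v \<noteq> 0" for v
    proof -
      have "0 < 1 / real (Suc k)" by simp
      also have "\<dots> \<le> (v /\<^sub>R norm v) \<bullet> (x *v (v /\<^sub>R norm v))"
        using that by (intro k) simp
      finally show ?thesis
        using that by (simp add: matrix_vector_mult_scaleR zero_less_mult_iff)
    qed
    with k show "x \<in> SymPos" by (simp add: SymPos_def pos_def_mat_def)
  next
    fix x :: "real^'n^'n" assume x: "x \<in> SymPos"
    have "continuous_on (sphere 0 1) (\<lambda>v. v \<bullet> (x *v v))"
      by (intro continuous_intros linear_continuous_on matrix_vector_mul_bounded_linear)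
    from continuous_attains_inf[OF compact_sphere _ this]
    obtain u where u: "u \<in> sphere 0 1" "\<And>v. v \<in> sphere 0 1 \<Longrightarrow> u \<bullet> (x *v u) \<le> v \<bullet> (x *v v)"
      by auto
    have "u \<noteq> 0" using u(1) by auto
    then have "0 < u \<bullet> (x *v u)"
      using x by (simp add: SymPos_def pos_def_mat_def)
    then obtain k where "1 / real (Suc k) < u \<bullet> (x *v u)"
      using nat_approx_posE by blast
    with u x have "x \<in> C k" by (fastforce simp: C_def SymPos_def pos_def_mat_def)
    then show "x \<in> (\<Union>k. C k)" by blast
  qed
  finally show ?thesis .
qed

section \<open>Splitting off one idempotent\<close>

text \<open>Halving the variable shows that the left-hand side exceeds itself by at least \<open>1/2\<close>.\<close>
lemma nn_integral_inverse_unit_interval: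
  "(\<integral>\<^sup>+ t. ennreal (indicator {0<..<1} t * t powr (-1)) \<partial>lborel) = (\<infinity> :: ennreal)"
proof (rule ccontr)
  let ?I = "\<integral>\<^sup>+ t. ennreal (indicator {0<..<1} t * t powr (-1)) \<partial>lborel"
  assume "?I \<noteq> \<infinity>"
  then have fin: "?I < \<infinity>" by (simp add: top.not_eq_extremum)
  define h :: real where "h = 1 / 2"
  have h: "0 < h" by (simp add: h_def)
  have "?I = ennreal h * (\<integral>\<^sup>+ t. ennreal (indicator {0<..<1} (h * t) * (h * t) powr (-1)) \<partial>lborel)"
    using h by (subst nn_integral_real_affine[where c=h and t=0]) auto
  also have "\<dots> = (\<integral>\<^sup>+ t. ennreal h * ennreal (indicator {0<..<1} (h * t) * (h * t) powr (-1)) \<partial>lborel)"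
    by (rule nn_integral_cmult[symmetric]) measurable
  also have "\<dots> = (\<integral>\<^sup>+ t. ennreal (indicator {0<..<2} t * t powr (-1)) \<partial>lborel)"
  proof (rule nn_integral_cong)
    fix t :: real
    have "h * (indicator {0<..<1} (h * t) * (h * t) powr (-1)) = indicator {0<..<2} t * t powr (-1)"
      by (auto simp: h_def indicator_def powr_minus field_simps)
    then show "ennreal h * ennreal (indicator {0<..<1} (h * t) * (h * t) powr (-1)) = ennreal (indicator {0<..<2} t * t powr (-1))"
      using h by (simp add: ennreal_mult[symmetric])
  qed
  also have "\<dots> \<ge> (\<integral>\<^sup>+ t. ennreal (indicator {0<..<1} t * t powr (-1)) + ennreal h * indicator {1..<2} t \<partial>lborel)"
  proof (rule nn_integral_mono)
    fix t :: real
    have "indicator {0<..<1} t * t powr (-1) + h * indicator {1..<2} t \<le> indicator {0<..<2} t * t powr (-1)"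
      by (auto simp: h_def indicator_def powr_minus field_simps)
    then show "ennreal (indicator {0<..<1} t * t powr (-1)) + ennreal h * indicator {1..<2} t
        \<le> ennreal (indicator {0<..<2} t * t powr (-1))"
      using h by (auto simp: indicator_def simp flip: ennreal_plus split: if_splits)
  qed
  also have "(\<integral>\<^sup>+ t. ennreal (indicator {0<..<1} t * t powr (-1)) + ennreal h * indicator {1..<2::real} t \<partial>lborel)
      = ?I + ennreal h"
    by (subst nn_integral_add) (auto simp: nn_integral_cmult)
  finally have "?I + ennreal h \<le> ?I + 0" by simp
  then have "ennreal h \<le> 0"
    using fin by (subst (asm) ennreal_add_left_cancel_le) auto
  then show False using h by simp
qed

text \<open>For \<open>a > -1\<close> this is Euler's integral after rescaling by \<open>k\<close>.
  Otherwise, on the unit interval, \<open>t powr a\<close> dominates \<open>t powr (-1)\<close> and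
  the exponential is at least \<open>exp (- k)\<close>, so the integral diverges at 0.\<close>

lemma nn_integral_powr_exp:
  assumes "0 < k"
  shows "(\<integral>\<^sup>+ t. ennreal (indicator {0<..} t * (t powr a * exp (- k * t))) \<partial>lborel)
    = (if -1 < a then ennreal (Gamma (a + 1) * k powr (- a - 1)) else \<infinity>)"
proof (cases "-1 < a")
  case True
  have "ennreal (Gamma (a + 1)) = (\<integral>\<^sup>+ t. ennreal (indicator {0..} t * t powr a / exp t) \<partial>lborel)"
    using Gamma_conv_nn_integral_real[of "a + 1"] True by simp
  also have "\<dots> = ennreal k * (\<integral>\<^sup>+ t. ennreal (indicator {0..} (k * t) * (k * t) powr a / exp (k * t)) \<partial>lborel)"
    using assms by (subst nn_integral_real_affine[where c=k and t=0]) auto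
  also have "\<dots> = (\<integral>\<^sup>+ t. ennreal (k powr (a + 1)) * ennreal (indicator {0<..} t * (t powr a * exp (- k * t))) \<partial>lborel)"
    using assms
    by (subst nn_integral_cmult[symmetric])
       (auto intro!: nn_integral_cong simp: ennreal_mult[symmetric] powr_mult powr_add exp_minus field_simps indicator_def zero_le_mult_iff)
  also have "\<dots> = ennreal (k powr (a + 1)) * (\<integral>\<^sup>+ t. ennreal (indicator {0<..} t * (t powr a * exp (- k * t))) \<partial>lborel)"
    by (rule nn_integral_cmult) measurable
  finally have "ennreal (k powr (- a - 1)) * ennreal (Gamma (a + 1))
      = ennreal (k powr (- a - 1)) * (ennreal (k powr (a + 1)) * (\<integral>\<^sup>+ t. ennreal (indicator {0<..} t * (t powr a * exp (- k * t))) \<partial>lborel))"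
    by simp
  moreover have "k powr (- a - 1) * k powr (a + 1) = 1"
    using assms by (simp flip: powr_add)
  ultimately have "(\<integral>\<^sup>+ t. ennreal (indicator {0<..} t * (t powr a * exp (- k * t))) \<partial>lborel)
      = ennreal (k powr (- a - 1)) * ennreal (Gamma (a + 1))"
    by (simp add: mult.assoc[symmetric] ennreal_mult[symmetric])
  also have "\<dots> = ennreal (Gamma (a + 1) * k powr (- a - 1))"
    using True by (subst ennreal_mult[symmetric]) (auto simp: mult.commute)
  finally show ?thesis using True by simp
next
  case False
  have "\<infinity> = ennreal (exp (- k)) * (\<integral>\<^sup>+ t. ennreal (indicator {0<..<1} t * t powr (-1)) \<partial>lborel)"
    unfolding nn_integral_inverse_unit_interval by (simp add: ennreal_mult_top)
  also have "\<dots> = (\<integral>\<^sup>+ t. ennreal (exp (- k)) * ennreal (indicator {0<..<1} t * t powr (-1)) \<partial>lborel)"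
    by (rule nn_integral_cmult[symmetric]) measurable
  also have "\<dots> \<le> (\<integral>\<^sup>+ t. ennreal (indicator {0<..} t * (t powr a * exp (- k * t))) \<partial>lborel)"
  proof (rule nn_integral_mono)
    fix t :: real
    have "exp (- k) * t powr (-1) \<le> t powr a * exp (- k * t)" if "0 < t" "t < 1"
    proof -
      have "t powr (-1) \<le> t powr a" using that False by (intro powr_mono') auto
      moreover have "exp (- k) \<le> exp (- k * t)" using that assms by simp
      ultimately show ?thesis by (subst mult.commute) (intro mult_mono, auto)
    qed
    then show "ennreal (exp (- k)) * ennreal (indicator {0<..<1} t * t powr (-1))
        \<le> ennreal (indicator {0<..} t * (t powr a * exp (- k * t)))"
      by (auto simp: indicator_def ennreal_mult[symmetric] intro!: ennreal_leI)
  qed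
  finally show ?thesis using False by (simp add: top_unique)
qed

section \<open>The form whose Gram matrices are phi and psi\<close>

definition trace_form :: "real^'n^'n \<Rightarrow> real^'n^'n \<Rightarrow> real^'n^'n \<Rightarrow> real" where
  "trace_form A X Y = trace (A ** X ** transpose Y)"

lemma bilinear_trace_form: "bilinear (trace_form A)"
  unfolding bilinear_def trace_form_def linear_iff
  by (auto simp: mat_distribs linear_add[OF linear_trace] linear_scale[OF linear_trace])

lemma trace_form_commute:
  assumes "transpose A = A"
  shows "trace_form A X Y = trace_form A Y X"
proof -
  have "trace_form A X Y = trace (transpose (A ** X ** transpose Y))"
    by (simp add: trace_form_def trace_transpose)
  also have "\<dots> = trace ((Y ** transpose X) ** A)"
    by (simp add: mat_distribs assms)
  also have "\<dots> = trace_form A Y X"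
    by (subst trace_mul_sym) (simp add: trace_form_def mat_distribs)
  finally show ?thesis .
qed

text \<open>The trace is the sum of the values of the quadratic form of \<open>A\<close> at the
  columns of \<open>X\<close>.\<close>

lemma trace_form_pos:
  assumes A: "pos_def_mat A" and X: "X \<noteq> 0"
  shows "0 < trace_form A X X"
proof -
  have "trace_form A X X = trace (transpose X ** (A ** X))"
    by (subst trace_mul_sym) (simp add: trace_form_def)
  also have "\<dots> = (\<Sum>j\<in>UNIV. column j X \<bullet> (A *v column j X))"
    by (simp add: trace_def matrix_matrix_mult_def matrix_vector_mult_def inner_vec_def transpose_def column_def)
  also have "\<dots> > 0"
  proof -
    obtain i j where ij: "X $ i $ j \<noteq> 0" using X by (auto simp: vec_eq_iff)
    then have "column j X \<noteq> 0" by (auto simp: column_def vec_eq_iff)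
    then have "0 < column j X \<bullet> (A *v column j X)"
      using A by (simp add: pos_def_mat_def)
    moreover have "0 \<le> column k X \<bullet> (A *v column k X)" for k
      using A unfolding pos_def_mat_def by (cases "column k X = 0") (auto intro: less_imp_le)
    ultimately show ?thesis
      by (intro sum_pos2[of _ j]) auto
  qed
  finally show ?thesis .
qed

lemma pos_on_orthonormal:
  fixes g :: "nat \<Rightarrow> 'a::euclidean_space"
  assumes B: "\<And>X. X \<noteq> 0 \<Longrightarrow> 0 < B X X"
    and g: "\<And>i j. i < n \<Longrightarrow> j < n \<Longrightarrow> g i \<bullet> g j = (if i = j then 1 else 0)"
  shows "pos_on B g n"
  unfolding pos_on_def
proof (intro allI impI B)
  fix x :: "nat \<Rightarrow> real" assume "\<exists>i<n. x i \<noteq> 0"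
  then obtain i where i: "i < n" "x i \<noteq> 0" by blast
  have "(\<Sum>j<n. x j *\<^sub>R g j) \<bullet> g i = (\<Sum>j<n. if j = i then x j else 0)"
    unfolding inner_sum_left by (intro sum.cong) (auto simp: g i)
  also have "\<dots> = x i" using i by simp
  finally show "(\<Sum>j<n. x j *\<^sub>R g j) \<noteq> 0" using i by auto
qed

section \<open>Integrals over Peirce corners and their recursion\<close>

definition corner :: "(real^'n^'n) set \<Rightarrow> real^'n^'n \<Rightarrow> (real^'n^'n) set" where
  "corner Z Q = {x \<in> Z. Q ** x ** Q = x}"

text \<open>Adding \<open>mat 1 - Q\<close> fills the complement of the corner with the identity, so
  positivity and determinant of full-size matrices express those of the corner.
  \<open>Q = mat 1\<close> gives the integrand of the theorem, and \<open>Q = 0\<close> gives weight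
  1 at the origin, which ends the recursion.\<close>

definition corner_weight :: "real^'n^'n \<Rightarrow> real \<Rightarrow> real^'n^'n \<Rightarrow> real^'n^'n \<Rightarrow> ennreal" where
  "corner_weight A s Q x = ennreal (indicator SymPos (x + (mat 1 - Q)) *
     (det (x + (mat 1 - Q)) powr s * exp (- trace (A ** x))))"

text \<open>The arbitrary choice of basis is harmless by
  \<open>iter_integral_orthonormal_cong\<close>; it makes the integral a function of
  \<open>Q\<close> alone, so that the recursion can be stated.\<close>

definition corner_integral :: "(real^'n^'n) set \<Rightarrow> real^'n^'n \<Rightarrow> real \<Rightarrow> real^'n^'n \<Rightarrow> ennreal" where
  "corner_integral Z A s Q =
     iter_integral (SOME vs. orthonormal_list vs \<and> span (set vs) = corner Z Q) (corner_weight A s Q)"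

lemma subspace_corner: "subspace Z \<Longrightarrow> subspace (corner Z Q)"
  unfolding subspace_def corner_def by (auto simp: mat_distribs mat_zeros)

lemma orthonormal_list_exists:
  assumes "subspace S"
  obtains vs where "orthonormal_list vs" "span (set vs) = S"
proof -
  obtain B where B: "pairwise orthogonal B" "\<And>x. x \<in> B \<Longrightarrow> norm x = 1" "independent B" "span B = S"
    using orthonormal_basis_subspace[OF assms] by metis
  then obtain vs where "set vs = B" "distinct vs"
    using finite_distinct_list[OF independent_imp_finite] by blast
  with B show ?thesis by (intro that[of vs]) (auto simp: orthonormal_list_def)
qed

lemma borel_measurable_corner_weight [measurable]: "corner_weight A s Q \<in> borel_measurable borel"
  unfolding corner_weight_def by measurable

lemma corner_integral_eq:
  assumes "orthonormal_list vs" "span (set vs) = corner Z Q"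
  shows "corner_integral Z A s Q = iter_integral vs (corner_weight A s Q)"
proof -
  define ws where "ws = (SOME vs. orthonormal_list vs \<and> span (set vs) = corner Z Q)"
  have "orthonormal_list ws \<and> span (set ws) = corner Z Q"
    unfolding ws_def by (rule someI[of _ vs]) (use assms in simp)
  then show ?thesis
    unfolding corner_integral_def ws_def[symmetric]
    using assms by (intro iter_integral_orthonormal_cong) auto
qed

lemma orthonormal_list_append:
  assumes "orthonormal_list vs" "orthonormal_list ws" "\<And>v w. v \<in> set vs \<Longrightarrow> w \<in> set ws \<Longrightarrow> v \<bullet> w = 0"
  shows "orthonormal_list (vs @ ws)"
proof -
  have "set vs \<inter> set ws = {}"
    using assms unfolding orthonormal_list_def
    by (metis disjoint_iff inner_eq_zero_iff norm_zero zero_neq_one)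
  moreover have "pairwise orthogonal (set vs \<union> set ws)"
    using assms unfolding orthonormal_list_def pairwise_def orthogonal_def
    by (metis UnE inner_commute)
  ultimately show ?thesis
    using assms unfolding orthonormal_list_def by auto
qed

lemma orthonormal_list_map_upt:
  assumes "\<And>i j. i < n \<Longrightarrow> j < n \<Longrightarrow> g i \<bullet> g j = (if i = j then 1 else 0)"
  shows "orthonormal_list (map g [0..<n])"
proof -
  have "inj_on g {0..<n}"
    using assms by (intro inj_onI) (metis atLeastLessThan_iff zero_neq_one)
  then show ?thesis
    using assms unfolding orthonormal_list_def
    by (auto simp: distinct_map pairwise_def orthogonal_def norm_eq_1)
qed

text \<open>The integral over \<open>l\<close> and \<open>b\<close> for one idempotent, with
  \<open>\<Phi>\<close> and \<open>\<Psi>\<close> the determinants of phi and psi. The second branch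
  is the divergent Gamma integral; \<open>2 * pi\<close> joins the \<open>pi\<close> of each
  Gaussian with the 2 from normalising \<open>b + transpose b\<close>.\<close>

definition step_factor :: "real \<Rightarrow> real \<Rightarrow> real \<Rightarrow> real \<Rightarrow> real \<Rightarrow> ennreal" where
  "step_factor \<mu> m s \<Phi> \<Psi> = (if -1 < \<mu> * s + m / 2
    then ennreal (\<mu> powr (- (\<mu> * s) - m / 2 - 1 / 2) * (2 * pi) powr (m / 2) * Gamma (\<mu> * s + m / 2 + 1)
      * (\<Phi> / \<Psi>) powr (- (\<mu> * s) - m / 2 - 1) * \<Psi> powr (- 1 / 2))
    else \<infinity>)"

text \<open>Isolates what the analysis needs from the algebra: compressions to \<open>c\<close> are
  scalar, the Peirce parts of an element of \<open>Z\<close> for \<open>Q\<close> and for the pair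
  \<open>Q\<close>, \<open>c\<close> lie again in \<open>Z\<close>, and so does
  \<open>b ** transpose b\<close> for \<open>b = Q ** x ** c\<close>. Blocks are not mentioned, so
  the same step serves inside a block and across blocks.\<close>

locale peel =
  fixes Z :: "(real^'n^'n) set" and c Q :: "real^'n^'n" and f :: "nat \<Rightarrow> real^'n^'n" and m :: nat
    and A :: "real^'n^'n" and s :: real
  assumes Z: "subspace Z" "Z \<subseteq> Sym"
    and c: "sym_idem c" "c \<noteq> 0" "c \<in> Z" and Q: "sym_idem Q" and cQ: "c ** Q = 0" "Q ** c = 0"
    and cxc: "\<And>x. x \<in> Z \<Longrightarrow> \<exists>l. c ** x ** c = l *\<^sub>R c"
    and QxQ: "\<And>x. x \<in> Z \<Longrightarrow> Q ** x ** Q \<in> Z"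
    and Qxc: "\<And>x. x \<in> Z \<Longrightarrow> Q ** x ** c + c ** x ** Q \<in> Z"
    and QxcxQ: "\<And>x. x \<in> Z \<Longrightarrow> Q ** x ** c ** x ** Q \<in> Z"
    and f: "orthonormal_basis {Q ** x ** c | x. x \<in> Z} f m"
    and A: "pos_def_mat A"
begin

definition "\<mu> = real (rank c)"
definition "et = (1 / sqrt \<mu>) *\<^sub>R c"
definition "g k = (if k = 0 then et else f (k - 1))"
definition "P = det_n m (\<lambda>i j. trace_form A (f i) (f j))"
definition "D = det_n (Suc m) (\<lambda>i j. trace_form A (g i) (g j)) / P"
text \<open>Carries the non-symmetric space \<open>H\<close> isometrically onto the off-diagonal
  symmetric part of the corner; the factor \<open>1 / sqrt 2\<close> compensates for counting
  \<open>b\<close> twice.\<close>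

definition L :: "real^'n^'n \<Rightarrow> real^'n^'n" where "L b = (1 / sqrt 2) *\<^sub>R (b + transpose b)"
definition "H = {Q ** x ** c | x. x \<in> Z}"
definition "fs = map f [0..<m]"

lemma cT: "transpose c = c" "c ** c = c" and QT: "transpose Q = Q" "Q ** Q = Q"
  using c Q by (auto simp: sym_idem_def)

lemma zeros: "c ** (Q ** X) = 0" "Q ** (c ** X) = 0" "c ** (c ** X) = c ** X" "Q ** (Q ** X) = Q ** X"
  using cQ cT QT by (simp_all add: matrix_mul_assoc mmult.zero_left)

lemmas prods = mat_distribs mat_zeros cT QT cQ zeros

lemma mu_pos: "0 < \<mu>"
  using rank_sym_idem_pos c by (simp add: \<mu>_def)

lemma symZ: "x \<in> Z \<Longrightarrow> transpose x = x"
  using Z by (auto simp: Sym_def)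

lemma linear_L: "linear L"
  unfolding L_def by (rule linearI) (simp_all add: transpose_linear_simps scaleR_add_right mult.commute)

lemma span_fs: "span (set fs) = H"
  using f by (simp add: fs_def orthonormal_basis_def H_def atLeast0LessThan)

lemma f_in: "i < m \<Longrightarrow> f i \<in> H"
  using f by (simp add: orthonormal_basis_def H_def)

lemma HD:
  assumes "b \<in> H"
  shows "b ** c = b" "c ** b = 0" "Q ** b = b" "b ** Q = 0" "c ** transpose b = transpose b"
    "transpose b ** c = 0" "transpose b ** Q = transpose b" "Q ** transpose b = 0"
    "b + transpose b \<in> Z" "b ** transpose b \<in> Z"
proof -
  obtain x where x: "x \<in> Z" "b = Q ** x ** c" using assms by (auto simp: H_def)
  show "b ** c = b" "c ** b = 0" "Q ** b = b" "b ** Q = 0" "c ** transpose b = transpose b"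
    "transpose b ** c = 0" "transpose b ** Q = transpose b" "Q ** transpose b = 0"
    by (simp_all add: x prods symZ)
  show "b + transpose b \<in> Z" using Qxc[OF x(1)] by (simp add: x prods symZ)
  show "b ** transpose b \<in> Z" using QxcxQ[OF x(1)] by (simp add: x prods symZ)
qed

lemma cornerD:
  assumes "y \<in> corner Z Q"
  shows "y \<in> Z" "Q ** y = y" "y ** Q = y" "c ** y = 0" "y ** c = 0" "transpose y = y"
proof -
  have y: "y \<in> Z" "y = Q ** y ** Q" using assms by (auto simp: corner_def)
  then show "y \<in> Z" "transpose y = y" by (auto simp: symZ)
  show "Q ** y = y" "y ** Q = y" "c ** y = 0" "y ** c = 0"
    by (subst y, subst (2) y, simp add: prods)+ (subst y, simp add: prods)+
qed

lemma et_inner: "et \<bullet> et = 1"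
proof -
  have "c \<bullet> c = \<mu>" by (simp add: inner_matrix_trace cT trace_sym_idem[OF c(1)] \<mu>_def)
  then show ?thesis using mu_pos by (simp add: et_def flip: real_sqrt_mult)
qed

lemma et_H: assumes "b \<in> H" shows "et \<bullet> b = 0" "et \<bullet> transpose b = 0"
proof -
  have "c \<bullet> b = trace (transpose b ** c)"
    by (subst trace_mul_sym) (simp add: inner_matrix_trace)
  then show "et \<bullet> b = 0" by (simp add: HD[OF assms] et_def trace_def)
  show "et \<bullet> transpose b = 0" by (simp add: inner_matrix_trace HD[OF assms] et_def trace_def mat_distribs)
qed

text \<open>Elements of \<open>H\<close> map the range of \<open>c\<close> into that of
  \<open>Q\<close> and have pairwise product 0, so \<open>b\<close> is orthogonal to the transpose
  of \<open>b'\<close> and the cross terms disappear.\<close>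

lemma H_inner: assumes "b \<in> H" "b' \<in> H" shows "L b \<bullet> L b' = b \<bullet> b'"
proof -
  have "b ** b' = 0" "b' ** b = 0"
    using HD[OF assms(1)] HD[OF assms(2)] by (metis matrix_mul_assoc mmult.zero_right)+
  then have "b \<bullet> transpose b' = 0" "transpose b' \<bullet> b = 0" "transpose b \<bullet> b' = 0"
    by (simp_all add: inner_matrix_trace flip: matrix_transpose_mul) (simp_all add: trace_def transpose_zero)
  then show ?thesis by (simp add: L_def inner_simps inner_transpose)
qed

lemma corner_inner:
  assumes "y \<in> corner Z Q"
  shows "et \<bullet> y = 0" and "b \<in> H \<Longrightarrow> L b \<bullet> y = 0"
proof -
  show "et \<bullet> y = 0" by (simp add: et_def inner_matrix_trace cornerD[OF assms] trace_def mat_distribs)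
  assume b: "b \<in> H"
  have "b ** y = 0"
    using HD(1)[OF b] cornerD(4)[OF assms] by (metis matrix_mul_assoc mmult.zero_right)
  moreover have "y ** transpose b = 0"
    using HD(5)[OF b] cornerD(5)[OF assms] by (metis matrix_mul_assoc mmult.zero_left)
  ultimately have "b \<bullet> y = 0" "y \<bullet> b = 0"
    by (simp_all add: inner_matrix_trace cornerD[OF assms] trace_def)
  moreover have "transpose b \<bullet> y = b \<bullet> y"
    using inner_transpose[of b y] by (simp add: cornerD[OF assms])
  ultimately show "L b \<bullet> y = 0" by (simp add: L_def inner_simps)
qed

lemma f_inner: "i < m \<Longrightarrow> j < m \<Longrightarrow> f i \<bullet> f j = (if i = j then 1 else 0)"
  using f by (simp add: orthonormal_basis_def)

lemma g_inner: "i < Suc m \<Longrightarrow> j < Suc m \<Longrightarrow> g i \<bullet> g j = (if i = j then 1 else 0)"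
  using et_inner et_H(1)[OF f_in, of "i - 1"] et_H(1)[OF f_in, of "j - 1"] f_inner[of "i - 1" "j - 1"]
  by (auto simp: g_def inner_commute)

lemma g_pos: "pos_on (trace_form A) g (Suc m)"
  by (rule pos_on_orthonormal[OF trace_form_pos[OF A] g_inner])

lemma A_sym: "transpose A = A"
  using A by (simp add: pos_def_mat_def)

lemma P_pos: "0 < P"
  using det_n_gram_pos[OF bilinear_trace_form trace_form_commute[OF A_sym] pos_on_tail[OF g_pos]]
  by (simp add: P_def g_def o_def)

lemma D_pos: "0 < D"
  using det_n_gram_pos[OF bilinear_trace_form trace_form_commute[OF A_sym] g_pos] P_pos
  by (simp add: D_def)

text \<open>The Peirce decomposition of \<open>x\<close> into its \<open>c\<close> part, its mixed
  part and its \<open>Q\<close> part is orthogonal. Concatenating orthonormal bases of the three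
  therefore factors Lebesgue measure on the larger corner with Jacobian 1.\<close>

lemma basis:
  assumes ws: "orthonormal_list ws" "span (set ws) = corner Z Q"
  shows "orthonormal_list ((et # map L fs) @ ws)" "span (set ((et # map L fs) @ ws)) = corner Z (c + Q)"
proof -
  have fsH: "b \<in> H" if "b \<in> set fs" for b
    using span_fs span_base[OF that] by simp
  have wsC: "w \<in> corner Z Q" if "w \<in> set ws" for w
    using ws(2) span_base[OF that] by simp
  have "orthonormal_list [et]"
    using et_inner by (simp add: orthonormal_list_def norm_eq_1)
  moreover have "orthonormal_list (map L fs)"
    unfolding fs_def map_map
    by (rule orthonormal_list_map_upt) (simp add: H_inner f_in f_inner)
  moreover have "et \<bullet> L b = 0" if "b \<in> H" for b
    using et_H[OF that] by (simp add: L_def inner_simps)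
  ultimately have "orthonormal_list ([et] @ map L fs)"
    using fsH by (intro orthonormal_list_append) auto
  then have "orthonormal_list (et # map L fs)" by simp
  then show "orthonormal_list ((et # map L fs) @ ws)"
    using fsH wsC corner_inner ws(1) by (intro orthonormal_list_append) auto
  show "span (set ((et # map L fs) @ ws)) = corner Z (c + Q)" (is "span ?S = _")
  proof
    have "et \<in> corner Z (c + Q)"
      using c(3) Z(1) by (simp add: corner_def et_def subspace_scale prods)
    moreover have "L b \<in> corner Z (c + Q)" if "b \<in> H" for b
      using HD[OF that] subspace_scale[OF Z(1) HD(9)[OF that]]
      by (simp add: corner_def L_def mat_distribs scaleR_add_right add.commute)
    moreover have "y \<in> corner Z (c + Q)" if "y \<in> corner Z Q" for y
      using cornerD[OF that] by (simp add: corner_def mat_distribs)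
    ultimately have "?S \<subseteq> corner Z (c + Q)"
      using fsH wsC by auto
    then show "span ?S \<subseteq> corner Z (c + Q)"
      by (rule span_minimal) (rule subspace_corner[OF Z(1)])
  next
    show "corner Z (c + Q) \<subseteq> span ?S"
    proof
      fix x assume "x \<in> corner Z (c + Q)"
      then have x: "x \<in> Z" "x = (c + Q) ** x ** (c + Q)" by (auto simp: corner_def)
      obtain l where l: "c ** x ** c = l *\<^sub>R c" using cxc[OF x(1)] by blast
      define b where "b = Q ** x ** c"
      have b: "b \<in> H" using x by (auto simp: b_def H_def)
      have bT: "transpose b = c ** x ** Q" by (simp add: b_def prods symZ[OF x(1)])
      have "et \<in> span ?S" by (intro span_base) simp
      then have "(l * sqrt \<mu>) *\<^sub>R et \<in> span ?S" by (rule span_mul)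
      moreover have "(l * sqrt \<mu>) *\<^sub>R et = c ** x ** c"
        using mu_pos by (simp add: et_def l)
      moreover have "L b \<in> span ?S"
      proof -
        have "L b \<in> span (L ` set fs)"
          using b unfolding linear_span_image[OF linear_L] span_fs by simp
        then show ?thesis by (rule subsetD[OF span_mono, rotated]) auto
      qed
      then have "sqrt 2 *\<^sub>R L b \<in> span ?S" by (rule span_mul)
      moreover have "sqrt 2 *\<^sub>R L b = b + transpose b" by (simp add: L_def)
      moreover have "Q ** x ** Q \<in> span ?S"
      proof -
        have "Q ** x ** Q \<in> corner Z Q"
          using QxQ[OF x(1)] by (simp add: corner_def prods)
        then have "Q ** x ** Q \<in> span (set ws)" by (simp add: ws(2))
        then show ?thesis by (rule subsetD[OF span_mono, rotated]) auto
      qed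
      ultimately have "c ** x ** c + (b + transpose b) + Q ** x ** Q \<in> span ?S"
        by (metis span_add)
      moreover have "x = c ** x ** c + (b + transpose b) + Q ** x ** Q"
        unfolding bT unfolding b_def by (subst x(2)) (simp add: mat_distribs)
      ultimately show "x \<in> span ?S" by simp
    qed
  qed
qed

lemma weight_nonpos:
  assumes "l \<le> 0" "b \<in> H" "y \<in> corner Z Q"
  shows "corner_weight A s (c + Q) (l *\<^sub>R c + (b + transpose b + y)) = 0"
proof -
  define X where "X = l *\<^sub>R c + (b + transpose b + y) + (mat 1 - (c + Q))"
  have "c ** X ** c = l *\<^sub>R c"
    by (simp add: X_def prods HD[OF assms(2)] cornerD[OF assms(3)])
  then have "\<not> pos_def_mat X"
    using pos_def_mat_corner_pos[OF c(1,2), of X l] assms(1) by auto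
  then show ?thesis by (simp add: corner_weight_def X_def SymPos_def)
qed

lemma weight_pos:
  assumes "0 < l" "b \<in> H" "y \<in> corner Z Q"
  shows "corner_weight A s (c + Q) (l *\<^sub>R c + (b + transpose b + (y + (1 / l) *\<^sub>R (b ** transpose b))))
    = ennreal (l powr (\<mu> * s)) * ennreal (exp (- (1 / l * trace_form A (l *\<^sub>R c + b) (l *\<^sub>R c + b))))
      * corner_weight A s Q y"
proof -
  define R where "R = y + (mat 1 - (c + Q))"
  note b = HD[OF assms(2)] and y = cornerD[OF assms(3)]
  have R: "c ** R = 0" "R ** c = 0" by (simp_all add: R_def prods y)
  define X where "X = l *\<^sub>R c + b + transpose b + (1 / l) *\<^sub>R (b ** transpose b) + R"
  define x where "x = l *\<^sub>R c + (b + transpose b + (y + (1 / l) *\<^sub>R (b ** transpose b)))"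
  have xX: "x + (mat 1 - (c + Q)) = X" by (simp add: x_def X_def R_def algebra_simps)
  have cR: "c + R = y + (mat 1 - Q)" by (simp add: R_def)
  \<comment> \<open>The part of \<open>x\<close> other than \<open>y\<close> is a square divided by
    \<open>l\<close>; under the trace against \<open>A\<close> this becomes the quadratic form of
    \<open>trace_form A\<close>.\<close>
  have "(l *\<^sub>R c + b) ** transpose (l *\<^sub>R c + b) = l *\<^sub>R (l *\<^sub>R c + b + transpose b + (1 / l) *\<^sub>R (b ** transpose b))"
    using assms(1) by (simp add: mat_distribs cT b scaleR_add_right)
  then have "trace_form A (l *\<^sub>R c + b) (l *\<^sub>R c + b)
      = l * trace (A ** (l *\<^sub>R c + b + transpose b + (1 / l) *\<^sub>R (b ** transpose b)))"
    by (simp only: trace_form_def matrix_mul_assoc' mmult.scaleR_right linear_scale[OF linear_trace] real_scaleR_def)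
  then have "1 / l * trace_form A (l *\<^sub>R c + b) (l *\<^sub>R c + b) + trace (A ** y) = trace (A ** x)"
    using assms(1) by (simp add: x_def mmult.add_right linear_add[OF linear_trace] add_ac)
  then have ex: "exp (- (1 / l * trace_form A (l *\<^sub>R c + b) (l *\<^sub>R c + b))) * exp (- trace (A ** y)) = exp (- trace (A ** x))"
    by (simp flip: exp_add)
  have S: "pos_def_mat X \<longleftrightarrow> pos_def_mat (c + R)" "det X = l ^ rank c * det (c + R)"
    unfolding X_def using Schur_complement[OF c(1,2) b(1,2) R assms(1)] by auto
  have pw: "det X powr s = l powr (\<mu> * s) * det (c + R) powr s"
    using assms(1) by (simp add: S(2) powr_mult \<mu>_def powr_powr flip: powr_realpow)
  show ?thesis
    unfolding x_def[symmetric] corner_weight_def xX cR[symmetric] pw ex[symmetric]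
    by (simp add: SymPos_def S(1) indicator_def ennreal_mult[symmetric] mult_ac)
qed

text \<open>Integrating \<open>y\<close> first, at fixed \<open>b\<close>, makes the translation by
  \<open>b' ** transpose b' / l\<close> available, where \<open>b' = b / sqrt 2\<close>; what is
  left is a Gaussian in \<open>b\<close>.\<close>

lemma inner_integral:
  assumes ws: "orthonormal_list ws" "span (set ws) = corner Z Q" and l: "0 < l"
  shows "iter_integral fs (\<lambda>b. iter_integral ws (\<lambda>y. corner_weight A s (c + Q) (l *\<^sub>R c + (L b + y))))
    = ennreal (l powr (\<mu> * s) * sqrt (2 * l) ^ m * sqrt pi ^ m * P powr (- 1 / 2) * exp (- (l * \<mu> * D)))
      * corner_integral Z A s Q"
proof -
  let ?G = "corner_integral Z A s Q"
  let ?e = "\<lambda>b. ennreal (exp (- (1 / l * trace_form A (l *\<^sub>R c + (1 / sqrt 2) *\<^sub>R b) (l *\<^sub>R c + (1 / sqrt 2) *\<^sub>R b))))"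
  have G: "?G = iter_integral ws (corner_weight A s Q)"
    by (rule corner_integral_eq[OF ws])
  have sH: "subspace H" using span_fs by (metis subspace_span)
  have inner: "iter_integral ws (\<lambda>y. corner_weight A s (c + Q) (l *\<^sub>R c + (L b + y)))
      = (ennreal (l powr (\<mu> * s)) * ?e b) * ?G" if "b \<in> H" for b
  proof -
    define b' where "b' = (1 / sqrt 2) *\<^sub>R b"
    have b': "b' \<in> H" using subspace_scale[OF sH that] by (simp add: b'_def)
    have Lb: "L b = b' + transpose b'" by (simp add: L_def b'_def mat_distribs scaleR_add_right)
    have "(1 / l) *\<^sub>R (b' ** transpose b') \<in> corner Z Q"
      using HD[OF b'] subspace_scale[OF Z(1) HD(10)[OF b']]
      by (simp add: corner_def mat_distribs) (simp add: matrix_mul_assoc)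
    then have "iter_integral ws (\<lambda>y. corner_weight A s (c + Q) (l *\<^sub>R c + (L b + y)))
        = iter_integral ws (\<lambda>y. corner_weight A s (c + Q) (l *\<^sub>R c + (L b + (y + (1 / l) *\<^sub>R (b' ** transpose b')))))"
      by (intro iter_integral_translate[symmetric]) (auto simp: ws)
    also have "\<dots> = iter_integral ws (\<lambda>y. (ennreal (l powr (\<mu> * s)) * ?e b) * corner_weight A s Q y)"
    proof (rule iter_integral_cong_span)
      fix y assume "y \<in> span (set ws)"
      then have "y \<in> corner Z Q" by (simp add: ws)
      from weight_pos[OF l b' this]
      show "corner_weight A s (c + Q) (l *\<^sub>R c + (L b + (y + (1 / l) *\<^sub>R (b' ** transpose b'))))
          = (ennreal (l powr (\<mu> * s)) * ?e b) * corner_weight A s Q y"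
        by (simp only: Lb b'_def add.assoc)
    qed
    also have "\<dots> = (ennreal (l powr (\<mu> * s)) * ?e b) * ?G"
      unfolding G by (rule iter_integral_cmult) measurable
    finally show ?thesis .
  qed
  have em: "?e \<in> borel_measurable borel"
    using measurable_compose[OF _ borel_measurable_bilinear_diag[OF bilinear_trace_form], of "\<lambda>b. l *\<^sub>R c + (1 / sqrt 2) *\<^sub>R b" borel A]
    by measurable
  have "iter_integral fs (\<lambda>b. iter_integral ws (\<lambda>y. corner_weight A s (c + Q) (l *\<^sub>R c + (L b + y))))
      = iter_integral fs (\<lambda>b. ennreal (l powr (\<mu> * s)) * (?e b * ?G))"
    by (rule iter_integral_cong_span) (simp only: span_fs inner mult.assoc)
  also have "\<dots> = ennreal (l powr (\<mu> * s)) * (iter_integral fs ?e * ?G)"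
    using em by (simp add: iter_integral_cmult iter_integral_multc)
  \<comment> \<open>In \<open>sqrt (2 * l)\<close> the factor \<open>sqrt 2\<close> undoes the
    normalisation of \<open>L\<close>, and \<open>sqrt l\<close> clears the division by
    \<open>l\<close>. The vector becomes \<open>sqrt l\<close> times
    \<open>sqrt (l * \<mu>) *\<^sub>R g 0 + b\<close>, the shape of
    \<open>iter_integral_gaussian\<close>.\<close>
  also have "iter_integral fs ?e = ennreal (sqrt (2 * l) ^ m) * iter_integral fs (\<lambda>b. ?e (sqrt (2 * l) *\<^sub>R b))"
    using iter_integral_scale[OF em, of "sqrt (2 * l)" fs] l by (simp add: fs_def)
  also have "(\<lambda>b. ?e (sqrt (2 * l) *\<^sub>R b))
      = (\<lambda>b. ennreal (exp (- trace_form A (sqrt (l * \<mu>) *\<^sub>R g 0 + b) (sqrt (l * \<mu>) *\<^sub>R g 0 + b))))"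
  proof
    fix b
    have "l *\<^sub>R c + (1 / sqrt 2) *\<^sub>R sqrt (2 * l) *\<^sub>R b = sqrt l *\<^sub>R (sqrt (l * \<mu>) *\<^sub>R g 0 + b)"
      using l mu_pos by (simp add: g_def et_def scaleR_add_right real_sqrt_mult)
    moreover have sq: "sqrt l * (sqrt l * x) / l = x" for x
      using l by (simp flip: mult.assoc)
    ultimately show "?e (sqrt (2 * l) *\<^sub>R b)
        = ennreal (exp (- trace_form A (sqrt (l * \<mu>) *\<^sub>R g 0 + b) (sqrt (l * \<mu>) *\<^sub>R g 0 + b)))"
      using sq by (simp add: bilinear_lmul[OF bilinear_trace_form] bilinear_rmul[OF bilinear_trace_form])
  qed
  also have "iter_integral fs \<dots> = ennreal (sqrt pi ^ m * P powr (- 1 / 2) * exp (- (l * \<mu> * D)))"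
  proof -
    have fs: "fs = map (g \<circ> Suc) [0..<m]" by (simp add: fs_def g_def)
    have gS: "g (Suc i) = f i" for i by (simp add: g_def)
    show ?thesis
      unfolding fs
      by (subst iter_integral_gaussian[OF bilinear_trace_form trace_form_commute[OF A_sym] g_pos])
         (use l mu_pos in \<open>simp add: gS P_def D_def\<close>)
  qed
  finally show ?thesis
    using l by (simp add: ennreal_mult[symmetric] mult.assoc[symmetric])
qed

definition "C = step_factor \<mu> m s (det_n (Suc m) (\<lambda>i j. trace_form A (g i) (g j))) P"

lemma corner_integral_step: "corner_integral Z A s (c + Q) = C * corner_integral Z A s Q"
proof -
  let ?G = "corner_integral Z A s Q"
  \<comment> \<open>With \<open>l = t / sqrt \<mu>\<close>, the factor
    \<open>l powr (\<mu> * s)\<close> and the \<open>m\<close> factors \<open>sqrt l\<close> combine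
    to \<open>l powr a\<close>, that is \<open>t powr a\<close> times
    \<open>\<mu> powr (- a / 2)\<close>. The exponent \<open>l * \<mu> * D\<close> becomes
    \<open>k * t\<close>.\<close>
  define a where "a = \<mu> * s + m / 2"
  define k where "k = sqrt \<mu> * D"
  define K where "K = \<mu> powr (- a / 2) * (2 * pi) powr (m / 2) * P powr (- 1 / 2)"
  have k: "0 < k" using mu_pos D_pos by (simp add: k_def)
  have K: "0 < K" using mu_pos P_pos by (simp add: K_def)
  obtain ws where ws: "orthonormal_list ws" "span (set ws) = corner Z Q"
    using orthonormal_list_exists[OF subspace_corner[OF Z(1)]] by metis
  have inner: "iter_integral fs (\<lambda>b. iter_integral ws (\<lambda>y. corner_weight A s (c + Q) (t *\<^sub>R et + (L b + y))))
      = ennreal K * ennreal (indicator {0<..} t * (t powr a * exp (- k * t))) * ?G" for t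
  proof (cases "0 < t")
    case True
    define l where "l = t / sqrt \<mu>"
    have l: "0 < l" using True mu_pos by (simp add: l_def)
    have te: "t *\<^sub>R et = l *\<^sub>R c" by (simp add: et_def l_def)
    have "l powr (\<mu> * s) * sqrt (2 * l) ^ m * sqrt pi ^ m * P powr (- 1 / 2) * exp (- (l * \<mu> * D))
        = K * (t powr a * exp (- k * t))"
    proof -
      have "sqrt (2 * l) ^ m * sqrt pi ^ m = sqrt ((2 * pi) * l) ^ m"
        by (simp add: real_sqrt_mult power_mult_distrib mult_ac)
      also have "\<dots> = (((2 * pi) * l) powr (1 / 2)) powr m"
        using l by (subst powr_realpow) (simp_all add: powr_half_sqrt)
      also have "\<dots> = ((2 * pi) * l) powr (m / 2)"
        by (simp add: powr_powr)
      finally have "sqrt (2 * l) ^ m * sqrt pi ^ m = ((2 * pi) * l) powr (m / 2)" .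
      then have "l powr (\<mu> * s) * (sqrt (2 * l) ^ m * sqrt pi ^ m) = (2 * pi) powr (m / 2) * l powr a"
        by (simp add: powr_mult a_def powr_add)
      moreover have "l powr a = \<mu> powr (- a / 2) * t powr a"
        using True mu_pos by (simp add: l_def powr_divide powr_minus powr_half_sqrt[symmetric] powr_powr field_simps)
      moreover have "l * \<mu> * D = k * t"
        using mu_pos by (simp add: l_def k_def real_div_sqrt field_simps)
      ultimately show ?thesis by (simp add: K_def mult_ac)
    qed
    then show ?thesis
      unfolding te inner_integral[OF ws l] using K True by (simp add: ennreal_mult[symmetric])
  next
    case False
    \<comment> \<open>The zero integrand is written \<open>0 * 0\<close> so that
      \<open>iter_integral_cmult\<close> can pull out a factor 0.\<close>
    have "iter_integral fs (\<lambda>b. iter_integral ws (\<lambda>y. corner_weight A s (c + Q) (t *\<^sub>R et + (L b + y))))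
        = iter_integral fs (\<lambda>b. iter_integral ws (\<lambda>y. 0 * 0))"
    proof (intro iter_integral_cong_span)
      fix b y assume b: "b \<in> span (set fs)" and y: "y \<in> span (set ws)"
      have sH: "subspace H" using span_fs by (metis subspace_span)
      define b' where "b' = (1 / sqrt 2) *\<^sub>R b"
      have b': "b' \<in> H" using subspace_scale[OF sH] b by (simp add: b'_def span_fs)
      have eq: "t *\<^sub>R et + (L b + y) = (t / sqrt \<mu>) *\<^sub>R c + (b' + transpose b' + y)"
        by (simp add: et_def L_def b'_def mat_distribs scaleR_add_right)
      show "corner_weight A s (c + Q) (t *\<^sub>R et + (L b + y)) = 0 * 0"
        unfolding eq
        using weight_nonpos[OF _ b', of "t / sqrt \<mu>" y] False mu_pos y ws(2) by (simp add: divide_nonpos_pos)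
    qed
    also have "\<dots> = 0"
      by (subst iter_integral_cmult, simp)+ simp
    finally show ?thesis using False by simp
  qed
  have "corner_integral Z A s (c + Q) = iter_integral ((et # map L fs) @ ws) (corner_weight A s (c + Q))"
    by (rule corner_integral_eq[OF basis[OF ws]])
  also have "\<dots> = (\<integral>\<^sup>+ t. ennreal K * ennreal (indicator {0<..} t * (t powr a * exp (- k * t))) * ?G \<partial>lborel)"
    by (simp only: iter_integral_append iter_integral.simps append_Cons iter_integral_linear_image[OF linear_L] inner add.assoc)
  also have "\<dots> = ennreal K * (\<integral>\<^sup>+ t. ennreal (indicator {0<..} t * (t powr a * exp (- k * t))) \<partial>lborel) * ?G"
    by (simp add: nn_integral_multc nn_integral_cmult)
  also have "ennreal K * (\<integral>\<^sup>+ t. ennreal (indicator {0<..} t * (t powr a * exp (- k * t))) \<partial>lborel) = C"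
  proof (cases "-1 < a")
    case True
    have "K * (Gamma (a + 1) * k powr (- a - 1))
        = \<mu> powr (- (\<mu> * s) - m / 2 - 1 / 2) * (2 * pi) powr (m / 2) * Gamma (\<mu> * s + m / 2 + 1)
          * D powr (- (\<mu> * s) - m / 2 - 1) * P powr (- 1 / 2)"
    proof -
      have "k powr (- a - 1) = \<mu> powr ((- a - 1) / 2) * D powr (- a - 1)"
        using mu_pos by (simp add: k_def powr_mult powr_half_sqrt[symmetric] powr_powr)
      moreover have "\<mu> powr (- a / 2) * \<mu> powr ((- a - 1) / 2) = \<mu> powr (- a - 1 / 2)"
      proof -
        have "- a / 2 + (- a - 1) / 2 = - a - 1 / 2" by (simp add: field_simps)
        then show ?thesis by (simp only: powr_add[symmetric])
      qed
      ultimately have "K * (Gamma (a + 1) * k powr (- a - 1)) = \<mu> powr (- a - 1 / 2) * (2 * pi) powr (m / 2) * Gamma (a + 1)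
          * D powr (- a - 1) * P powr (- 1 / 2)"
        by (simp add: K_def mult_ac)
      then show ?thesis by (simp add: a_def algebra_simps)
    qed
    moreover have "0 \<le> Gamma (a + 1) * k powr (- a - 1)"
      using True by (intro mult_nonneg_nonneg less_imp_le[OF Gamma_real_pos]) auto
    ultimately show ?thesis
      using True K unfolding nn_integral_powr_exp[OF k] by (simp add: C_def step_factor_def D_def[symmetric] a_def ennreal_mult[symmetric])
  next
    case False
    then show ?thesis
      using K unfolding nn_integral_powr_exp[OF k] by (simp add: C_def step_factor_def a_def ennreal_mult_top)
  qed
  finally show ?thesis .
qed

lemma step_factor_eq:
  "C = step_factor (rank c) m s (det_n (m + 1) (phi_entries A ((1 / sqrt (rank c)) *\<^sub>R c) f))
    (if m = 0 then 1 else det_n m (psi_entries A f))"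
  and gram_dets_pos: "0 < det_n (m + 1) (phi_entries A ((1 / sqrt (rank c)) *\<^sub>R c) f)"
    "0 < (if m = 0 then 1 else det_n m (psi_entries A f))"
proof -
  have phi: "phi_entries A ((1 / sqrt (rank c)) *\<^sub>R c) f = (\<lambda>i j. trace_form A (g i) (g j))"
    by (simp add: fun_eq_iff phi_entries_def Let_def trace_form_def g_def et_def \<mu>_def)
  \<comment> \<open>The empty determinant is 1, in agreement with the convention for
    \<open>m = 0\<close>.\<close>
  have psi: "(if m = 0 then 1 else det_n m (psi_entries A f)) = P"
    by (simp add: P_def psi_entries_def[abs_def] trace_form_def) (simp add: det_n_def)
  show "0 < (if m = 0 then 1 else det_n m (psi_entries A f))"
    unfolding psi by (rule P_pos)
  show "0 < det_n (m + 1) (phi_entries A ((1 / sqrt (rank c)) *\<^sub>R c) f)"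
    unfolding phi using det_n_gram_pos[OF bilinear_trace_form trace_form_commute[OF A_sym] g_pos] by simp
  show "C = step_factor (rank c) m s (det_n (m + 1) (phi_entries A ((1 / sqrt (rank c)) *\<^sub>R c) f))
      (if m = 0 then 1 else det_n m (psi_entries A f))"
    unfolding psi phi by (simp add: C_def \<mu>_def)
qed

lemma rank_pos: "0 < rank c"
  using rank_sym_idem_pos c by blast

end

section \<open>Primitive idempotents and Peirce components\<close>

text \<open>Polarising at \<open>v\<close> and \<open>S *v v\<close> turns the hypothesis into the
  vanishing of the squared norm of \<open>S *v v\<close>.\<close>

lemma sym_quadratic_zero:
  fixes S :: "real^'n^'n"
  assumes "transpose S = S" "\<And>v. v \<bullet> (S *v v) = 0"
  shows "S = 0"
proof -
  have "S *v v = 0" for v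
  proof -
    have "v \<bullet> (S *v (S *v v)) = (S *v v) \<bullet> (S *v v)"
      using dot_mult_transpose[of v S "S *v v"] by (simp add: assms(1))
    then show ?thesis
      using assms(2)[of "v + S *v v"] assms(2)[of v] assms(2)[of "S *v v"]
      by (simp add: matrix_vector_right_distrib inner_simps)
  qed
  then show ?thesis by (simp add: matrix_eq)
qed

section \<open>Matrices between 0 and 1 in the Loewner order and limits of repeated squares\<close>

definition between_0_1 :: "real^'n^'n \<Rightarrow> bool" where
  "between_0_1 A \<longleftrightarrow> transpose A = A \<and> (\<forall>v. 0 \<le> v \<bullet> (A *v v) \<and> v \<bullet> (A *v v) \<le> v \<bullet> v)"

lemma quadratic_square:
  fixes A :: "real^'n^'n"
  assumes "transpose A = A"
  shows "v \<bullet> ((A ** A) *v v) = (A *v v) \<bullet> (A *v v)"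
  using dot_mult_transpose[of v A "A *v v"] by (simp add: assms matrix_vector_mul_assoc)

text \<open>\<open>A - A\<^sup>2 = A (1 - A) A + (1 - A) A (1 - A)\<close>\<close>
lemma between_0_1_square_le:
  assumes A: "between_0_1 A"
  shows "v \<bullet> ((A ** A) *v v) \<le> v \<bullet> (A *v v)"
proof -
  have sym: "transpose A = A" using A by (simp add: between_0_1_def)
  have "v \<bullet> (A *v (A *v v)) = (A *v v) \<bullet> (A *v v)"
    using dot_mult_transpose[of v A "A *v v"] by (simp add: sym)
  then have "v \<bullet> (A *v v) - (A *v v) \<bullet> (A *v v)
      = ((A *v v) \<bullet> (A *v v) - (A *v v) \<bullet> (A *v (A *v v))) + (v - A *v v) \<bullet> (A *v (v - A *v v))"
    by (simp add: matrix_vector_mult_diff_distrib inner_simps)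
  also have "\<dots> \<ge> 0"
    using A unfolding between_0_1_def by (intro add_nonneg_nonneg) auto
  finally show ?thesis by (simp add: quadratic_square[OF sym])
qed

lemma between_0_1_square:
  assumes A: "between_0_1 A"
  shows "between_0_1 (A ** A)"
proof -
  have sym: "transpose A = A" using A by (simp add: between_0_1_def)
  show ?thesis
    unfolding between_0_1_def
  proof (intro conjI allI)
    show "transpose (A ** A) = A ** A" by (simp add: matrix_transpose_mul sym)
    fix v show "0 \<le> v \<bullet> ((A ** A) *v v)" by (simp add: quadratic_square[OF sym])
    have "v \<bullet> (A *v v) \<le> v \<bullet> v" using A by (simp add: between_0_1_def)
    then show "v \<bullet> ((A ** A) *v v) \<le> v \<bullet> v"
      using between_0_1_square_le[OF A, of v] by simp
  qed
qed

text \<open>Since the square of \<open>A\<close> lies below \<open>A\<close>, the norm of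
  \<open>A *v v\<close> is at most that of \<open>v\<close>; expanding the squared norm of
  \<open>A *v v - v\<close> then leaves nothing positive.\<close>

lemma between_0_1_fixpoint:
  assumes A: "between_0_1 A" and v: "v \<bullet> (A *v v) = v \<bullet> v"
  shows "A *v v = v"
proof -
  have sym: "transpose A = A" using A by (simp add: between_0_1_def)
  have "(A *v v) \<bullet> (A *v v) \<le> v \<bullet> v"
    using between_0_1_square_le[OF A, of v] v by (simp add: quadratic_square[OF sym])
  then have "(A *v v - v) \<bullet> (A *v v - v) \<le> 0"
    using v by (simp add: inner_simps inner_commute)
  then show ?thesis by (metis inner_gt_zero_iff not_le right_minus_eq)
qed

text \<open>Squaring lowers the quadratic form, so its values at each vector decrease and stay
  bounded; polarisation at basis vectors recovers the entries from these values.\<close>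

lemma repeated_squares_converge:
  fixes A :: "nat \<Rightarrow> real^'n^'n"
  assumes "between_0_1 (A 0)" and Suc: "\<And>n. A (Suc n) = A n ** A n"
  obtains L where "A \<longlonglongrightarrow> L"
proof -
  have b: "between_0_1 (A n)" for n
    by (induction n) (auto simp: assms between_0_1_square)
  then have sym: "transpose (A n) = A n" for n by (simp add: between_0_1_def)
  have q: "convergent (\<lambda>n. v \<bullet> (A n *v v))" for v
  proof (rule Bseq_monoseq_convergent)
    have "decseq (\<lambda>n. v \<bullet> (A n *v v))"
      by (rule decseq_SucI) (simp add: Suc between_0_1_square_le[OF b])
    then show "monoseq (\<lambda>n. v \<bullet> (A n *v v))" by (simp add: decseq_imp_monoseq)
    have "norm (v \<bullet> (A n *v v)) \<le> v \<bullet> v" for n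
      using b[of n] unfolding between_0_1_def by (metis abs_of_nonneg real_norm_def)
    then show "Bseq (\<lambda>n. v \<bullet> (A n *v v))" by (intro BseqI') auto
  qed
  have "convergent (\<lambda>n. A n $ i $ j)" for i j
  proof -
    let ?u = "axis i 1 :: real^'n" and ?v = "axis j 1 :: real^'n"
    have eq: "A n $ i $ j = ((?u + ?v) \<bullet> (A n *v (?u + ?v)) - ?u \<bullet> (A n *v ?u) - ?v \<bullet> (A n *v ?v)) * (1/2)" for n
    proof -
      have "?u \<bullet> (A n *v ?v) = A n $ i $ j"
        by (simp add: inner_axis' matrix_vector_mult_basis column_def)
      moreover have "?v \<bullet> (A n *v ?u) = ?u \<bullet> (A n *v ?v)"
        using dot_mult_transpose[of ?v "A n" ?u] by (simp add: sym inner_commute)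
      ultimately show ?thesis
        by (simp add: matrix_vector_right_distrib inner_add_left inner_add_right)
    qed
    show ?thesis
      unfolding eq by (intro convergent_mult convergent_diff q convergent_const)
  qed
  then obtain l where "\<And>i j. (\<lambda>n. A n $ i $ j) \<longlonglongrightarrow> l i j"
    unfolding convergent_def by metis
  then have "A \<longlonglongrightarrow> (\<chi> i j. l i j)"
    by (intro vec_tendstoI) simp
  then show ?thesis by (rule that)
qed

text \<open>If \<open>w\<close> were not a multiple of \<open>c\<close>, then, rescaled to have spectrum spanning \<open>[0, 1]\<close> on the range
  of \<open>c\<close>, its repeated squares would converge to an idempotent strictly between \<open>0\<close> and \<open>c\<close>.\<close>
lemma primitive_idempotent:
  fixes c w :: "real^'n^'n"
  assumes S: "subspace S" and SSym: "S \<subseteq> Sym" and sq: "\<And>x. x \<in> S \<Longrightarrow> x ** x \<in> S"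
    and c: "sym_idem c" "c \<in> S" "c \<noteq> 0"
    and prim: "\<And>u. u \<in> S \<Longrightarrow> u ** u = u \<Longrightarrow> c ** u ** c = u \<Longrightarrow> u = 0 \<or> u = c"
    and w: "w \<in> S" "c ** w ** c = w"
  shows "\<exists>l. w = l *\<^sub>R c"
proof -
  have cT: "transpose c = c" "c ** c = c" using c by (auto simp: sym_idem_def)
  have cw: "c ** w = w" "w ** c = w"
    using w(2) cT(2) by (metis matrix_mul_assoc)+
  have wT: "transpose w = w" using w SSym by (auto simp: Sym_def)
  \<comment> \<open>The unit sphere of the range of \<open>c\<close>. The extreme values of the
    quadratic form of \<open>w\<close> on it play the role of smallest and largest
    eigenvalue.\<close>
  define K where "K = {v. norm v = 1 \<and> c *v v = v}"
  have "K = sphere 0 1 \<inter> {v. c *v v = v}" by (auto simp: K_def)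
  moreover have "closed {v. c *v v = v}"
    by (intro closed_Collect_eq linear_continuous_on matrix_vector_mul_bounded_linear continuous_on_id)
  ultimately have K: "compact K" by (simp add: compact_Int_closed)
  obtain v0 where v0: "c *v v0 \<noteq> 0"
    using c(3) matrix_eq by (metis matrix_vector_mult_0)
  have normed: "(c *v v) /\<^sub>R norm (c *v v) \<in> K" if "c *v v \<noteq> 0" for v
    using that by (simp add: K_def matrix_vector_mult_scaleR matrix_vector_mul_assoc cT)
  then have Kne: "K \<noteq> {}" using v0 by blast
  let ?q = "\<lambda>v. v \<bullet> (w *v v)"
  have cont: "continuous_on K ?q"
    by (intro continuous_intros linear_continuous_on matrix_vector_mul_bounded_linear)
  obtain vm where vm: "vm \<in> K" "\<And>v. v \<in> K \<Longrightarrow> ?q vm \<le> ?q v"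
    using continuous_attains_inf[OF K Kne cont] by auto
  obtain vM where vM: "vM \<in> K" "\<And>v. v \<in> K \<Longrightarrow> ?q v \<le> ?q vM"
    using continuous_attains_sup[OF K Kne cont] by auto
  have qc: "?q v = ?q (c *v v)" for v
    using dot_mult_transpose[of v c "w *v (c *v v)"] by (simp add: cT matrix_vector_mul_assoc cw)
  have scale: "?q v = (norm (c *v v))\<^sup>2 * ?q ((c *v v) /\<^sub>R norm (c *v v))" if "c *v v \<noteq> 0" for v
    using that by (subst qc) (simp add: matrix_vector_mult_scaleR power2_eq_square field_simps)
  have lo: "?q vm * (norm (c *v v))\<^sup>2 \<le> ?q v" and hi: "?q v \<le> ?q vM * (norm (c *v v))\<^sup>2" for v
  proof -
    have "?q vm * (norm (c *v v))\<^sup>2 \<le> ?q v \<and> ?q v \<le> ?q vM * (norm (c *v v))\<^sup>2"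
    proof (cases "c *v v = 0")
      case True
      then show ?thesis using qc[of v] by simp
    next
      case False
      show ?thesis
        unfolding scale[OF False] mult.commute[of _ "(norm (c *v v))\<^sup>2"]
        by (intro conjI mult_left_mono vm(2) vM(2) normed False) simp_all
    qed
    then show "?q vm * (norm (c *v v))\<^sup>2 \<le> ?q v" "?q v \<le> ?q vM * (norm (c *v v))\<^sup>2" by auto
  qed
  have cq: "v \<bullet> (c *v v) = (norm (c *v v))\<^sup>2" for v
    using sym_idem_quadratic[OF c(1)] by (simp add: power2_norm_eq_inner)
  show ?thesis
  proof (cases "?q vm = ?q vM")
    case True
    \<comment> \<open>With equal extremes, \<open>lo\<close> and \<open>hi\<close> pin the form of
      \<open>w\<close> to a multiple of that of \<open>c\<close>.\<close>
    have "w - ?q vm *\<^sub>R c = 0"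
    proof (rule sym_quadratic_zero)
      show "transpose (w - ?q vm *\<^sub>R c) = w - ?q vm *\<^sub>R c"
        by (simp add: mat_distribs cT wT)
      fix v
      show "v \<bullet> ((w - ?q vm *\<^sub>R c) *v v) = 0"
        using lo[of v] hi[of v] True
        by (simp add: matrix_vector_mult_diff_rdistrib inner_diff_right cq flip: scaleR_matrix_vector_assoc)
    qed
    then show ?thesis by auto
  next
    case False
    define D where "D = ?q vM - ?q vm"
    have D: "0 < D" using vm(2)[OF vM(1)] False by (simp add: D_def)
    define u where "u = (1 / D) *\<^sub>R (w - ?q vm *\<^sub>R c)"
    have uq: "v \<bullet> (u *v v) = (?q v - ?q vm * (norm (c *v v))\<^sup>2) / D" for v
      by (simp add: u_def matrix_vector_mult_diff_rdistrib inner_diff_right cq flip: scaleR_matrix_vector_assoc)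
    have cle: "(norm (c *v v))\<^sup>2 \<le> v \<bullet> v" for v
    proof -
      have "0 \<le> (v - c *v v) \<bullet> (v - c *v v)" by simp
      then show ?thesis
        using sym_idem_quadratic[OF c(1), of v] by (simp add: inner_simps inner_commute power2_norm_eq_inner)
    qed
    have "between_0_1 u"
      unfolding between_0_1_def
    proof (intro conjI allI)
      show "transpose u = u" by (simp add: u_def mat_distribs cT wT)
      fix v
      show "0 \<le> v \<bullet> (u *v v)" using lo[of v] D by (simp add: uq)
      have "v \<bullet> (u *v v) \<le> (norm (c *v v))\<^sup>2"
        using hi[of v] D by (simp add: uq field_simps) (simp add: D_def algebra_simps)
      then show "v \<bullet> (u *v v) \<le> v \<bullet> v" using cle[of v] by simp
    qed
    define B where "B = rec_nat u (\<lambda>_ X. X ** X)"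
    have B: "B 0 = u" "B (Suc n) = B n ** B n" for n by (simp_all add: B_def)
    have b01: "between_0_1 (B n)" for n
      by (induction n) (auto simp: B \<open>between_0_1 u\<close> between_0_1_square)
    obtain L where L: "B \<longlonglongrightarrow> L"
      using repeated_squares_converge[of B] B \<open>between_0_1 u\<close> by metis
    have uS: "u \<in> S"
      unfolding u_def using S w c by (intro subspace_scale subspace_diff) auto
    have BS: "B n \<in> S" "c ** B n ** c = B n" for n
    proof -
      have "B n \<in> S \<and> c ** B n = B n \<and> B n ** c = B n"
      proof (induction n)
        case 0
        then show ?case using uS by (simp add: B u_def mat_distribs cw cT)
      next
        case (Suc n)
        then show ?case by (metis B(2) matrix_mul_assoc sq)
      qed
      then show "B n \<in> S" "c ** B n ** c = B n" by auto
    qed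
    have "L \<in> S"
      using closed_sequentially[OF closed_subspace[OF S], of B L] BS L by auto
    moreover have "L ** L = L"
    proof (rule LIMSEQ_unique)
      show "(\<lambda>n. B (Suc n)) \<longlonglongrightarrow> L ** L"
        unfolding B by (intro mmult.tendsto L)
      show "(\<lambda>n. B (Suc n)) \<longlonglongrightarrow> L" using L by (rule LIMSEQ_Suc)
    qed
    moreover have "c ** L ** c = L"
    proof (rule LIMSEQ_unique[OF _ L])
      have "(\<lambda>n. c ** B n ** c) \<longlonglongrightarrow> c ** L ** c"
        by (intro mmult.tendsto L tendsto_const)
      then show "B \<longlonglongrightarrow> c ** L ** c" by (simp add: BS)
    qed
    ultimately have L0c: "L = 0 \<or> L = c" by (rule prim)
    have limv: "(\<lambda>n. v \<bullet> (B n *v v)) \<longlonglongrightarrow> v \<bullet> (L *v v)" for v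
    proof -
      have "linear (\<lambda>x::real^'n^'n. v \<bullet> (x *v v))"
        by (auto simp: linear_iff matrix_vector_mult_add_rdistrib inner_add_right simp flip: scaleR_matrix_vector_assoc)
      then have "bounded_linear (\<lambda>x::real^'n^'n. v \<bullet> (x *v v))" by (simp add: linear_conv_bounded_linear)
      from bounded_linear.tendsto[OF this L] show ?thesis .
    qed
    have nM: "norm vM = 1" "c *v vM = vM" and nm: "norm vm = 1" "c *v vm = vm"
      using vM(1) vm(1) by (auto simp: K_def)
    \<comment> \<open>At the maximum the rescaled form equals the squared norm, so every repeated
      square fixes \<open>vM\<close>. The limit cannot be 0 and must be \<open>c\<close>.\<close>
    have "u *v vM = vM"
      using nM D by (intro between_0_1_fixpoint[OF \<open>between_0_1 u\<close>])
        (simp add: uq D_def[symmetric] power2_norm_eq_inner[symmetric])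
    then have "B n *v vM = vM" for n
      by (induction n) (auto simp: B simp flip: matrix_vector_mul_assoc)
    then have "vM \<bullet> (L *v vM) = vM \<bullet> vM"
      using limv[of vM] by (simp add: LIMSEQ_const_iff)
    then have "L = c" using L0c nM by auto
    \<comment> \<open>At the minimum the rescaled form is 0 and the squares stay below it, so the
      limit has form 0 at \<open>vm\<close>. This contradicts \<open>L = c\<close>, because
      \<open>c\<close> fixes the unit vector \<open>vm\<close>.\<close>
    have "vm \<bullet> (B n *v vm) = 0" for n
    proof -
      have "vm \<bullet> (B n *v vm) \<le> 0"
      proof (induction n)
        case 0
        then show ?case using nm by (simp add: B uq)
      next
        case (Suc n)
        then show ?case using between_0_1_square_le[OF b01, of vm n] by (simp add: B)
      qed
      moreover have "0 \<le> vm \<bullet> (B n *v vm)" using b01[of n] by (simp add: between_0_1_def)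
      ultimately show ?thesis by simp
    qed
    then have "vm \<bullet> (L *v vm) = 0"
      using limv[of vm] by (simp add: LIMSEQ_const_iff)
    then have "vm = 0" using \<open>L = c\<close> nm by simp
    then show ?thesis using nm by simp
  qed
qed

text \<open>\<open>e\<close> stands for one diagonal block and \<open>E\<close> for all later blocks
  together. The assumptions \<open>exe\<close>, \<open>Exe\<close> and \<open>ExE\<close> come from
  the decomposition (Z0); \<open>jordan\<close>, \<open>right_mult\<close> and \<open>ExexE\<close>
  come from (Z1), partly by polarisation.\<close>

locale block_step =
  fixes Z :: "(real^'n^'n) set" and e E :: "real^'n^'n"
  assumes Z: "subspace Z" "Z \<subseteq> Sym" and eE: "sym_idem e" "sym_idem E" "e ** E = 0" "E ** e = 0"
    and exe: "\<And>x. x \<in> Z \<Longrightarrow> e ** x ** e \<in> Z"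
    and Exe: "\<And>x. x \<in> Z \<Longrightarrow> E ** x ** e + e ** x ** E \<in> Z"
    and ExE: "\<And>x. x \<in> Z \<Longrightarrow> E ** x ** E \<in> Z"
    and jordan: "\<And>x y. x \<in> Z \<Longrightarrow> y \<in> Z \<Longrightarrow> e ** x ** e = x \<Longrightarrow> e ** y ** e = y \<Longrightarrow> x ** y + y ** x \<in> Z"
    and right_mult: "\<And>x y. x \<in> Z \<Longrightarrow> y \<in> Z \<Longrightarrow> e ** y ** e = y \<Longrightarrow> E ** x ** y + y ** x ** E \<in> Z"
    and ExexE: "\<And>x. x \<in> Z \<Longrightarrow> E ** x ** e ** x ** E \<in> Z"
begin

definition "M = {x \<in> Z. e ** x ** e = x}"

lemma eT: "transpose e = e" "e ** e = e" "transpose E = E" "E ** E = E"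
  using eE by (auto simp: sym_idem_def)

lemma ezeros: "e ** (E ** X) = 0" "E ** (e ** X) = 0" "e ** (e ** X) = e ** X" "E ** (E ** X) = E ** X"
  using eE(3,4) eT by (simp_all add: matrix_mul_assoc mmult.zero_left)

lemmas eprods = mat_distribs mat_zeros eT eE ezeros

lemma MD:
  assumes "x \<in> M"
  shows "x \<in> Z" "e ** x = x" "x ** e = x" "E ** x = 0" "x ** E = 0" "e ** (x ** y) = x ** y" "x ** (e ** y) = x ** y"
    "E ** (x ** y) = 0" "x ** (E ** y) = 0"
proof -
  show "x \<in> Z" using assms by (simp add: M_def)
  have x: "x = e ** (x ** e)" using assms by (simp add: M_def matrix_mul_assoc')
  show 1: "e ** x = x" "x ** e = x"
    by (subst x, subst (2) x, simp add: eprods)+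
  show 2: "E ** x = 0" "x ** E = 0"
    by (subst x, simp add: eprods)+
  show "e ** (x ** y) = x ** y" "x ** (e ** y) = x ** y" "E ** (x ** y) = 0" "x ** (E ** y) = 0"
    by (simp_all add: matrix_mul_assoc 1 2 mmult.zero_left)
qed

lemma subspace_M: "subspace M"
  using Z(1) unfolding subspace_def M_def by (auto simp: mat_distribs mat_zeros)

lemma M_jordan:
  assumes "x \<in> M" "y \<in> M"
  shows "x ** y + y ** x \<in> M"
proof -
  have "x ** y + y ** x \<in> Z"
    using assms by (intro jordan) (simp_all add: M_def)
  then show ?thesis
    unfolding M_def by (simp add: mat_distribs MD[OF assms(1)] MD[OF assms(2)])
qed

lemma M_square: "x \<in> M \<Longrightarrow> x ** x \<in> M"
proof -
  assume "x \<in> M"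
  then have "(1/2) *\<^sub>R (x ** x + x ** x) \<in> M"
    by (intro subspace_scale[OF subspace_M] M_jordan)
  then show ?thesis by (simp flip: scaleR_2)
qed

text \<open>The quadratic representation of a Jordan algebra: with the Jordan product,
  \<open>x ** y ** x\<close> is twice the product of \<open>x\<close> with (\<open>x\<close> times
  \<open>y\<close>), minus the product of \<open>x ** x\<close> with \<open>y\<close>.\<close>

lemma M_quadratic: assumes "x \<in> M" "y \<in> M" shows "x ** y ** x \<in> M"
proof -
  have "(1/2) *\<^sub>R ((x ** (x ** y + y ** x) + (x ** y + y ** x) ** x) - ((x ** x) ** y + y ** (x ** x))) \<in> M"
    using assms by (intro subspace_scale[OF subspace_M] subspace_diff[OF subspace_M] M_jordan M_square)
  also have "(1/2) *\<^sub>R ((x ** (x ** y + y ** x) + (x ** y + y ** x) ** x) - ((x ** x) ** y + y ** (x ** x))) = x ** y ** x"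
    by (simp add: mat_distribs flip: scaleR_2)
  finally show ?thesis .
qed

lemma M_quadratic2: assumes "q \<in> M" "c \<in> M" "y \<in> M" shows "q ** y ** c + c ** y ** q \<in> M"
proof -
  have "(q + c) ** y ** (q + c) - q ** y ** q - c ** y ** c \<in> M"
    using assms by (intro subspace_diff[OF subspace_M] M_quadratic subspace_add[OF subspace_M])
  then show ?thesis by (simp add: mat_distribs add.commute)
qed

lemma exe_M: "x \<in> Z \<Longrightarrow> e ** x ** e \<in> M"
  using exe by (simp add: M_def eprods)

lemma M_Z: "x \<in> M \<Longrightarrow> x \<in> Z" by (simp add: M_def)

lemma right_mult_M: "x \<in> Z \<Longrightarrow> y \<in> M \<Longrightarrow> E ** x ** y + y ** x ** E \<in> Z"
  using right_mult by (simp add: M_def)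

lemma QxQ:
  assumes "q \<in> M" "x \<in> Z"
  shows "(q + E) ** x ** (q + E) \<in> Z"
proof -
  have "q ** (e ** x ** e) ** q + (E ** x ** q + q ** x ** E) + E ** x ** E \<in> Z"
    using assms by (intro subspace_add[OF Z(1)] right_mult_M ExE M_Z[OF M_quadratic] exe_M)
  then show ?thesis
    by (simp add: mat_distribs MD[OF assms(1)] add_ac)
qed

lemma Qxc:
  assumes "q \<in> M" "c \<in> M" "x \<in> Z"
  shows "(q + E) ** x ** c + c ** x ** (q + E) \<in> Z"
proof -
  have "(q ** (e ** x ** e) ** c + c ** (e ** x ** e) ** q) + (E ** x ** c + c ** x ** E) \<in> Z"
    using assms by (intro subspace_add[OF Z(1)] right_mult_M M_Z[OF M_quadratic2] exe_M)
  then show ?thesis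
    by (simp add: mat_distribs MD[OF assms(1)] MD[OF assms(2)] add_ac)
qed

text \<open>Expanding \<open>q + E\<close> on both sides leaves a block inside \<open>e\<close>, a
  block inside \<open>E\<close> and a symmetric pair of mixed blocks, each with its own reason for
  lying in \<open>Z\<close>.\<close>

lemma QxcxQ:
  assumes M: "q \<in> M" "c \<in> M" "x \<in> Z" and idem: "c ** c = c" "q ** q = q" "c ** q = 0" "q ** c = 0"
  shows "(q + E) ** x ** c ** x ** (q + E) \<in> Z"
proof -
  note mm = MD[OF M(1)] MD[OF M(2)]
  have cc: "c ** (c ** y) = c ** y" "q ** (q ** y) = q ** y" "c ** (q ** y) = 0" "q ** (c ** y) = 0" for y
    by (simp_all add: matrix_mul_assoc idem mmult.zero_left)
  define z where "z = e ** x ** e"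
  have z: "z \<in> M" unfolding z_def by (rule exe_M[OF M(3)])
  have 1: "q ** (z ** c ** z) ** q \<in> Z"
    using M z by (intro M_Z[OF M_quadratic] M_quadratic)
  \<comment> \<open>\<open>ExexE\<close> is applied to \<open>E ** x ** c + c ** x ** E\<close> in
    place of \<open>x\<close>, and \<open>c ** c = c\<close> contracts the middle.\<close>
  have 2: "E ** x ** c ** x ** E \<in> Z"
    using ExexE[OF right_mult_M[OF M(3,2)]] by (simp add: eprods mm cc idem)
  \<comment> \<open>Chosen so that \<open>w ** q = c ** z ** q\<close>: multiplying by
    \<open>w\<close> and then by \<open>q\<close> from the right yields the mixed block, although
    \<open>c ** z ** q\<close> itself is not symmetric.\<close>
  define w where "w = q ** z ** c + c ** z ** q"
  have w: "w \<in> M" unfolding w_def using M z by (intro M_quadratic2)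
  have 3: "E ** x ** c ** x ** q + q ** x ** c ** x ** E \<in> Z"
    using right_mult_M[OF right_mult_M[OF M(3) w] M(1)]
    by (simp add: w_def z_def eprods mm cc idem)
  have "q ** (z ** c ** z) ** q + (E ** x ** c ** x ** q + q ** x ** c ** x ** E) + E ** x ** c ** x ** E \<in> Z"
    by (intro subspace_add[OF Z(1)] 1 2 3)
  then show ?thesis
    by (simp add: mat_distribs z_def mm add_ac)
qed

lemma cxc:
  assumes c: "sym_idem c" "c \<in> M" "c \<noteq> 0" and x: "x \<in> Z"
    and prim: "\<And>u. u \<in> M \<Longrightarrow> u ** u = u \<Longrightarrow> c ** u ** c = u \<Longrightarrow> u = 0 \<or> u = c"
  shows "\<exists>l. c ** x ** c = l *\<^sub>R c"
proof -
  have "c ** x ** c = c ** (e ** x ** e) ** c"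
    by (simp add: mat_distribs MD[OF c(2)])
  then have w1: "c ** x ** c \<in> M"
    using M_quadratic[OF c(2) exe_M[OF x]] by simp
  have w2: "c ** (c ** x ** c) ** c = c ** x ** c"
    using c(1) by (simp add: sym_idem_def mat_distribs) (simp add: matrix_mul_assoc sym_idem_def)
  have MS: "M \<subseteq> Sym" using Z(2) by (auto simp: M_def)
  show ?thesis
    by (rule primitive_idempotent[OF subspace_M MS _ c _ w1 w2]) (erule M_square, rule prim)
qed

text \<open>The defining form of \<open>hspace\<close> treats diagonal and off-diagonal elements
  separately. Because \<open>q\<close> sees only the diagonal block of \<open>x\<close> and
  \<open>E\<close> only the off-diagonal one, it is the single image \<open>Q ** x ** c\<close>
  required for peeling.\<close>

lemma h_image:
  assumes q: "q \<in> M" and c: "c \<in> M"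
  shows "{q ** y ** c + l ** c | y l. y \<in> M \<and> l \<in> Z \<and> E ** l ** e + e ** l ** E = l}
    = {(q + E) ** x ** c | x. x \<in> Z}"
proof (intro equalityI subsetI)
  fix b assume "b \<in> {q ** y ** c + l ** c | y l. y \<in> M \<and> l \<in> Z \<and> E ** l ** e + e ** l ** E = l}"
  then obtain y l where b: "b = q ** y ** c + l ** c" and y: "y \<in> M" and l: "l \<in> Z" "E ** l ** e + e ** l ** E = l"
    by blast
  have "(q + E) ** (y + l) ** c = q ** y ** c + (q ** l ** c + E ** l ** c)"
    by (simp add: mat_distribs MD[OF y])
  also have "q ** l ** c = 0"
    by (subst l(2)[symmetric]) (simp add: eprods MD[OF q] MD[OF c])
  also have "E ** l ** c = l ** c"
    by (subst (1 2) l(2)[symmetric]) (simp add: eprods MD[OF q] MD[OF c])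
  finally have "b = (q + E) ** (y + l) ** c" by (simp add: b)
  then show "b \<in> {(q + E) ** x ** c | x. x \<in> Z}"
    using y l(1) Z(1) by (auto simp: M_def intro: subspace_add)
next
  fix b assume "b \<in> {(q + E) ** x ** c | x. x \<in> Z}"
  then obtain x where x: "x \<in> Z" "b = (q + E) ** x ** c" by blast
  define l where "l = E ** x ** e + e ** x ** E"
  have "b = q ** (e ** x ** e) ** c + l ** c"
    by (simp add: x l_def eprods MD[OF q] MD[OF c])
  moreover have "l \<in> Z" unfolding l_def by (rule Exe[OF x(1)])
  moreover have "E ** l ** e + e ** l ** E = l" by (simp add: l_def eprods)
  ultimately show "b \<in> {q ** y ** c + l ** c | y l. y \<in> M \<and> l \<in> Z \<and> E ** l ** e + e ** l ** E = l}"
    using exe_M[OF x(1)] by blast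
qed

end

section \<open>The block structure\<close>

definition diag_proj :: "('n \<Rightarrow> bool) \<Rightarrow> real^'n^'n" where
  "diag_proj P = (\<chi> a b. if a = b \<and> P a then 1 else 0)"

lemma diag_proj_mult_left: "(diag_proj P ** x) $ a $ b = (if P a then x $ a $ b else 0)"
  for x :: "real^'n^'n"
  by (simp add: diag_proj_def matrix_matrix_mult_def if_distrib[of "\<lambda>t. t * _"] cong: if_cong)

lemma diag_proj_mult_right: "(x ** diag_proj P) $ a $ b = (if P b then x $ a $ b else 0)"
  for x :: "real^'n^'n"
proof -
  have "(x ** diag_proj P) $ a $ b = (\<Sum>k\<in>UNIV. if k = b then (if P b then x $ a $ b else 0) else 0)"
    unfolding diag_proj_def matrix_matrix_mult_def vec_lambda_beta by (intro sum.cong) auto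
  then show ?thesis by simp
qed

lemma sym_idem_diag_proj: "sym_idem (diag_proj P)"
  unfolding sym_idem_def
  by (auto simp: vec_eq_iff diag_proj_mult_left) (auto simp: diag_proj_def transpose_def)

lemma diag_proj_disjoint: "(\<And>a. \<not> (P a \<and> P' a)) \<Longrightarrow> diag_proj P ** diag_proj P' = 0"
  by (auto simp: vec_eq_iff diag_proj_mult_left) (auto simp: diag_proj_def)

definition etail :: "('n::finite \<Rightarrow> nat) \<Rightarrow> nat \<Rightarrow> real^'n^'n" where
  "etail blk i = diag_proj (\<lambda>a. i \<le> blk a)"

lemma eblk_diag_proj: "eblk blk i = diag_proj (\<lambda>a. blk a = i)"
  by (auto simp: eblk_def diag_proj_def vec_eq_iff)

lemma etail_rec: "etail blk i = eblk blk i + etail blk (Suc i)"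
  by (auto simp: etail_def eblk_diag_proj diag_proj_def vec_eq_iff)

locale block_space =
  fixes blk :: "'n::finite \<Rightarrow> nat" and r :: nat and Z :: "(real^'n^'n) set"
  assumes blk: "range blk = {..<r}" and subsp: "subspace Z" and ZSym: "Z \<subseteq> Sym"
    and Z0: "condZ0 blk r Z" and Z1: "condZ1 blk Z"
begin

text \<open>A pattern of blocks is compatible with the decomposition of \<open>Z\<close> if membership of an
  off-diagonal block \<open>(p, q)\<close> only depends on \<open>min p q\<close>, the index of its \<open>Lblk\<close> component.\<close>
lemma block_mask:
  assumes x: "x \<in> Z" and K: "\<And>p q. p \<noteq> q \<Longrightarrow> K p q = KL (min p q)"
  shows "(\<chi> a b. if K (blk a) (blk b) then x $ a $ b else 0) \<in> Z"
proof -
  obtain M L where x_eq: "x = (\<Sum>i<r. M i) + (\<Sum>i<r-1. L i)"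
    and M: "\<And>i. i < r \<Longrightarrow> M i \<in> Mblk blk Z i" and L: "\<And>i. i < r-1 \<Longrightarrow> L i \<in> Lblk blk Z i"
    using Z0 x unfolding condZ0_def by blast
  define y where "y = (\<Sum>i<r. if K i i then M i else 0) + (\<Sum>i<r-1. if KL i then L i else 0)"
  have "y \<in> Z"
    unfolding y_def using M L subspace_0[OF subsp]
    by (intro subspace_add[OF subsp] subspace_sum[OF subsp]) (auto simp: Mblk_def Lblk_def)
  moreover have eq: "y $ a $ b = (if K (blk a) (blk b) then x $ a $ b else 0)" for a b
  proof -
    let ?k = "if K (blk a) (blk b) then 1 else (0::real)"
    have "(if K i i then M i else 0) $ a $ b = ?k * M i $ a $ b" if "i < r" for i
      using M[OF that] by (cases "M i $ a $ b = 0") (auto simp: Mblk_def)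
    moreover have "(if KL i then L i else 0) $ a $ b = ?k * L i $ a $ b" if "i < r - 1" for i
    proof (cases "L i $ a $ b = 0")
      case False
      then have "blk b < blk a \<and> blk b = i \<or> blk a < blk b \<and> blk a = i"
        using L[OF that] unfolding Lblk_def by blast
      then have "blk a \<noteq> blk b \<and> min (blk a) (blk b) = i" by auto
      then show ?thesis using K by auto
    qed simp
    ultimately have "y $ a $ b = ?k * x $ a $ b"
      by (simp add: y_def x_eq sum_component distrib_left sum_distrib_left)
    then show ?thesis by simp
  qed
  moreover have "(\<chi> a b. if K (blk a) (blk b) then x $ a $ b else 0) = y"
    by (simp add: vec_eq_iff eq)
  ultimately show ?thesis by simp
qed

lemma BlockTri_add: "BlockTri blk (x + y) = BlockTri blk x + BlockTri blk y"
  by (simp add: BlockTri_def vec_eq_iff)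

lemma Z1_polar:
  assumes "x \<in> Z" "y \<in> Z"
  shows "BlockTri blk x ** transpose (BlockTri blk y) + BlockTri blk y ** transpose (BlockTri blk x) \<in> Z"
proof -
  let ?q = "\<lambda>x. BlockTri blk x ** transpose (BlockTri blk x)"
  have "?q (x + y) - ?q x - ?q y \<in> Z"
    using Z1 assms unfolding condZ1_def
    by (intro subspace_diff[OF subsp]) (auto intro: subspace_add[OF subsp])
  then show ?thesis by (simp add: BlockTri_add mat_distribs add.commute)
qed

lemma block_step: "block_step Z (eblk blk i) (etail blk (Suc i))"
proof
  let ?e = "eblk blk i" and ?E = "etail blk (Suc i)"
  note entry = eblk_diag_proj etail_def diag_proj_mult_left diag_proj_mult_right
  show "subspace Z" "Z \<subseteq> Sym" by (fact subsp ZSym)+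
  show "sym_idem ?e" "sym_idem ?E"
    by (simp_all add: eblk_diag_proj etail_def sym_idem_diag_proj)
  show "?e ** ?E = 0" "?E ** ?e = 0"
    unfolding eblk_diag_proj etail_def by (rule diag_proj_disjoint; auto)+
  have eT: "transpose ?e = ?e" "?e ** ?e = ?e" "transpose ?E = ?E"
    using sym_idem_diag_proj by (auto simp: sym_idem_def eblk_diag_proj etail_def)
  have sym: "transpose x = x" if "x \<in> Z" for x using ZSym that by (auto simp: Sym_def)
  show "?e ** x ** ?e \<in> Z" if "x \<in> Z" for x
  proof -
    have "?e ** x ** ?e = (\<chi> a b. if blk a = i \<and> blk b = i then x $ a $ b else 0)"
      by (simp add: vec_eq_iff entry)
    then show ?thesis using block_mask[OF that, of "\<lambda>p q. p = i \<and> q = i" "\<lambda>_. False"] by auto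
  qed
  show "?E ** x ** ?E \<in> Z" if "x \<in> Z" for x
  proof -
    have "?E ** x ** ?E = (\<chi> a b. if Suc i \<le> blk a \<and> Suc i \<le> blk b then x $ a $ b else 0)"
      by (simp add: vec_eq_iff entry)
    then show ?thesis using block_mask[OF that, of "\<lambda>p q. Suc i \<le> p \<and> Suc i \<le> q" "\<lambda>j. Suc i \<le> j"] by auto
  qed
  show Exe: "?E ** x ** ?e + ?e ** x ** ?E \<in> Z" if "x \<in> Z" for x
  proof -
    have "?E ** x ** ?e + ?e ** x ** ?E
        = (\<chi> a b. if Suc i \<le> blk a \<and> blk b = i \<or> blk a = i \<and> Suc i \<le> blk b then x $ a $ b else 0)"
      by (auto simp: vec_eq_iff entry)
    moreover have "(Suc i \<le> p \<and> q = i \<or> p = i \<and> Suc i \<le> q) = (min p q = i)" if "p \<noteq> q" for p q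
      using that by (auto simp: min_def)
    ultimately show ?thesis
      using block_mask[OF that, of "\<lambda>p q. Suc i \<le> p \<and> q = i \<or> p = i \<and> Suc i \<le> q" "\<lambda>j. j = i"]
      by simp
  qed
  have BT_M: "BlockTri blk x = x" if "?e ** x ** ?e = x" for x
  proof -
    have z: "x $ a $ b = 0" if "\<not> (blk a = i \<and> blk b = i)" for a b
      using arg_cong[OF \<open>?e ** x ** ?e = x\<close>, of "\<lambda>x. x $ a $ b"] that by (simp add: entry split: if_splits)
    show ?thesis
      by (simp add: BlockTri_def vec_eq_iff) (metis z order_refl)
  qed
  \<comment> \<open>\<open>BlockTri\<close> keeps only the lower half of the off-diagonal part.
    Hence (Z1) applied to this part gives \<open>ExexE\<close>, and polarised against a diagonal
    block it gives \<open>right_mult\<close>; on two diagonal blocks \<open>BT_M\<close> gives the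
    Jordan product.\<close>
  have BT_L: "BlockTri blk (?E ** x ** ?e + ?e ** x ** ?E) = ?E ** x ** ?e" for x
    by (auto simp: BlockTri_def vec_eq_iff entry)
  show "x ** y + y ** x \<in> Z" if "x \<in> Z" "y \<in> Z" "?e ** x ** ?e = x" "?e ** y ** ?e = y" for x y
    using Z1_polar[OF that(1,2)] by (simp add: BT_M that sym)
  show "?E ** x ** y + y ** x ** ?E \<in> Z" if "x \<in> Z" "y \<in> Z" "?e ** y ** ?e = y" for x y
  proof -
    have "?e ** y = y" "y ** ?e = y"
      using that(3) eT(2) by (metis matrix_mul_assoc)+
    then have "?E ** x ** ?e ** y = ?E ** x ** y" "y ** (?e ** x ** ?E) = y ** x ** ?E"
      by (simp_all add: matrix_mul_assoc') (simp_all add: matrix_mul_assoc)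
    then show ?thesis
      using Z1_polar[OF Exe[OF that(1)] that(2)]
      by (simp add: BT_L BT_M that sym matrix_transpose_mul eT matrix_mul_assoc)
  qed
  show "?E ** x ** ?e ** x ** ?E \<in> Z" if "x \<in> Z" for x
  proof -
    have "?E ** x ** ?e ** transpose (?E ** x ** ?e) \<in> Z"
      using Z1[unfolded condZ1_def, rule_format, OF Exe[OF that]] by (simp only: BT_L)
    moreover have "?e ** (?e ** y) = ?e ** y" for y :: "real^'n^'n"
      by (simp add: matrix_mul_assoc eT(2))
    ultimately show ?thesis
      by (simp add: matrix_transpose_mul eT sym[OF that] matrix_mul_assoc')
  qed
qed

lemma Mblk_eq: "Mblk blk Z i = {x \<in> Z. eblk blk i ** x ** eblk blk i = x}"
  by (auto simp: Mblk_def vec_eq_iff eblk_diag_proj diag_proj_mult_left diag_proj_mult_right split: if_splits)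

lemma Lblk_eq: "Lblk blk Z i = {l \<in> Z. etail blk (Suc i) ** l ** eblk blk i + eblk blk i ** l ** etail blk (Suc i) = l}"
proof -
  have "(etail blk (Suc i) ** l ** eblk blk i + eblk blk i ** l ** etail blk (Suc i)) $ a $ b
     = (if (blk a > blk b \<and> blk b = i) \<or> (blk b > blk a \<and> blk a = i) then l $ a $ b else 0)" for l a b
    by (auto simp: etail_def eblk_diag_proj diag_proj_mult_left diag_proj_mult_right)
  then show ?thesis
    unfolding Lblk_def vec_eq_iff by (auto split: if_splits)
qed

lemma hspace_eq:
  "hspace blk Z i c d \<alpha> = {(\<Sum>\<beta>\<in>{\<alpha><..<d}. c \<beta>) ** y ** c \<alpha> + l ** c \<alpha> | y l.
     y \<in> Mblk blk Z i \<and> l \<in> Z \<and> etail blk (Suc i) ** l ** eblk blk i + eblk blk i ** l ** etail blk (Suc i) = l}"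
  unfolding hspace_def Lblk_eq by blast

end

text \<open>Multiplying \<open>a ** b + b ** a = 0\<close> by \<open>a\<close> from the left and
  from the right shows that both products equal \<open>- (a ** b ** a)\<close>, so they agree and
  their sum is twice either.\<close>

lemma idempotents_orthogonal:
  fixes a b :: "real^'n^'n"
  assumes "a ** a = a" "jprod a b = 0"
  shows "a ** b = 0"
proof -
  have s: "a ** b + b ** a = 0" using assms(2) by (simp add: jprod_def)
  have "a ** (a ** b + b ** a) = a ** b + a ** b ** a" "(a ** b + b ** a) ** a = a ** b ** a + b ** a"
    using assms(1) by (simp_all add: mat_distribs) (simp_all add: matrix_mul_assoc assms(1))
  then have "a ** b + a ** b ** a = 0" "a ** b ** a + b ** a = 0"
    using s by (simp_all add: mat_zeros)
  then have "a ** b = b ** a" by (metis add.commute add_left_cancel)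
  then show ?thesis using s by (simp flip: scaleR_2)
qed

lemma idempotent_jprod: "jprod a a = a \<longleftrightarrow> a ** a = (a :: real^'n^'n)"
  by (simp add: jprod_def flip: scaleR_2)

lemma chain_product:
  fixes a :: "nat \<Rightarrow> 'a::comm_monoid_mult"
  assumes "\<And>k. k < n \<Longrightarrow> a k = b k * a (Suc k)"
  shows "a 0 = (\<Prod>k<n. b k) * a n"
  using assms by (induction n) (auto simp: mult.assoc)

section \<open>Jordan frames and the product over all idempotents\<close>

locale wishart_setup = block_space blk r Z
  for blk :: "'n::finite \<Rightarrow> nat" and r :: nat and Z :: "(real^'n^'n) set" +
  fixes A :: "real^'n^'n" and s :: real
    and c :: "nat \<Rightarrow> nat \<Rightarrow> real^'n^'n" and d :: "nat \<Rightarrow> nat"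
    and f :: "nat \<Rightarrow> nat \<Rightarrow> nat \<Rightarrow> real^'n^'n"
  assumes A: "A \<in> SymPos"
    and frames: "\<And>i. i < r \<Longrightarrow> jordan_frame (Mblk blk Z i) (eblk blk i) (c i) (d i)"
    and hbases: "\<And>i \<alpha>. i < r \<Longrightarrow> \<alpha> < d i \<Longrightarrow>
      orthonormal_basis (hspace blk Z i (c i) (d i) \<alpha>) (f i \<alpha>) (m_sc blk Z c d i \<alpha>)"
begin

lemma frame_idem: "i < r \<Longrightarrow> \<alpha> < d i \<Longrightarrow> c i \<alpha> ** c i \<alpha> = c i \<alpha>"
  and frame_orth: "i < r \<Longrightarrow> \<alpha> < d i \<Longrightarrow> \<beta> < d i \<Longrightarrow> \<alpha> \<noteq> \<beta> \<Longrightarrow> c i \<alpha> ** c i \<beta> = 0"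
  and frame_M: "i < r \<Longrightarrow> \<alpha> < d i \<Longrightarrow> c i \<alpha> \<in> Mblk blk Z i"
  and frame_nonzero: "i < r \<Longrightarrow> \<alpha> < d i \<Longrightarrow> c i \<alpha> \<noteq> 0"
  and frame_sum: "i < r \<Longrightarrow> (\<Sum>\<alpha><d i. c i \<alpha>) = eblk blk i"
  and frame_max: "i < r \<Longrightarrow> orth_idem_family (Mblk blk Z i) c' k \<Longrightarrow> k \<le> d i"
proof -
  note fr = frames[unfolded jordan_frame_def orth_idem_family_def idempotent_jprod]
  show idem: "c i \<alpha> ** c i \<alpha> = c i \<alpha>" if "i < r" "\<alpha> < d i" for i \<alpha>
    using fr[OF that(1)] that(2) by blast
  show "i < r \<Longrightarrow> \<alpha> < d i \<Longrightarrow> \<beta> < d i \<Longrightarrow> \<alpha> \<noteq> \<beta> \<Longrightarrow> c i \<alpha> ** c i \<beta> = 0"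
    using fr[of i] by (intro idempotents_orthogonal idem) auto
  show "i < r \<Longrightarrow> \<alpha> < d i \<Longrightarrow> c i \<alpha> \<in> Mblk blk Z i" "i < r \<Longrightarrow> \<alpha> < d i \<Longrightarrow> c i \<alpha> \<noteq> 0"
    "i < r \<Longrightarrow> (\<Sum>\<alpha><d i. c i \<alpha>) = eblk blk i"
    using fr[of i] by auto
  show "i < r \<Longrightarrow> orth_idem_family (Mblk blk Z i) c' k \<Longrightarrow> k \<le> d i"
    using frames[of i] unfolding jordan_frame_def by blast
qed

text \<open>Otherwise replacing \<open>c i \<alpha>\<close> by \<open>u\<close> and \<open>c i \<alpha> - u\<close> gives a longer orthogonal family.\<close>
lemma frame_primitive:
  assumes i: "i < r" "\<alpha> < d i" and u: "u \<in> Mblk blk Z i" "u ** u = u" "c i \<alpha> ** u ** c i \<alpha> = u"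
  shows "u = 0 \<or> u = c i \<alpha>"
proof (rule ccontr)
  assume n: "\<not> ?thesis"
  note ci = frame_idem[OF i]
  have uc: "c i \<alpha> ** u = u" "u ** c i \<alpha> = u"
    using u(3) ci by (metis matrix_mul_assoc)+
  have orth: "u ** c i \<beta> = 0" "c i \<beta> ** u = 0" if "\<beta> < d i" "\<beta> \<noteq> \<alpha>" for \<beta>
    using uc frame_orth[OF i(1) i(2) that(1)] frame_orth[OF i(1) that(1) i(2)] that(2)
    by (metis matrix_mul_assoc mmult.zero_left mmult.zero_right)+
  define c' where "c' = (\<lambda>\<beta>. if \<beta> = d i then c i \<alpha> - u else if \<beta> = \<alpha> then u else c i \<beta>)"
  have "c i \<alpha> - u \<in> Mblk blk Z i"
    using frame_M[OF i] u(1) block_step.subspace_M[OF block_step, of i] Mblk_eq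
    unfolding block_step.M_def[OF block_step] by (metis subspace_diff)
  then have mem: "c' \<beta> \<in> Mblk blk Z i \<and> c' \<beta> \<noteq> 0 \<and> c' \<beta> ** c' \<beta> = c' \<beta>" if "\<beta> < Suc (d i)" for \<beta>
    using that n u frame_M[OF i(1)] frame_nonzero[OF i(1)] frame_idem[OF i(1)] i(2)
    by (auto simp: c'_def less_Suc_eq mat_distribs uc)
  have orth': "c' \<beta> ** c' \<gamma> = 0" if "\<beta> < Suc (d i)" "\<gamma> < Suc (d i)" "\<beta> \<noteq> \<gamma>" for \<beta> \<gamma>
    using that i(2) orth frame_orth[OF i(1)]
    by (auto simp: c'_def less_Suc_eq mat_distribs uc u(2))
  have "orth_idem_family (Mblk blk Z i) c' (Suc (d i))"
    unfolding orth_idem_family_def idempotent_jprod using mem orth'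
    by (auto simp: jprod_def)
  from frame_max[OF i(1) this] show False by simp
qed

text \<open>The sum of the idempotents not yet removed when \<open>c i \<alpha>\<close> is next; at
  \<open>\<alpha> = d i\<close> it is the projection onto the later blocks, which is where the next
  block takes over.\<close>

definition "tail i \<alpha> = (\<Sum>\<beta>\<in>{\<alpha>..<d i}. c i \<beta>) + etail blk (Suc i)"

lemma tail_rec: "\<alpha> < d i \<Longrightarrow> tail i \<alpha> = c i \<alpha> + tail i (Suc \<alpha>)"
  by (simp add: tail_def sum.atLeast_Suc_lessThan)

lemma peel:
  assumes i: "i < r" "\<alpha> < d i"
  shows "peel Z (c i \<alpha>) (tail i (Suc \<alpha>)) (f i \<alpha>) (m_sc blk Z c d i \<alpha>) A"
proof -
  let ?c = "c i \<alpha>" and ?E = "etail blk (Suc i)"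
  interpret b: block_step Z "eblk blk i" ?E by (rule block_step)
  have M: "Mblk blk Z i = b.M" by (simp add: Mblk_eq b.M_def)
  define q where "q = (\<Sum>\<beta>\<in>{Suc \<alpha>..<d i}. c i \<beta>)"
  have cM: "c i \<beta> \<in> b.M" if "\<beta> < d i" for \<beta> using frame_M[OF i(1) that] M by simp
  have qM: "q \<in> b.M"
    unfolding q_def by (intro subspace_sum[OF b.subspace_M] cM) simp
  have cq: "?c ** q = 0" "q ** ?c = 0"
    unfolding q_def mmult.sum_left mmult.sum_right
    using frame_orth[OF i(1)] i(2) by (auto intro!: sum.neutral)
  have cbq: "c i \<beta> ** q = c i \<beta>" if "\<beta> \<in> {Suc \<alpha>..<d i}" for \<beta>
  proof -
    have "c i \<beta> ** q = (\<Sum>\<gamma>\<in>{Suc \<alpha>..<d i}. if \<gamma> = \<beta> then c i \<beta> else 0)"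
      unfolding q_def mmult.sum_right
      using frame_orth[OF i(1)] frame_idem[OF i(1)] that by (intro sum.cong) auto
    then show ?thesis using that by simp
  qed
  then have qq: "q ** q = q"
    by (subst q_def, subst mmult.sum_left) (simp add: q_def)
  have sym: "transpose x = x" if "x \<in> b.M" for x
    using that ZSym by (auto simp: b.M_def Sym_def)
  have Q: "tail i (Suc \<alpha>) = q + ?E" by (simp add: tail_def q_def)
  have c: "sym_idem ?c" using frame_idem[OF i] sym[OF cM[OF i(2)]] by (simp add: sym_idem_def)
  show ?thesis
    unfolding Q
  proof
    show "subspace Z" "Z \<subseteq> Sym" by (fact subsp ZSym)+
    show "sym_idem ?c" by (fact c)
    show "?c \<noteq> 0" by (rule frame_nonzero[OF i])
    show "?c \<in> Z" by (rule b.M_Z[OF cM[OF i(2)]])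
    show "sym_idem (q + ?E)"
      by (simp add: sym_idem_def mat_distribs sym[OF qM] qq b.eT b.MD[OF qM])
    show "?c ** (q + ?E) = 0" "(q + ?E) ** ?c = 0"
      by (simp_all add: mat_distribs cq b.MD[OF cM[OF i(2)]])
    show "\<exists>l. ?c ** x ** ?c = l *\<^sub>R ?c" if "x \<in> Z" for x
      using b.cxc[OF c cM[OF i(2)] frame_nonzero[OF i] that] frame_primitive[OF i] M by metis
    show "(q + ?E) ** x ** (q + ?E) \<in> Z" if "x \<in> Z" for x
      by (rule b.QxQ[OF qM that])
    show "(q + ?E) ** x ** ?c + ?c ** x ** (q + ?E) \<in> Z" if "x \<in> Z" for x
      by (rule b.Qxc[OF qM cM[OF i(2)] that])
    show "(q + ?E) ** x ** ?c ** x ** (q + ?E) \<in> Z" if "x \<in> Z" for x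
      by (rule b.QxcxQ[OF qM cM[OF i(2)] that frame_idem[OF i] qq cq])
    have "hspace blk Z i (c i) (d i) \<alpha> = {(q + ?E) ** x ** ?c | x. x \<in> Z}"
      unfolding hspace_eq M b.h_image[OF qM cM[OF i(2)], symmetric]
      by (simp add: q_def atLeastSucLessThan_greaterThanLessThan)
    then show "orthonormal_basis {(q + ?E) ** x ** ?c | x. x \<in> Z} (f i \<alpha>) (m_sc blk Z c d i \<alpha>)"
      using hbases[OF i] by simp
    show "pos_def_mat A" using A by (simp add: SymPos_def)
  qed
qed

definition "fac i \<alpha> = step_factor (mu_sc c i \<alpha>) (m_sc blk Z c d i \<alpha>) s (det_phi blk Z c d f A i \<alpha>) (det_psi blk Z c d f A i \<alpha>)"

text \<open>The recursion telescopes twice, over the frame inside a block and then over the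
  blocks.\<close>

lemma corner_integral_full: "corner_integral Z A s (mat 1) = (\<Prod>i<r. \<Prod>\<alpha><d i. fac i \<alpha>)"
proof -
  have "corner_integral Z A s (tail i \<alpha>) = fac i \<alpha> * corner_integral Z A s (tail i (Suc \<alpha>))"
    if "i < r" "\<alpha> < d i" for i \<alpha>
  proof -
    interpret p: peel Z "c i \<alpha>" "tail i (Suc \<alpha>)" "f i \<alpha>" "m_sc blk Z c d i \<alpha>" A s
      by (rule peel[OF that])
    show ?thesis
      using p.corner_integral_step
      unfolding tail_rec[OF that(2), symmetric] p.step_factor_eq
      by (simp add: fac_def det_phi_def det_psi_def etilde_def mu_sc_def)
  qed
  then have "corner_integral Z A s (tail i 0) = (\<Prod>\<alpha><d i. fac i \<alpha>) * corner_integral Z A s (tail i (d i))"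
    if "i < r" for i
    using that by (intro chain_product) auto
  moreover have "tail i 0 = etail blk i" if "i < r" for i
    using frame_sum[OF that] by (simp add: tail_def atLeast0LessThan etail_rec[of blk i])
  ultimately have "corner_integral Z A s (etail blk i) = (\<Prod>\<alpha><d i. fac i \<alpha>) * corner_integral Z A s (etail blk (Suc i))"
    if "i < r" for i
    using that by (simp add: tail_def)
  then have "corner_integral Z A s (etail blk 0) = (\<Prod>i<r. \<Prod>\<alpha><d i. fac i \<alpha>) * corner_integral Z A s (etail blk r)"
    by (rule chain_product)
  moreover have "etail blk 0 = mat 1"
    by (simp add: etail_def diag_proj_def mat_def)
  moreover have "etail blk r = 0"
    using blk by (auto simp: etail_def diag_proj_def vec_eq_iff) (metis lessThan_iff not_le rangeI)
  \<comment> \<open>The corner of 0 is the zero space with empty basis, where the weight is that of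
    the identity matrix.\<close>
  moreover have "corner_integral Z A s 0 = 1"
  proof -
    have "corner_integral Z A s 0 = iter_integral [] (corner_weight A s 0)"
      using subspace_0[OF subsp]
      by (intro corner_integral_eq) (auto simp: orthonormal_list_def corner_def mat_zeros)
    also have "\<dots> = 1"
      by (simp add: corner_weight_def SymPos_def pos_def_mat_def mat_zeros trace_def)
    finally show ?thesis .
  qed
  ultimately show ?thesis by simp
qed

end

context wishart_setup
begin

lemma structure_constants_pos:
  assumes i: "i < r" "\<alpha> < d i"
  shows "0 < mu_sc c i \<alpha>" "0 < det_phi blk Z c d f A i \<alpha>" "0 < det_psi blk Z c d f A i \<alpha>"
proof -
  interpret p: peel Z "c i \<alpha>" "tail i (Suc \<alpha>)" "f i \<alpha>" "m_sc blk Z c d i \<alpha>" A s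
    by (rule peel[OF i])
  show "0 < mu_sc c i \<alpha>" "0 < det_phi blk Z c d f A i \<alpha>" "0 < det_psi blk Z c d f A i \<alpha>"
    using p.rank_pos p.gram_dets_pos by (simp_all add: mu_sc_def det_phi_def det_psi_def etilde_def)
qed

lemma nn_integral_wishart:
  assumes J: "orthonormal_basis Z J (dim Z)"
  shows "(\<integral>\<^sup>+ t. ennreal (wishart_integrand A s J (dim Z) t) \<partial>coord_measure (dim Z)) = (\<Prod>i<r. \<Prod>\<alpha><d i. fac i \<alpha>)"
proof -
  have "(\<integral>\<^sup>+ t. ennreal (wishart_integrand A s J (dim Z) t) \<partial>coord_measure (dim Z))
      = (\<integral>\<^sup>+ t. corner_weight A s (mat 1) (\<Sum>k<dim Z. t k *\<^sub>R J k) \<partial>coord_measure (dim Z))"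
    by (simp add: wishart_integrand_def corner_weight_def from_coords_def Let_def)
  also have "\<dots> = iter_integral (map J [0..<dim Z]) (corner_weight A s (mat 1))"
    by (rule nn_integral_coord_measure) measurable
  also have "\<dots> = corner_integral Z A s (mat 1)"
  proof (rule corner_integral_eq[symmetric])
    show "orthonormal_list (map J [0..<dim Z])"
      using J by (intro orthonormal_list_map_upt) (simp add: orthonormal_basis_def)
    show "span (set (map J [0..<dim Z])) = corner Z (mat 1)"
      using J by (simp add: orthonormal_basis_def corner_def atLeast0LessThan)
  qed
  finally show ?thesis by (simp add: corner_integral_full)
qed

lemma borel_measurable_wishart_integrand:
  "wishart_integrand A s J N \<in> borel_measurable (coord_measure N)"
proof -
  have [measurable]: "(\<lambda>t. from_coords J N t) \<in> measurable (coord_measure N) borel"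
    unfolding from_coords_def coord_measure_def by measurable
  show ?thesis
    unfolding wishart_integrand_def Let_def by measurable
qed

end

theorem theorem4p14:
  fixes blk :: "'n::{finite,linorder} \<Rightarrow> nat" and r :: nat
    and Z :: "(real^'n::{finite,linorder}^'n::{finite,linorder}) set" and A :: "real^'n::{finite,linorder}^'n::{finite,linorder}" and s :: real
    and c :: "nat \<Rightarrow> nat \<Rightarrow> real^'n::{finite,linorder}^'n::{finite,linorder}" and d :: "nat \<Rightarrow> nat"
    and f :: "nat \<Rightarrow> nat \<Rightarrow> nat \<Rightarrow> real^'n::{finite,linorder}^'n::{finite,linorder}"
    and J :: "nat \<Rightarrow> real^'n::{finite,linorder}^'n::{finite,linorder}"
  defines "\<mu> \<equiv> mu_sc c" and "m \<equiv> m_sc blk Z c d"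
  assumes part: "ordered_partition blk r"
    and subsp: "subspace Z" and ZSym: "Z \<subseteq> Sym"
    and Z0: "condZ0 blk r Z" and Z1: "condZ1 blk Z"
    and Apos: "A \<in> SymPos"
    and frames: "\<forall>i<r. jordan_frame (Mblk blk Z i) (eblk blk i) (c i) (d i)"
    and hbases: "\<forall>i<r. \<forall>\<alpha><d i. orthonormal_basis (hspace blk Z i (c i) (d i) \<alpha>) (f i \<alpha>) (m i \<alpha>)"
    and Zbasis: "orthonormal_basis Z J (dim Z)"
  shows "(integrable (coord_measure (dim Z)) (wishart_integrand A s J (dim Z)) \<longleftrightarrow>
           s > Max {- (2 + real (m i \<alpha>)) / (2 * real (\<mu> i \<alpha>)) | i \<alpha>. i < r \<and> \<alpha> < d i}) \<and>
         (s > Max {- (2 + real (m i \<alpha>)) / (2 * real (\<mu> i \<alpha>)) | i \<alpha>. i < r \<and> \<alpha> < d i} \<longrightarrow>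
         integral\<^sup>L (coord_measure (dim Z)) (wishart_integrand A s J (dim Z)) =
         exp (- (\<Sum>i<r. \<Sum>\<alpha><d i. real (\<mu> i \<alpha>) * ln (real (\<mu> i \<alpha>))) * s
              - (1/2) * (\<Sum>i<r. \<Sum>\<alpha><d i. (ln (real (\<mu> i \<alpha>)) - ln (2 * pi)) * real (m i \<alpha>)
                                             + ln (real (\<mu> i \<alpha>)))) *
         (\<Prod>i<r. \<Prod>\<alpha><d i.
            Gamma (real (\<mu> i \<alpha>) * s + 1 + real (m i \<alpha>) / 2) *
            (det_phi blk Z c d f A i \<alpha> / det_psi blk Z c d f A i \<alpha>)
              powr (- real (\<mu> i \<alpha>) * s - 1 - real (m i \<alpha>) / 2) *
            det_psi blk Z c d f A i \<alpha> powr (- 1 / 2)))"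
proof -
  interpret w: wishart_setup blk r Z A s c d f
    by unfold_locales (use part subsp ZSym Z0 Z1 Apos frames hbases in \<open>auto simp: ordered_partition_def m_def\<close>)
  let ?W = "wishart_integrand A s J (dim Z)" and ?M = "coord_measure (dim Z)"
  let ?D = "det_phi blk Z c d f A" and ?P = "det_psi blk Z c d f A"
  let ?S = "{- (2 + real (m i \<alpha>)) / (2 * real (\<mu> i \<alpha>)) | i \<alpha>. i < r \<and> \<alpha> < d i}"
  define I where "I = Sigma {..<r} (\<lambda>i. {..<d i})"
  have I: "finite I" by (simp add: I_def)
  have pos: "0 < \<mu> i \<alpha>" "0 < ?D i \<alpha>" "0 < ?P i \<alpha>" if "(i, \<alpha>) \<in> I" for i \<alpha>
    using w.structure_constants_pos[of i \<alpha>] that by (auto simp: \<mu>_def I_def)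
  define V where "V i \<alpha> = real (\<mu> i \<alpha>) powr (- (\<mu> i \<alpha> * s) - m i \<alpha> / 2 - 1 / 2) * (2 * pi) powr (m i \<alpha> / 2)
      * Gamma (\<mu> i \<alpha> * s + m i \<alpha> / 2 + 1) * (?D i \<alpha> / ?P i \<alpha>) powr (- (\<mu> i \<alpha> * s) - m i \<alpha> / 2 - 1)
      * ?P i \<alpha> powr (- 1 / 2)" for i \<alpha>
  define ok where "ok i \<alpha> \<longleftrightarrow> -1 < \<mu> i \<alpha> * s + m i \<alpha> / 2" for i \<alpha>
  have fac: "w.fac i \<alpha> = (if ok i \<alpha> then ennreal (V i \<alpha>) else \<infinity>)" for i \<alpha>
    by (simp add: w.fac_def step_factor_def V_def ok_def \<mu>_def m_def)
  have V_pos: "0 < V i \<alpha>" if "(i, \<alpha>) \<in> I" "ok i \<alpha>" for i \<alpha>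
    unfolding V_def using pos[OF that(1)] that(2)
    by (intro mult_pos_pos Gamma_real_pos) (auto simp: ok_def)
  have nn: "(\<integral>\<^sup>+ t. ennreal (?W t) \<partial>?M) = (\<Prod>(i, \<alpha>)\<in>I. w.fac i \<alpha>)"
    unfolding w.nn_integral_wishart[OF Zbasis] I_def by (simp add: prod.Sigma)
  have W_nonneg: "0 \<le> ?W t" for t
    by (simp add: wishart_integrand_def Let_def)
  have W_meas: "?W \<in> borel_measurable ?M"
    by (rule w.borel_measurable_wishart_integrand)
  have S: "?S = (\<lambda>(i, \<alpha>). - (2 + real (m i \<alpha>)) / (2 * real (\<mu> i \<alpha>))) ` I"
    by (force simp: I_def)
  \<comment> \<open>\<open>Max\<close> of the empty set would be unspecified. The block of any index
    has a nonzero identity, so its frame is nonempty.\<close>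
  have "I \<noteq> {}"
  proof -
    have "blk undefined < r" using w.blk by blast
    moreover have "eblk blk (blk undefined) \<noteq> 0"
      by (auto simp: eblk_def vec_eq_iff)
    then have "d (blk undefined) \<noteq> 0"
      using w.frame_sum[OF \<open>blk undefined < r\<close>] by (metis lessThan_0 sum.empty)
    ultimately show ?thesis by (auto simp: I_def)
  qed
  then have "s > Max ?S \<longleftrightarrow> (\<forall>(i, \<alpha>)\<in>I. - (2 + real (m i \<alpha>)) / (2 * real (\<mu> i \<alpha>)) < s)"
    unfolding S using I by (subst Max_less_iff) auto
  also have "\<dots> \<longleftrightarrow> (\<forall>(i, \<alpha>)\<in>I. ok i \<alpha>)"
    using pos(1) by (intro ball_cong refl) (auto simp: ok_def field_simps)
  finally have Max: "s > Max ?S \<longleftrightarrow> (\<forall>(i, \<alpha>)\<in>I. ok i \<alpha>)" .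
  have fin: "(\<Prod>(i, \<alpha>)\<in>I. w.fac i \<alpha>) = ennreal (\<Prod>(i, \<alpha>)\<in>I. V i \<alpha>)" if "\<forall>(i, \<alpha>)\<in>I. ok i \<alpha>"
    using that V_pos by (subst prod_ennreal[symmetric]) (force simp: fac intro!: prod.cong intro: less_imp_le)+
  \<comment> \<open>In \<open>ennreal\<close> a product with a zero factor is 0 even if another
    factor is infinite, so the strict positivity of all factors is what lets one divergent Gamma
    integral prevail.\<close>
  have inf: "(\<Prod>(i, \<alpha>)\<in>I. w.fac i \<alpha>) = \<infinity>" if "\<not> (\<forall>(i, \<alpha>)\<in>I. ok i \<alpha>)"
    unfolding infinity_ennreal_def ennreal_prod_eq_top
  proof (intro conjI ballI I)
    fix p assume "p \<in> I"
    then show "(case p of (i, \<alpha>) \<Rightarrow> w.fac i \<alpha>) \<noteq> 0"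
      using V_pos[of "fst p" "snd p"] by (cases p) (auto simp: fac ennreal_eq_0_iff)
  next
    show "\<exists>p\<in>I. (case p of (i, \<alpha>) \<Rightarrow> w.fac i \<alpha>) = top"
      using that by (auto simp: fac intro!: bexI)
  qed
  have "integrable ?M ?W \<longleftrightarrow> (\<integral>\<^sup>+ t. ennreal (?W t) \<partial>?M) < \<infinity>"
    using W_meas W_nonneg by (simp add: integrable_iff_bounded)
  also have "\<dots> \<longleftrightarrow> s > Max ?S"
    unfolding nn Max using fin inf by (metis ennreal_less_top less_irrefl infinity_ennreal_def)
  finally have int: "integrable ?M ?W \<longleftrightarrow> s > Max ?S" .
  \<comment> \<open>The powers of \<open>\<mu> i \<alpha>\<close> and \<open>2 * pi\<close> are
    written as exponentials; their exponents are the summands that add up to the constants p and q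
    of the formula.\<close>
  have V_eq: "V i \<alpha> = exp (- (\<mu> i \<alpha> * ln (\<mu> i \<alpha>)) * s - (1/2) * ((ln (\<mu> i \<alpha>) - ln (2 * pi)) * m i \<alpha> + ln (\<mu> i \<alpha>)))
      * (Gamma (\<mu> i \<alpha> * s + 1 + m i \<alpha> / 2) * (?D i \<alpha> / ?P i \<alpha>) powr (- real (\<mu> i \<alpha>) * s - 1 - m i \<alpha> / 2)
        * ?P i \<alpha> powr (- 1 / 2))" if "(i, \<alpha>) \<in> I" for i \<alpha>
  proof -
    have "real (\<mu> i \<alpha>) powr (- (\<mu> i \<alpha> * s) - m i \<alpha> / 2 - 1 / 2) * (2 * pi) powr (m i \<alpha> / 2)
        = exp (- (\<mu> i \<alpha> * ln (\<mu> i \<alpha>)) * s - (1/2) * ((ln (\<mu> i \<alpha>) - ln (2 * pi)) * m i \<alpha> + ln (\<mu> i \<alpha>)))"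
      using pos(1)[OF that] by (simp add: powr_def exp_add[symmetric]) (simp add: field_simps)
    moreover have "\<mu> i \<alpha> * s + m i \<alpha> / 2 + 1 = \<mu> i \<alpha> * s + 1 + m i \<alpha> / 2"
      "- (\<mu> i \<alpha> * s) - m i \<alpha> / 2 - 1 = - real (\<mu> i \<alpha>) * s - 1 - m i \<alpha> / 2" by simp_all
    ultimately show ?thesis unfolding V_def by (simp only: mult.assoc)
  qed
  have "integral\<^sup>L ?M ?W = (\<Prod>(i, \<alpha>)\<in>I. V i \<alpha>)" if "s > Max ?S"
  proof -
    have "\<forall>(i, \<alpha>)\<in>I. ok i \<alpha>" using that Max by blast
    moreover have "0 \<le> (\<Prod>(i, \<alpha>)\<in>I. V i \<alpha>)"
      using calculation V_pos by (intro prod_nonneg) (force intro: less_imp_le)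
    ultimately show ?thesis
      by (subst integral_eq_nn_integral[OF W_meas]) (simp_all add: W_nonneg nn fin)
  qed
  also have "(\<Prod>(i, \<alpha>)\<in>I. V i \<alpha>)
      = exp (\<Sum>(i, \<alpha>)\<in>I. - (\<mu> i \<alpha> * ln (\<mu> i \<alpha>)) * s - (1/2) * ((ln (\<mu> i \<alpha>) - ln (2 * pi)) * m i \<alpha> + ln (\<mu> i \<alpha>)))
        * (\<Prod>(i, \<alpha>)\<in>I. Gamma (\<mu> i \<alpha> * s + 1 + m i \<alpha> / 2) * (?D i \<alpha> / ?P i \<alpha>) powr (- real (\<mu> i \<alpha>) * s - 1 - m i \<alpha> / 2)
        * ?P i \<alpha> powr (- 1 / 2))"
    unfolding exp_sum[OF I] prod.distrib[symmetric] by (intro prod.cong refl) (auto simp: V_eq)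
  also have "(\<Sum>(i, \<alpha>)\<in>I. - (\<mu> i \<alpha> * ln (\<mu> i \<alpha>)) * s - (1/2) * ((ln (\<mu> i \<alpha>) - ln (2 * pi)) * m i \<alpha> + ln (\<mu> i \<alpha>)))
      = - (\<Sum>i<r. \<Sum>\<alpha><d i. real (\<mu> i \<alpha>) * ln (real (\<mu> i \<alpha>))) * s
              - (1/2) * (\<Sum>i<r. \<Sum>\<alpha><d i. (ln (real (\<mu> i \<alpha>)) - ln (2 * pi)) * real (m i \<alpha>)
                                             + ln (real (\<mu> i \<alpha>)))"
    unfolding I_def by (subst sum.Sigma[symmetric]) (simp_all add: sum_subtractf sum_distrib_left sum_distrib_right sum_negf)
  finally show ?thesis
    using int unfolding I_def by (simp add: prod.Sigma)
qed

end
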